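(* Let $(Z_n)_{n\ge 0}$ be a supercritical branching process in an i.i.d. random environment satisfying the standing assumptions given in the context. Suppose that there exists a constant $\delta\in(0,1)$ such that $\mathbb{E}X^{2+\delta}=\mathbb{E}(\log m_0)^{2+\delta}<\infty$, and that there exist constants $p>1$ and $c>0$ such that $$\mathbb{E}\, m_0^c<\infty\quad\text{and}\quad\mathbb{E}\left(\frac{m_0^{(p)}}{m_0^p}\right)^c<\infty.$$ Let $\mathcal{N}$ be a standard normal random variable and $W_r(\cdot,\cdot)$ the Wasserstein distance of order $r$. Then for any $r\in[\delta,1]$ there is a constant $C>0$, not depending on $n$, such that for all $n\ge1$, $$W_r\left(\frac{\log Z_n-n\mu}{\sqrt{n}\,\sigma},\,\mathcal{N}\right)\le\frac{C}{n^{\delta/2}},$$ and for any $r\in(1,2]$ there is a constant $C>0$, not depending on $n$, such that for all $n\ge1$, $$W_r\left(\frac{\log Z_n-n\mu}{\sqrt{n}\,\sigma},\,\mathcal{N}\right)\le\frac{C}{n^{\delta/(2r)}}.$$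
   Context: Branching process in random environment: $\xi=(\xi_0,\xi_1,\ldots)$ is a sequence of i.i.d. random variables (the environment). To each $\xi_n$ is associated an offspring distribution $p(\xi_n)=\{p_k(\xi_n):k\in\mathbb{N}\}$ on $\mathbb{N}=\{0,1,2,\dots\}$. The process is defined by $Z_0=1$ and $Z_{n+1}=\sum_{i=1}^{Z_n}X_{n,i}$ for $n\ge 0$, where, given $\xi$, for each $n$ the variables $(X_{n,i})_{i\ge1}$ are i.i.d. with law $p(\xi_n)$, i.e. $\mathbb{P}(X_{n,i}=k\mid\xi_n)=p_k(\xi_n)$, and are independent of $(Z_1,\ldots,Z_n)$. $\mathbb{P}_\xi$ denotes the conditional probability given $\xi$ (quenched law), and $\mathbb{P}(dx,d\xi)=\mathbb{P}_\xi(dx)\,\tau(d\xi)$ the total (annealed) probability, where $\tau$ is the law of $\xi$; $\mathbb{E}_\xi$ and $\mathbb{E}$ are the corresponding expectations. Notation: for $p>0$, $m_n^{(p)}=\sum_{i\ge0} i^p\,p_i(\xi_n)$, and $m_n=m_n^{(1)}$; $X=\log m_0$, $\mu=\mathbb{E}X$, $\sigma^2=\mathbb{E}(X-\mu)^2$. The process is called supercritical if $\mu>0$. Standing assumptions: $\mu>0$; $p_0(\xi_0)=0$ a.s. (so $X\ge0$ and $Z_n\ge1$ a.s.); $\sigma\in(0,\infty)$; and $\mathbb{E}\left[\frac{Z_1}{m_0}\log Z_1\right]<\infty$. Wasserstein distance: for probability laws $\mu_1,\mu_2$ on $\mathbb{R}$ let $\mathcal{L}(\mu_1,\mu_2)$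 be the set of probability laws on $\mathbb{R}^2$ with marginals $\mu_1$ and $\mu_2$. For $0<r\le1$, $W_r(\mu_1,\mu_2)=\inf\{\int|x-y|^r\,Q(dx,dy):Q\in\mathcal{L}(\mu_1,\mu_2)\}$; for $r>1$, $W_r(\mu_1,\mu_2)=\inf\{(\int|x-y|^r\,Q(dx,dy))^{1/r}:Q\in\mathcal{L}(\mu_1,\mu_2)\}$. For random variables $U,V$ with laws $P_U,P_V$ (under $\mathbb{P}$), $W_r(U,V)$ means $W_r(P_U,P_V)$. *)

theory Defs
  imports "HOL-Probability.Probability"
begin

section \<open>Branching processes in an i.i.d. random environment\<close>

text \<open>
  \<open>\<nu>\<close> is the law of a single environment variable, so the law \<open>\<tau>\<close> of the i.i.d. environment
  \<open>\<xi> = (\<xi>\<^sub>0, \<xi>\<^sub>1, \<dots>)\<close> is the infinite product; \<open>\<xi>\<close> is the coordinate process.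
\<close>

definition env_law :: "'e measure \<Rightarrow> (nat \<Rightarrow> 'e) measure" where
  "env_law \<nu> = PiM UNIV (\<lambda>_. \<nu>)"

text \<open>
  The total law \<open>P(dx, d\<xi>) = P\<^sub>\<xi>(dx) \<tau>(d\<xi>)\<close> on pairs \<open>(\<xi>, x)\<close>.
\<close>

definition total_law ::
    "'e measure \<Rightarrow> 'b measure \<Rightarrow> ((nat \<Rightarrow> 'e) \<Rightarrow> 'b measure) \<Rightarrow> ((nat \<Rightarrow> 'e) \<times> 'b) measure" where
  "total_law \<nu> \<Gamma> Pq =
     env_law \<nu> \<bind> (\<lambda>\<xi>. Pq \<xi> \<bind> (\<lambda>x. return (env_law \<nu> \<Otimes>\<^sub>M \<Gamma>) (\<xi>, x)))"

primrec branching :: "(nat \<Rightarrow> nat \<Rightarrow> 'b \<Rightarrow> nat) \<Rightarrow> nat \<Rightarrow> 'b \<Rightarrow> nat" where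
  "branching V 0 x = 1"
| "branching V (Suc n) x = (\<Sum>i\<in>{1..branching V n x}. V n i x)"

text \<open>
  \<open>p \<theta>\<close> is the offspring distribution attached to the environment state \<open>\<theta>\<close>, \<open>Pq \<xi>\<close> is the quenched
  law on \<open>\<Gamma>\<close> given the environment \<open>\<xi>\<close>, and \<open>V n i\<close> is the number of children of the \<open>i\<close>-th
  individual (\<open>i \<ge> 1\<close>) of generation \<open>n\<close>.  That \<open>V n i\<close> is a function on \<open>\<Gamma>\<close> alone is no
  restriction, since \<open>\<Gamma>\<close> may itself record the environment.  Being a conditional law, \<open>Pq \<xi>\<close> is
  only constrained for almost every \<open>\<xi>\<close>.
\<close>

locale bpre =
  fixes \<nu> :: "'e measure"
    and p :: "'e \<Rightarrow> nat pmf"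
    and \<Gamma> :: "'b measure"
    and Pq :: "(nat \<Rightarrow> 'e) \<Rightarrow> 'b measure"
    and V :: "nat \<Rightarrow> nat \<Rightarrow> 'b \<Rightarrow> nat"
  assumes prob_env: "prob_space \<nu>"
    and measurable_offspring: "\<And>k. (\<lambda>\<theta>. pmf (p \<theta>) k) \<in> borel_measurable \<nu>"
    and quenched_kernel: "Pq \<in> env_law \<nu> \<rightarrow>\<^sub>M prob_algebra \<Gamma>"
    and measurable_V: "\<And>n i. i \<ge> 1 \<Longrightarrow> V n i \<in> \<Gamma> \<rightarrow>\<^sub>M count_space UNIV"
    and quenched_law: "AE \<xi> in env_law \<nu>. \<forall>n. \<forall>i\<ge>1.
      distr (Pq \<xi>) (count_space UNIV) (V n i) = measure_pmf (p (\<xi> n))"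
    and quenched_indep: "AE \<xi> in env_law \<nu>. \<forall>n.
      prob_space.indep_vars (Pq \<xi>) (\<lambda>_. count_space UNIV) (V n) {1..}"
    and quenched_indep_past: "AE \<xi> in env_law \<nu>. \<forall>n.
      prob_space.indep_var (Pq \<xi>)
        (PiM {1..n} (\<lambda>_. count_space UNIV)) (\<lambda>x. \<lambda>k\<in>{1..n}. branching V k x)
        (PiM {1..} (\<lambda>_. count_space UNIV)) (\<lambda>x. \<lambda>i\<in>{1..}. V n i x)"


section \<open>Moments\<close>

text \<open>Powers with positive exponent on \<open>[0, \<infinity>]\<close>.\<close>

definition ennpowr :: "ennreal \<Rightarrow> real \<Rightarrow> ennreal" where
  "ennpowr x a = (if x = \<infinity> then \<infinity> else ennreal (enn2real x powr a))"

definition offspring_moment :: "('e \<Rightarrow> nat pmf) \<Rightarrow> real \<Rightarrow> 'e \<Rightarrow> ennreal" where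
  "offspring_moment p q \<theta> = (\<Sum>i. ennreal (real i powr q * pmf (p \<theta>) i))"

text \<open>
  \<open>X = log m\<^sub>0\<close>; the value 0 that this expression takes where \<open>m\<^sub>0 = \<infinity>\<close> plays no role, because
  \<open>m\<^sub>0 < \<infinity>\<close> almost surely is required wherever \<open>X\<close> is used.
\<close>

definition log_mean :: "('e \<Rightarrow> nat pmf) \<Rightarrow> (nat \<Rightarrow> 'e) \<times> 'b \<Rightarrow> real" where
  "log_mean p \<omega> = ln (enn2real (offspring_moment p 1 (fst \<omega> 0)))"

definition drift :: "'e measure \<Rightarrow> ('e \<Rightarrow> nat pmf) \<Rightarrow> 'b measure \<Rightarrow> ((nat \<Rightarrow> 'e) \<Rightarrow> 'b measure) \<Rightarrow> real"
  where "drift \<nu> p \<Gamma> Pq = (\<integral>\<omega>. log_mean p \<omega> \<partial>total_law \<nu> \<Gamma> Pq)"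

definition volatility ::
    "'e measure \<Rightarrow> ('e \<Rightarrow> nat pmf) \<Rightarrow> 'b measure \<Rightarrow> ((nat \<Rightarrow> 'e) \<Rightarrow> 'b measure) \<Rightarrow> real" where
  "volatility \<nu> p \<Gamma> Pq =
     sqrt (\<integral>\<omega>. (log_mean p \<omega> - drift \<nu> p \<Gamma> Pq)\<^sup>2 \<partial>total_law \<nu> \<Gamma> Pq)"

text \<open>
  The standing assumptions.  The first two conditions and integrability of the square spell out
  that \<open>\<mu>\<close> and \<open>\<sigma>\<close> exist and are finite.
\<close>

locale supercritical_bpre = bpre +
  assumes mean_finite: "AE \<omega> in total_law \<nu> \<Gamma> Pq. offspring_moment p 1 (fst \<omega> 0) < \<infinity>"
    and integrable_log_mean: "integrable (total_law \<nu> \<Gamma> Pq) (log_mean p)"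
    and drift_pos: "drift \<nu> p \<Gamma> Pq > 0"
    and no_extinction: "AE \<omega> in total_law \<nu> \<Gamma> Pq. pmf (p (fst \<omega> 0)) 0 = 0"
    and volatility_finite:
      "integrable (total_law \<nu> \<Gamma> Pq) (\<lambda>\<omega>. (log_mean p \<omega> - drift \<nu> p \<Gamma> Pq)\<^sup>2)"
    and volatility_pos: "volatility \<nu> p \<Gamma> Pq > 0"
    and Z_log_Z: "integrable (total_law \<nu> \<Gamma> Pq) (\<lambda>\<omega>.
      real (branching V 1 (snd \<omega>)) / enn2real (offspring_moment p 1 (fst \<omega> 0))
        * ln (real (branching V 1 (snd \<omega>))))"

definition normalized_log_Z ::
    "'e measure \<Rightarrow> ('e \<Rightarrow> nat pmf) \<Rightarrow> 'b measure \<Rightarrow> ((nat \<Rightarrow> 'e) \<Rightarrow> 'b measure)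
      \<Rightarrow> (nat \<Rightarrow> nat \<Rightarrow> 'b \<Rightarrow> nat) \<Rightarrow> nat \<Rightarrow> (nat \<Rightarrow> 'e) \<times> 'b \<Rightarrow> real" where
  "normalized_log_Z \<nu> p \<Gamma> Pq V n \<omega> =
     (ln (real (branching V n (snd \<omega>))) - real n * drift \<nu> p \<Gamma> Pq)
       / (sqrt (real n) * volatility \<nu> p \<Gamma> Pq)"


section \<open>Wasserstein distances\<close>

definition couplings :: "real measure \<Rightarrow> real measure \<Rightarrow> (real \<times> real) measure set" where
  "couplings \<mu>\<^sub>1 \<mu>\<^sub>2 = {Q. prob_space Q \<and> sets Q = sets borel
      \<and> distr Q borel fst = \<mu>\<^sub>1 \<and> distr Q borel snd = \<mu>\<^sub>2}"

definition wasserstein :: "real \<Rightarrow> real measure \<Rightarrow> real measure \<Rightarrow> ennreal" where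
  "wasserstein r \<mu>\<^sub>1 \<mu>\<^sub>2 =
     (if r \<le> 1
      then (INF Q\<in>couplings \<mu>\<^sub>1 \<mu>\<^sub>2. \<integral>\<^sup>+ z. ennreal (\<bar>fst z - snd z\<bar> powr r) \<partial>Q)
      else (INF Q\<in>couplings \<mu>\<^sub>1 \<mu>\<^sub>2.
        ennpowr (\<integral>\<^sup>+ z. ennreal (\<bar>fst z - snd z\<bar> powr r) \<partial>Q) (1 / r)))"

text \<open>\<open>W\<^sub>r(U, V)\<close> for random variables \<open>U\<close> on \<open>M\<close> and \<open>V\<close> on \<open>N\<close> is the distance of their laws.\<close>

definition wasserstein_rv ::
    "real \<Rightarrow> 'a measure \<Rightarrow> ('a \<Rightarrow> real) \<Rightarrow> 'c measure \<Rightarrow> ('c \<Rightarrow> real) \<Rightarrow> ennreal" where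
  "wasserstein_rv r M U N V = wasserstein r (distr M borel U) (distr N borel V)"

end

theory Submission
  imports Defs "HOL-Complex_Analysis.Complex_Analysis" "HOL-Real_Asymp.Real_Asymp"
begin

text \<open>
  All orders \<open>r \<in> [\<delta>, 2]\<close> are served by one coupling: \<open>\<bar>d\<bar>\<^sup>r \<le> \<bar>d\<bar>\<^sup>\<delta> + d\<^sup>2\<close>, so it suffices to couple
  the normalised \<open>log Z\<^sub>n\<close> with the normal law at expected cost \<open>\<bar>d\<bar>\<^sup>\<delta> + d\<^sup>2\<close> of order \<open>n\<^sup>-\<^sup>\<delta>\<^sup>/\<^sup>2\<close>.

  Write \<open>log Z\<^sub>n = S\<^sub>n + \<Sum>\<^sub>k log R\<^sub>k\<close> with \<open>S\<^sub>n = \<Sum>\<^sub>k log m\<^sub>k\<close> and \<open>R\<^sub>k = Z\<^sub>k\<^sub>+\<^sub>1 / (m\<^sub>k Z\<^sub>k)\<close>. Given the environment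
  and the past, \<open>R\<^sub>k\<close> is an average of \<open>Z\<^sub>k\<close> independent variables of mean 1, so \<open>E (log R\<^sub>k)\<^sup>2\<close> is controlled by a negative
  moment of \<open>Z\<^sub>k\<close>. By Jensen's inequality negative moments are at most multiplied by
  \<open>E Z\<^sub>1\<^sup>-\<^sup>\<eta> < 1\<close> in each generation, hence they decay geometrically and \<open>log Z\<^sub>n - S\<^sub>n\<close> is bounded in \<open>L\<^sup>2\<close>.

  For the random walk, truncate the steps at \<open>\<surd>n\<close> and add an independent noise of size \<open>1 / \<surd>n\<close> whose
  characteristic function has compact support. Integrating the inversion formula by parts four times, with
  Cauchy's inequality supplying the derivatives, bounds the distance from the resulting density to the
  normal density by \<open>C n\<^sup>-\<^sup>\<delta>\<^sup>/\<^sup>2 / (1 + x\<^sup>4)\<close>; a maximal coupling of the two densities then has the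
  required cost.
\<close>

section \<open>Smoothing by a kernel with compactly supported Fourier transform\<close>

text \<open>The weight 1 + x^4 is dictated by the cost, which grows like x^2: a density error with
  this weight has an integrable cost of order 1/(1 + x^2). Four derivatives of a characteristic
  function are out of reach for steps with only 2 + \<delta> moments. After truncation at sqrt n the
  scaled step is bounded by 1, so its transform is entire, and bounds on its values in the strip |Im
  w| \<le> 1 yield the derivatives. The comparison with the Gaussian holds only for |Re w| up to a
  small multiple of sqrt n. The noise restricts attention to these frequencies, which forces its
  size to be 1/sqrt n, at a cost of order n^(-\<delta>/2). The removed large values cost no more: a
  nonzero scaled excess exceeds 1 in modulus, so each of its moments up to order 2 + \<delta> is at
  most L n^(-1 - \<delta>/2), and there are n of them. For the offspring law only moments of a
  possibly small order c are available, so the rate in the law of large numbers within a generation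
  is lowered to a small power before averaging over the environment. Supercriticality makes the
  factor E Z_1^(-\<eta>) strictly less than 1: the value 1 would mean one child per individual and
  \<mu> = 0.\<close>

definition clip :: "real \<Rightarrow> real measure" where
  "clip b = restrict_space lborel {-b..b}"

text \<open>The Fourier transform of \<open>F\<close> cut off to [-b, b]. \<open>F\<close> takes
  complex arguments because its derivatives on the real line are estimated from its values on small
  discs around real points.\<close>

definition wave :: "real \<Rightarrow> (complex \<Rightarrow> complex) \<Rightarrow> real \<Rightarrow> complex" where
  "wave b F y = (\<integral>u. exp (\<i> * of_real (y * u)) * F (of_real u) \<partial>clip b)"

lemma space_clip [simp]: "space (clip b) = {-b..b}"
  by (simp add: clip_def space_restrict_space)

lemma finite_measure_clip: "finite_measure (clip b)"
proof
  show "emeasure (clip b) (space (clip b)) \<noteq> \<infinity>"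
    by (simp add: clip_def space_restrict_space emeasure_restrict_space emeasure_lborel_Icc_eq)
qed

lemma measurable_clip: "f \<in> borel_measurable borel \<Longrightarrow> f \<in> borel_measurable (clip b)"
  unfolding clip_def by (intro measurable_restrict_space1) simp

lemma integrable_clip:
  fixes f :: "real \<Rightarrow> 'a :: euclidean_space"
  assumes "continuous_on UNIV f"
  shows "integrable (clip b) f"
proof -
  have "set_integrable lborel {-b..b} f"
    by (rule borel_integrable_atLeastAtMost') (rule continuous_on_subset[OF assms], simp)
  then show ?thesis
    unfolding clip_def set_integrable_def by (simp add: integrable_restrict_space)
qed

lemma integral_clip_FTC:
  fixes f :: "real \<Rightarrow> 'a :: euclidean_space"
  assumes "0 \<le> b" "\<And>x. (F has_vector_derivative f x) (at x)" "continuous_on UNIV f"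
  shows "integral\<^sup>L (clip b) f = F b - F (-b)"
proof -
  have "integral\<^sup>L (clip b) f = (\<integral>x. indicator {-b..b} x *\<^sub>R f x \<partial>lborel)"
    unfolding clip_def by (subst integral_restrict_space) auto
  also have "\<dots> = F b - F (-b)"
    using assms by (intro integral_FTC_atLeastAtMost)
      (auto intro: has_vector_derivative_at_within continuous_on_subset[OF assms(3)])
  finally show ?thesis .
qed

lemma entire_on_reals:
  assumes "F holomorphic_on UNIV"
  shows "continuous_on UNIV (\<lambda>u :: real. F (of_real u))"
  by (intro continuous_on_compose2[OF holomorphic_on_imp_continuous_on[OF assms]]
      continuous_on_of_real continuous_intros) auto

text \<open>The derivative of exp (i y u) F(u) integrates to the boundary values, and these vanish
  because \<open>F\<close> is zero at both ends. So a factor y is traded for a derivative of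
  \<open>F\<close>.\<close>

lemma wave_by_parts:
  assumes F: "F holomorphic_on UNIV" and "0 \<le> b" "F (of_real b) = 0" "F (- of_real b) = 0"
  shows "\<i> * of_real y * wave b F y = - wave b (deriv F) y"
proof -
  let ?e = "\<lambda>u :: real. exp (\<i> * of_real (y * u)) :: complex"
  have F': "deriv F holomorphic_on UNIV"
    using F by (intro holomorphic_deriv) auto
  have cF: "continuous_on UNIV (\<lambda>u :: real. F (of_real u))"
    and cF': "continuous_on UNIV (\<lambda>u :: real. deriv F (of_real u))"
    using entire_on_reals F F' by blast+
  have d: "((\<lambda>u. ?e u * F (of_real u)) has_vector_derivative
      \<i> * of_real y * (?e u * F (of_real u)) + ?e u * deriv F (of_real u)) (at u)" for u
  proof -
    have "(F has_field_derivative deriv F (of_real u)) (at (of_real u))"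
      using F by (intro holomorphic_derivI[of _ UNIV]) auto
    then have "((\<lambda>z. exp (\<i> * of_real y * z) * F z) has_field_derivative
      \<i> * of_real y * (?e u * F (of_real u)) + ?e u * deriv F (of_real u)) (at (of_real u))"
      by (auto intro!: derivative_eq_intros simp: algebra_simps)
    from has_vector_derivative_real_field[OF this] show ?thesis
      by (simp add: mult.assoc)
  qed
  have i1: "integrable (clip b) (\<lambda>u. \<i> * of_real y * (?e u * F (of_real u)))"
    and i2: "integrable (clip b) (\<lambda>u. ?e u * deriv F (of_real u))"
    by (intro integrable_clip continuous_intros cF cF')+
  have "(\<integral>u. \<i> * of_real y * (?e u * F (of_real u)) + ?e u * deriv F (of_real u) \<partial>clip b)
      = ?e b * F (of_real b) - ?e (- b) * F (of_real (- b))"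
    by (rule integral_clip_FTC[OF \<open>0 \<le> b\<close> d]) (intro continuous_intros cF cF')
  then have "(\<integral>u. \<i> * of_real y * (?e u * F (of_real u)) \<partial>clip b)
      + (\<integral>u. ?e u * deriv F (of_real u) \<partial>clip b) = 0"
    using assms i1 i2 by simp
  then show ?thesis
    unfolding wave_def by (simp add: add_eq_0_iff2)
qed

text \<open>The factor (b^2 - w^2)^k gives zeros of order k at both ends, and a derivative lowers
  the order by one only, so all k integrations by parts are free of boundary terms.\<close>

lemma wave_by_parts_iterated:
  assumes "F holomorphic_on UNIV" "G holomorphic_on UNIV" "0 \<le> b"
    and "\<And>w. F w = (of_real b ^ 2 - w ^ 2) ^ k * G w"
  shows "(\<i> * of_real y) ^ k * wave b F y = (- 1) ^ k * wave b ((deriv ^^ k) F) y"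
  using assms
proof (induction k arbitrary: F G)
  case 0
  then show ?case by simp
next
  case (Suc k)
  define B :: complex where "B = of_real b"
  \<comment> \<open>The cofactor after one differentiation: the product rule lowers the power of b^2
    - w^2 by one and leaves \<open>G'\<close>, again entire, so the induction hypothesis applies to
    \<open>deriv F\<close>.\<close>
  define G' where "G' w = (B ^ 2 - w ^ 2) * deriv G w - 2 * of_nat (Suc k) * w * G w" for w
  have dF: "deriv F w = (B ^ 2 - w ^ 2) ^ k * G' w" for w
  proof -
    have FF: "F = (\<lambda>w. (B ^ 2 - w ^ 2) ^ Suc k * G w)"
      using Suc.prems unfolding B_def by auto
    have dG: "(G has_field_derivative deriv G w) (at w)"
      using Suc.prems by (intro holomorphic_derivI[of _ UNIV]) auto
    have "(F has_field_derivative (B ^ 2 - w ^ 2) ^ k * G' w) (at w)"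
      unfolding FF G'_def
      by (rule derivative_eq_intros dG refl | simp add: algebra_simps)+
    then show ?thesis by (rule DERIV_imp_deriv)
  qed
  have F': "deriv F holomorphic_on UNIV"
    by (intro holomorphic_deriv Suc.prems(1)) auto
  have "deriv G holomorphic_on UNIV"
    by (intro holomorphic_deriv Suc.prems(2)) auto
  then have G': "G' holomorphic_on UNIV"
    unfolding G'_def using Suc.prems by (intro holomorphic_intros) auto
  have "\<i> * of_real y * wave b F y = - wave b (deriv F) y"
    using Suc.prems(3) by (intro wave_by_parts Suc.prems(1)) (auto simp: Suc.prems(4))
  then have "(\<i> * of_real y) ^ Suc k * wave b F y = - ((\<i> * of_real y) ^ k * wave b (deriv F) y)"
    by (simp only: power_Suc2 mult.assoc mult_minus_right)
  also have "(\<i> * of_real y) ^ k * wave b (deriv F) y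
      = (- 1) ^ k * wave b ((deriv ^^ k) (deriv F)) y"
    by (rule Suc.IH[OF F' G' Suc.prems(3)]) (simp add: dF B_def)
  finally show ?case
    by (simp add: funpow_swap1)
qed

lemma norm_wave_le:
  assumes "F holomorphic_on UNIV" "integrable (clip b) D"
    and "\<And>u. u \<in> {-b..b} \<Longrightarrow> cmod (F (of_real u)) \<le> D u"
  shows "cmod (wave b F y) \<le> integral\<^sup>L (clip b) D"
proof -
  let ?f = "\<lambda>u. exp (\<i> * of_real (y * u)) * F (of_real u)"
  have i: "integrable (clip b) ?f"
    by (intro integrable_clip continuous_intros entire_on_reals assms)
  have "cmod (wave b F y) \<le> (\<integral>u. norm (?f u) \<partial>clip b)"
    unfolding wave_def by (rule integral_norm_bound)
  also have "\<dots> \<le> integral\<^sup>L (clip b) D"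
    by (intro integral_mono integrable_norm i assms(2)) (simp add: norm_mult assms(3))
  finally show ?thesis .
qed

text \<open>Four integrations by parts, then Cauchy's inequality on discs of radius
  \<open>\<rho>\<close>, which costs 4!/\<open>\<rho>\<close>^4. The radius stays free: it is 1 for
  the kernel itself and 1/T when the argument of the transform is stretched by T.\<close>

lemma wave_decay:
  assumes F: "F holomorphic_on UNIV" "G holomorphic_on UNIV"
    and "\<And>w. F w = (of_real b ^ 2 - w ^ 2) ^ 4 * G w"
    and "0 \<le> b" "0 < \<rho>" and D: "integrable (clip b) D"
    and le: "\<And>u w. u \<in> {-b..b} \<Longrightarrow> dist w (of_real u) \<le> \<rho> \<Longrightarrow> cmod (F w) \<le> D u"
  shows "y ^ 4 * cmod (wave b F y) \<le> 24 / \<rho> ^ 4 * integral\<^sup>L (clip b) D"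
proof -
  have "cmod (wave b ((deriv ^^ 4) F) y) \<le> (\<integral>u. 24 / \<rho> ^ 4 * D u \<partial>clip b)"
  proof (rule norm_wave_le)
    show "(deriv ^^ 4) F holomorphic_on UNIV"
      using F by (intro holomorphic_higher_deriv) auto
    show "integrable (clip b) (\<lambda>u. 24 / \<rho> ^ 4 * D u)"
      using D by simp
    fix u assume "u \<in> {-b..b}"
    then have "cmod ((deriv ^^ 4) F (of_real u)) \<le> fact 4 * D u / \<rho> ^ 4"
      using F \<open>0 < \<rho>\<close>
      by (intro Cauchy_inequality le)
        (auto simp: dist_norm norm_minus_commute intro: holomorphic_on_subset
          holomorphic_on_imp_continuous_on)
    then show "cmod ((deriv ^^ 4) F (of_real u)) \<le> 24 / \<rho> ^ 4 * D u"
      by (simp add: fact_numeral)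
  qed
  moreover have "cmod ((\<i> * of_real y) ^ 4 * wave b F y) = cmod (wave b ((deriv ^^ 4) F) y)"
    using wave_by_parts_iterated[OF F \<open>0 \<le> b\<close> assms(3), where y = y]
    by (simp add: norm_mult)
  ultimately show ?thesis
    by (simp add: norm_mult norm_power)
qed

section \<open>The kernel and its decay\<close>

definition bump :: "real \<Rightarrow> complex \<Rightarrow> complex" where
  "bump b w = (of_real b ^ 2 - w ^ 2) ^ 4"

text \<open>A squared modulus, so nonnegative; and as the product of a transform with its conjugate
  it is the transform of an autocorrelation, supported in [-2b, 2b]. The exponent 4 in
  \<open>bump\<close> pays for four integrations by parts.\<close>

definition kern :: "real \<Rightarrow> real \<Rightarrow> real" where
  "kern b y = (cmod (wave b (bump b) y))\<^sup>2"

lemma bump_holomorphic [holomorphic_intros]: "bump b holomorphic_on A"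
  unfolding bump_def by (intro holomorphic_intros)

lemma norm_bump_le:
  assumes "cmod w \<le> b + 1" "0 \<le> b"
  shows "cmod (bump b w) \<le> (b\<^sup>2 + (b + 1)\<^sup>2) ^ 4"
proof -
  have "cmod (of_real b ^ 2 - w ^ 2) \<le> b\<^sup>2 + (cmod w)\<^sup>2"
    by (rule order_trans[OF norm_triangle_ineq4]) (simp add: norm_power)
  also have "\<dots> \<le> b\<^sup>2 + (b + 1)\<^sup>2"
    using assms by (intro add_left_mono power_mono) auto
  finally show ?thesis
    unfolding bump_def norm_power by (intro power_mono) auto
qed

lemma kern_nonneg [simp]: "0 \<le> kern b y"
  by (simp add: kern_def)

lemma continuous_wave:
  assumes "F holomorphic_on UNIV"
  shows "continuous_on UNIV (wave b F)"
proof -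
  have c: "continuous_on UNIV (\<lambda>u. F (of_real u))"
    by (rule entire_on_reals[OF assms])
  have [measurable]: "(\<lambda>u :: real. F (of_real u)) \<in> borel_measurable borel"
    using c by (rule borel_measurable_continuous_onI)
  have "isCont (wave b F) y" for y
    unfolding wave_def continuous_at_sequentially comp_def
  proof safe
    fix X :: "nat \<Rightarrow> real" assume X: "X \<longlonglongrightarrow> y"
    show "(\<lambda>n. \<integral>u. exp (\<i> * of_real (X n * u)) * F (of_real u) \<partial>clip b)
        \<longlonglongrightarrow> (\<integral>u. exp (\<i> * of_real (y * u)) * F (of_real u) \<partial>clip b)"
    proof (rule integral_dominated_convergence[where w = "\<lambda>u. cmod (F (of_real u))"])
      show "integrable (clip b) (\<lambda>u. cmod (F (of_real u)))"
        by (intro integrable_clip continuous_intros c)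
      show "(\<lambda>u. exp (\<i> * of_real (z * u)) * F (of_real u)) \<in> borel_measurable (clip b)" for z
        by (intro borel_measurable_integrable integrable_clip continuous_intros c)
      then show "(\<lambda>u. exp (\<i> * of_real (X n * u)) * F (of_real u)) \<in> borel_measurable (clip b)" for n .
      have "(\<lambda>n. exp (\<i> * of_real (X n * u)) * F (of_real u))
          \<longlonglongrightarrow> exp (\<i> * of_real (y * u)) * F (of_real u)" for u
        by (intro tendsto_intros X)
      then show "AE u in clip b. (\<lambda>n. exp (\<i> * of_real (X n * u)) * F (of_real u))
          \<longlonglongrightarrow> exp (\<i> * of_real (y * u)) * F (of_real u)"
        by simp
      show "AE u in clip b. norm (exp (\<i> * of_real (X n * u)) * F (of_real u)) \<le> cmod (F (of_real u))" for n
        by (simp add: norm_mult)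
    qed
  qed
  then show ?thesis by (simp add: continuous_on_eq_continuous_at)
qed

lemma continuous_kern: "continuous_on UNIV (kern b)"
  unfolding kern_def by (intro continuous_intros continuous_wave holomorphic_intros)

lemma measurable_kern [measurable]: "kern b \<in> borel_measurable borel"
  by (rule borel_measurable_continuous_onI[OF continuous_kern])

text \<open>The transform of \<open>bump\<close> is bounded and decays like y^(-4);
  \<open>kern\<close> is its squared modulus, hence the power 8.\<close>

lemma kern_decay:
  assumes "0 \<le> b"
  obtains C where "0 < C" "\<And>y. (1 + y ^ 8) * kern b y \<le> C"
proof -
  define D where "D = integral\<^sup>L (clip b) (\<lambda>_. (b\<^sup>2 + (b + 1)\<^sup>2) ^ 4)"
  have i: "integrable (clip b) (\<lambda>_. (b\<^sup>2 + (b + 1)\<^sup>2) ^ 4)"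
    by (intro integrable_clip continuous_intros)
  have 1: "cmod (bump b w) \<le> (b\<^sup>2 + (b + 1)\<^sup>2) ^ 4" if "u \<in> {-b..b}" "dist w (of_real u) \<le> 1" for u w
  proof (rule norm_bump_le)
    have "cmod w \<le> cmod (w - of_real u) + cmod (of_real u)"
      by (metis add.commute norm_triangle_sub)
    then show "cmod w \<le> b + 1"
      using that by (auto simp: dist_norm)
  qed (use assms in auto)
  have 2: "cmod (wave b (bump b) y) \<le> D" for y
    unfolding D_def using i
    by (intro norm_wave_le 1 holomorphic_intros) auto
  have 3: "y ^ 4 * cmod (wave b (bump b) y) \<le> 24 * D" for y
  proof -
    have "y ^ 4 * cmod (wave b (bump b) y)
        \<le> 24 / 1 ^ 4 * integral\<^sup>L (clip b) (\<lambda>_. (b\<^sup>2 + (b + 1)\<^sup>2) ^ 4)"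
      by (rule wave_decay[OF bump_holomorphic holomorphic_on_const[of 1], OF _ assms _ i 1])
        (simp_all add: bump_def)
    then show ?thesis by (simp add: D_def)
  qed
  have "(1 + y ^ 8) * kern b y \<le> D\<^sup>2 + (24 * D)\<^sup>2 + 1" for y
  proof -
    have "kern b y \<le> D\<^sup>2"
      unfolding kern_def using 2 by (intro power_mono) auto
    moreover have "(y ^ 4 * cmod (wave b (bump b) y))\<^sup>2 \<le> (24 * D)\<^sup>2"
      using 3 by (intro power_mono) auto
    then have "y ^ 8 * kern b y \<le> (24 * D)\<^sup>2"
      by (simp add: kern_def power_mult_distrib flip: power_mult)
    ultimately show ?thesis
      by (simp add: algebra_simps)
  qed
  moreover have "0 < D\<^sup>2 + (24 * D)\<^sup>2 + 1"
    by (meson add_nonneg_pos add_nonneg_nonneg zero_le_power2 zero_less_one)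
  ultimately show ?thesis using that by blast
qed


section \<open>Smoothed laws in terms of characteristic functions\<close>

lemma integrable_inverse_square: "integrable lborel (\<lambda>x :: real. 1 / (1 + x\<^sup>2))"
  using integrable_inverse_1_plus_square
  by (simp add: set_integrable_def inverse_eq_divide)

text \<open>The substitution s = (u - v) T leads to 1/(1 + s^2), whose primitive arctan varies by at
  most \<pi>. The gain 1/T offsets the factor T that a density smoothed by noise of size 1/T
  carries.\<close>

lemma integral_clip_inverse_square:
  assumes "0 \<le> b" "0 < T"
  shows "integrable (clip b) (\<lambda>u. 1 / (1 + ((u - v) * T)\<^sup>2))"
    and "integral\<^sup>L (clip b) (\<lambda>u. 1 / (1 + ((u - v) * T)\<^sup>2)) \<le> pi / T"
proof -
  have c: "continuous_on UNIV (\<lambda>u. 1 / (1 + ((u - v) * T)\<^sup>2))"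
    by (intro continuous_intros) (metis add_nonneg_eq_0_iff zero_le_one zero_le_power2 zero_neq_one)
  then show "integrable (clip b) (\<lambda>u. 1 / (1 + ((u - v) * T)\<^sup>2))"
    by (rule integrable_clip)
  have "((\<lambda>u. arctan ((u - v) * T) / T) has_real_derivative 1 / (1 + ((u - v) * T)\<^sup>2)) (at u)" for u
    using assms by (auto intro!: derivative_eq_intros simp: inverse_eq_divide)
  then have "integral\<^sup>L (clip b) (\<lambda>u. 1 / (1 + ((u - v) * T)\<^sup>2))
      = arctan ((b - v) * T) / T - arctan ((- b - v) * T) / T"
    by (intro integral_clip_FTC[OF \<open>0 \<le> b\<close> _ c])
      (simp add: has_real_derivative_iff_has_vector_derivative)
  also have "\<dots> = (arctan ((b - v) * T) - arctan ((- b - v) * T)) / T"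
    by (simp add: diff_divide_distrib)
  also have "\<dots> \<le> pi / T"
    using assms arctan_bounded[of "(b - v) * T"] arctan_bounded[of "(- b - v) * T"]
    by (intro divide_right_mono) auto
  finally show "integral\<^sup>L (clip b) (\<lambda>u. 1 / (1 + ((u - v) * T)\<^sup>2)) \<le> pi / T" .
qed

text \<open>Written as a double integral over \<open>clip b\<close>, the squared modulus in \<open>kern\<close> turns the smoothing
  of a law into an integral of its characteristic function.\<close>

lemma measurable_pair_clip:
  assumes "f \<in> borel_measurable (borel \<Otimes>\<^sub>M borel)" and [measurable_cong]: "sets \<mu> = sets borel"
  shows "f \<in> borel_measurable (\<mu> \<Otimes>\<^sub>M clip b)"
proof -
  have "(\<lambda>z. z) \<in> clip b \<rightarrow>\<^sub>M borel" by (rule measurable_clip) simp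
  then have "snd \<in> \<mu> \<Otimes>\<^sub>M clip b \<rightarrow>\<^sub>M borel"
    using measurable_compose[OF measurable_snd] by fast
  then have "(\<lambda>z. (fst z, snd z)) \<in> \<mu> \<Otimes>\<^sub>M clip b \<rightarrow>\<^sub>M borel \<Otimes>\<^sub>M borel"
    by measurable
  from measurable_compose[OF this assms(1)] show ?thesis by simp
qed

lemma bounded_Fubini_clip:
  fixes f :: "real \<Rightarrow> real \<Rightarrow> complex"
  assumes "real_distribution \<mu>" "case_prod f \<in> borel_measurable (borel \<Otimes>\<^sub>M borel)"
    and "\<And>y v. v \<in> {-b..b} \<Longrightarrow> cmod (f y v) \<le> B"
  shows "(\<integral>y. (\<integral>v. f y v \<partial>clip b) \<partial>\<mu>) = (\<integral>v. (\<integral>y. f y v \<partial>\<mu>) \<partial>clip b)"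
    and "integrable (clip b) (\<lambda>v. \<integral>y. f y v \<partial>\<mu>)"
proof -
  interpret \<mu>: real_distribution \<mu> by fact
  interpret c: finite_measure "clip b" by (rule finite_measure_clip)
  interpret P: pair_sigma_finite \<mu> "clip b" ..
  interpret PF: finite_measure "\<mu> \<Otimes>\<^sub>M clip b"
    by (rule finite_measure_pair_measure) (rule c.finite_measure_axioms, rule \<mu>.finite_measure_axioms)
  have i: "integrable (\<mu> \<Otimes>\<^sub>M clip b) (case_prod f)"
    using assms
    by (intro PF.integrable_const_bound[where B = B] AE_I2 measurable_pair_clip)
      (auto simp: space_pair_measure)
  show "(\<integral>y. (\<integral>v. f y v \<partial>clip b) \<partial>\<mu>) = (\<integral>v. (\<integral>y. f y v \<partial>\<mu>) \<partial>clip b)"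
    using P.Fubini_integral[OF i] by simp
  show "integrable (clip b) (\<lambda>v. \<integral>y. f y v \<partial>\<mu>)"
    by (rule P.integrable_snd[OF i])
qed

lemma measurable_wave_bump [measurable]: "wave b (bump b) \<in> borel_measurable borel"
  by (rule borel_measurable_continuous_onI[OF continuous_wave]) (rule bump_holomorphic)

text \<open>Write |W|^2 as W times its conjugate, with W the transform of \<open>bump\<close>;
  integrating over the law first puts \<open>char \<mu>\<close> at T (s - v). The inner integral
  over s is kept as a \<open>wave\<close>, so that \<open>wave_decay\<close> can act on it for each
  v. \<open>Re w\<close> reads off the real variable s at which \<open>wave\<close> evaluates its
  argument.\<close>

lemma smoothing_eq_char:
  assumes "real_distribution \<mu>" "0 \<le> b"
  shows "complex_of_real (\<integral>y. kern b (T * (y - x)) \<partial>\<mu>)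
    = (\<integral>v. exp (\<i> * of_real (T * x * v)) * bump b (of_real v)
        * wave b (\<lambda>w. bump b w * char \<mu> (T * (Re w - v))) (- (T * x)) \<partial>clip b)" (is ?eq)
    and "integrable (clip b) (\<lambda>v. exp (\<i> * of_real (T * x * v)) * bump b (of_real v)
        * wave b (\<lambda>w. bump b w * char \<mu> (T * (Re w - v))) (- (T * x)))" (is ?int)
proof -
  interpret \<mu>: real_distribution \<mu> by fact
  define E where "E = (b\<^sup>2 + (b + 1)\<^sup>2) ^ 4"
  define W where "W = wave b (bump b)"
  \<comment> \<open>Integrand of the conjugate of W (T (y - x)), with v as integration variable;
    \<open>bump\<close> is real on the real line, so conjugation only changes the sign in the
    exponent.\<close>
  define c where "c y v = exp (\<i> * of_real (- (T * (y - x) * v))) * bump b (of_real v)" for y v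
  have E: "cmod (bump b (of_real u)) \<le> E" if "u \<in> {-b..b}" for u
    unfolding E_def using that \<open>0 \<le> b\<close> by (intro norm_bump_le) auto
  have Wb: "cmod (W y) \<le> integral\<^sup>L (clip b) (\<lambda>_. E)" for y
    unfolding W_def by (intro norm_wave_le E holomorphic_intros integrable_clip continuous_intros)
  have [measurable]: "W \<in> borel_measurable borel"
    unfolding W_def by (rule measurable_wave_bump)
  have cnj: "cnj (W (T * (y - x))) = (\<integral>v. c y v \<partial>clip b)" for y
    unfolding W_def wave_def c_def
    by (subst Bochner_Integration.integral_cnj[symmetric], intro Bochner_Integration.integral_cong refl)
      (simp add: bump_def exp_cnj)
  have kern: "complex_of_real (kern b (T * (y - x))) = (\<integral>v. c y v * W (T * (y - x)) \<partial>clip b)" for y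
  proof -
    have "complex_of_real (kern b (T * (y - x))) = W (T * (y - x)) * cnj (W (T * (y - x)))"
      by (simp only: kern_def W_def complex_norm_square)
    then show ?thesis by (simp add: cnj mult.commute)
  qed
  have inner: "(\<integral>y. c y v * W (T * (y - x)) \<partial>\<mu>)
      = exp (\<i> * of_real (T * x * v)) * bump b (of_real v)
        * wave b (\<lambda>w. bump b w * char \<mu> (T * (Re w - v))) (- (T * x))"
    if v: "v \<in> {-b..b}" for v
  proof -
    have "(\<integral>y. c y v * W (T * (y - x)) \<partial>\<mu>)
        = (\<integral>y. (\<integral>s. c y v * (exp (\<i> * of_real (T * (y - x) * s)) * bump b (of_real s)) \<partial>clip b) \<partial>\<mu>)"
      unfolding W_def wave_def by simp
    also have "\<dots> = (\<integral>s. (\<integral>y. c y v * (exp (\<i> * of_real (T * (y - x) * s)) * bump b (of_real s)) \<partial>\<mu>) \<partial>clip b)"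
    proof (rule bounded_Fubini_clip(1)[OF assms(1), where B = "E * E"])
      show "cmod (c y v * (exp (\<i> * of_real (T * (y - x) * s)) * bump b (of_real s))) \<le> E * E"
        if "s \<in> {-b..b}" for y s
        using mult_mono[OF E[OF v] E[OF that]] by (simp add: c_def norm_mult E_def)
      show "(\<lambda>(y, s). c y v * (exp (\<i> * of_real (T * (y - x) * s)) * bump b (of_real s)))
          \<in> borel_measurable (borel \<Otimes>\<^sub>M borel)"
        unfolding c_def split_beta' borel_prod bump_def
        by (intro borel_measurable_continuous_onI continuous_intros)
    qed
    also have "\<dots> = (\<integral>s. exp (\<i> * of_real (T * x * v)) * bump b (of_real v) *
        (exp (\<i> * of_real (- (T * x) * s)) * (bump b (of_real s) * char \<mu> (T * (s - v)))) \<partial>clip b)"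
    proof (intro Bochner_Integration.integral_cong refl)
      fix s
      have "(\<integral>y. c y v * (exp (\<i> * of_real (T * (y - x) * s)) * bump b (of_real s)) \<partial>\<mu>)
        = (\<integral>y. (exp (\<i> * of_real (T * x * v)) * bump b (of_real v) *
        (exp (\<i> * of_real (- (T * x) * s)) * bump b (of_real s))) * exp (\<i> * of_real (T * (s - v) * y)) \<partial>\<mu>)"
      proof (intro Bochner_Integration.integral_cong refl)
        fix y
        have "exp (\<i> * of_real (- (T * (y - x) * v))) * exp (\<i> * of_real (T * (y - x) * s))
          = exp (\<i> * of_real (T * x * v)) * exp (\<i> * of_real (- (T * x) * s)) * exp (\<i> * of_real (T * (s - v) * y))"
          by (simp add: exp_add[symmetric] algebra_simps)
        then show "c y v * (exp (\<i> * of_real (T * (y - x) * s)) * bump b (of_real s)) =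
          (exp (\<i> * of_real (T * x * v)) * bump b (of_real v) *
        (exp (\<i> * of_real (- (T * x) * s)) * bump b (of_real s))) * exp (\<i> * of_real (T * (s - v) * y))"
          unfolding c_def by (simp only: mult_ac)
      qed
      also have "\<dots> = (exp (\<i> * of_real (T * x * v)) * bump b (of_real v) *
        (exp (\<i> * of_real (- (T * x) * s)) * bump b (of_real s))) * char \<mu> (T * (s - v))"
        unfolding char_def by simp
      finally show "(\<integral>y. c y v * (exp (\<i> * of_real (T * (y - x) * s)) * bump b (of_real s)) \<partial>\<mu>) =
        exp (\<i> * of_real (T * x * v)) * bump b (of_real v) *
        (exp (\<i> * of_real (- (T * x) * s)) * (bump b (of_real s) * char \<mu> (T * (s - v))))"
        by (simp add: mult.assoc)
    qed
    also have "\<dots> = exp (\<i> * of_real (T * x * v)) * bump b (of_real v)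
        * wave b (\<lambda>w. bump b w * char \<mu> (T * (Re w - v))) (- (T * x))"
      unfolding wave_def by simp
    finally show ?thesis .
  qed
  have cW_le: "cmod (c y v * W (T * (y - x))) \<le> E * integral\<^sup>L (clip b) (\<lambda>_. E)"
    if "v \<in> {-b..b}" for y v
    using E[OF that] Wb[of "T * (y - x)"] by (simp add: c_def norm_mult E_def mult_mono)
  have cW_meas: "(\<lambda>(y, v). c y v * W (T * (y - x))) \<in> borel_measurable (borel \<Otimes>\<^sub>M borel)"
  proof -
    have "continuous_on UNIV (\<lambda>p :: real \<times> real. W (T * (fst p - x)))"
      unfolding W_def
      by (rule continuous_on_compose2[OF continuous_wave[OF bump_holomorphic]])
        (auto intro!: continuous_intros)
    then show ?thesis
      unfolding c_def split_beta' borel_prod bump_def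
      by (intro borel_measurable_continuous_onI continuous_intros)
  qed
  have "complex_of_real (\<integral>y. kern b (T * (y - x)) \<partial>\<mu>)
      = (\<integral>y. (\<integral>v. c y v * W (T * (y - x)) \<partial>clip b) \<partial>\<mu>)"
    unfolding kern[symmetric] by simp
  also have "\<dots> = (\<integral>v. (\<integral>y. c y v * W (T * (y - x)) \<partial>\<mu>) \<partial>clip b)"
    by (rule bounded_Fubini_clip(1)[OF assms(1) cW_meas cW_le])
  also have "\<dots> = (\<integral>v. exp (\<i> * of_real (T * x * v)) * bump b (of_real v)
        * wave b (\<lambda>w. bump b w * char \<mu> (T * (Re w - v))) (- (T * x)) \<partial>clip b)"
    by (intro Bochner_Integration.integral_cong refl inner) simp
  finally show ?eq .
  show ?int
  proof (rule Bochner_Integration.integrable_cong[OF refl, THEN iffD1])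
    show "integrable (clip b) (\<lambda>v. \<integral>y. c y v * W (T * (y - x)) \<partial>\<mu>)"
      by (rule bounded_Fubini_clip(2)[OF assms(1) cW_meas cW_le])
  qed (simp add: inner)
qed

text \<open>A disc of radius 1/T around u becomes a disc of radius 1 around (u - v) T, so it stays
  in the strip where \<open>D\<close> is controlled. Four derivatives cost T^4, which the weight (T
  x)^4 returns, and the integral over u gains 1/T. The factor 75 is 25 times 3: 25 = 1 + 4!, and 3
  compares 1 + s^2 with 1 + r^2 when s and r differ by at most 1.\<close>

lemma inner_wave_bound:
  assumes D: "D holomorphic_on UNIV" and "0 \<le> b" "1 \<le> T" "0 \<le> \<epsilon>" "v \<in> {-b..b}"
    and le: "\<And>w. \<bar>Im w\<bar> \<le> 1 \<Longrightarrow> \<bar>Re w\<bar> \<le> 2 * b * T + 1 \<Longrightarrow> cmod (D w) \<le> \<epsilon> / (1 + (Re w)\<^sup>2)"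
  defines "E \<equiv> (b\<^sup>2 + (b + 1)\<^sup>2) ^ 4"
  shows "(1 + x ^ 4) * cmod (wave b (\<lambda>w. bump b w * D ((w - of_real v) * of_real T)) (T * x))
      \<le> 75 * E * pi * \<epsilon> / T"
proof -
  define F where "F w = bump b w * D ((w - of_real v) * of_real T)" for w
  define M where "M u = 3 * E * \<epsilon> * (1 / (1 + ((u - v) * T)\<^sup>2))" for u
  have D': "(\<lambda>w. D ((w - of_real v) * of_real T)) holomorphic_on UNIV"
    using holomorphic_on_compose_gen[OF _ D, of "\<lambda>w. (w - of_real v) * of_real T" UNIV]
    by (simp add: comp_def holomorphic_intros)
  then have F: "F holomorphic_on UNIV"
    unfolding F_def by (intro holomorphic_intros)
  have FM: "cmod (F w) \<le> M u" if u: "u \<in> {-b..b}" and w: "dist w (of_real u) \<le> 1 / T" for u w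
  proof -
    have wu: "cmod (w - of_real u) * T \<le> 1"
      using w \<open>1 \<le> T\<close> by (simp add: dist_norm field_simps)
    have "cmod (w - of_real u) * 1 \<le> cmod (w - of_real u) * T"
      using \<open>1 \<le> T\<close> by (intro mult_left_mono) auto
    with wu have wu1: "cmod (w - of_real u) \<le> 1" by simp
    have "cmod w \<le> cmod (w - of_real u) + cmod (of_real u)"
      by (metis add.commute norm_triangle_sub)
    then have "cmod (bump b w) \<le> E"
      unfolding E_def using wu1 u \<open>0 \<le> b\<close> by (intro norm_bump_le) auto
    moreover have "cmod (D ((w - of_real v) * of_real T)) \<le> 3 * \<epsilon> * (1 / (1 + ((u - v) * T)\<^sup>2))"
    proof -
      let ?z = "(w - of_real v) * of_real T :: complex"
      have z: "cmod (?z - of_real ((u - v) * T)) \<le> 1"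
      proof -
        have "?z - of_real ((u - v) * T) = (w - of_real u) * of_real T"
          by (simp add: algebra_simps)
        then show ?thesis using wu \<open>1 \<le> T\<close> by (simp add: norm_mult)
      qed
      have im: "\<bar>Im ?z\<bar> \<le> 1"
        using z abs_Im_le_cmod[of "?z - of_real ((u - v) * T)"] by simp
      have re: "\<bar>Re ?z - (u - v) * T\<bar> \<le> 1"
        using z abs_Re_le_cmod[of "?z - of_real ((u - v) * T)"] by simp
      have "\<bar>(u - v) * T\<bar> \<le> 2 * b * T"
        using u assms(5) \<open>1 \<le> T\<close> by (subst abs_mult) (intro mult_mono, auto)
      with re have "\<bar>Re ?z\<bar> \<le> 2 * b * T + 1" by linarith
      then have "cmod (D ?z) \<le> \<epsilon> / (1 + (Re ?z)\<^sup>2)"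
        by (intro le im)
      also have "\<dots> \<le> \<epsilon> * (3 / (1 + ((u - v) * T)\<^sup>2))"
      proof -
        define s r where "s = (u - v) * T" and "r = Re ?z"
        have "s\<^sup>2 = (r + (s - r))\<^sup>2" by simp
        also have "\<dots> \<le> 2 * r\<^sup>2 + 2 * (s - r)\<^sup>2"
          using zero_le_power2[of "r - (s - r)"] by (simp add: power2_eq_square algebra_simps)
        finally have "s\<^sup>2 \<le> 2 * r\<^sup>2 + 2 * (s - r)\<^sup>2" .
        moreover have "(s - r)\<^sup>2 \<le> 1"
          using re by (intro abs_square_le_1[THEN iffD2]) (auto simp: s_def r_def)
        moreover have "1 + p \<le> 3 * (1 + q)" if "p \<le> 2 * q + 2 * t" "t \<le> 1" "0 \<le> q" for p q t :: real
          using that by (simp add: algebra_simps)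
        ultimately have "1 + s\<^sup>2 \<le> 3 * (1 + r\<^sup>2)"
          using zero_le_power2 by blast
        moreover have "0 < 1 + s\<^sup>2" "0 < 1 + r\<^sup>2" by (auto simp: add_pos_nonneg)
        ultimately have "1 / (1 + r\<^sup>2) \<le> 3 / (1 + s\<^sup>2)"
          by (simp add: field_simps)
        then show ?thesis
          using \<open>0 \<le> \<epsilon>\<close> unfolding s_def[symmetric] r_def[symmetric]
          by (metis mult_left_mono times_divide_eq_right mult.right_neutral)
      qed
      finally show ?thesis by (simp add: mult.commute)
    qed
    ultimately have "cmod (F w) \<le> E * (3 * \<epsilon> * (1 / (1 + ((u - v) * T)\<^sup>2)))"
      unfolding F_def norm_mult by (intro mult_mono) (auto simp: E_def)
    then show ?thesis by (simp add: M_def algebra_simps)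
  qed
  have M: "integrable (clip b) M"
    unfolding M_def using assms by (intro integrable_mult_right integral_clip_inverse_square) auto
  have "integral\<^sup>L (clip b) M \<le> 3 * E * \<epsilon> * (pi / T)"
    unfolding M_def using assms
    by (subst integral_mult_right_zero, intro mult_left_mono integral_clip_inverse_square)
      (auto simp: E_def)
  moreover have "cmod (wave b F (T * x)) \<le> integral\<^sup>L (clip b) M"
    using \<open>1 \<le> T\<close> by (intro norm_wave_le F M FM) auto
  moreover have "x ^ 4 * cmod (wave b F (T * x)) \<le> 24 * integral\<^sup>L (clip b) M"
  proof -
    have "(T * x) ^ 4 * cmod (wave b F (T * x)) \<le> 24 / (1 / T) ^ 4 * integral\<^sup>L (clip b) M"
      using \<open>1 \<le> T\<close> \<open>0 \<le> b\<close>
      by (intro wave_decay[OF F D'] M FM) (auto simp: F_def bump_def)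
    then have "T ^ 4 * (x ^ 4 * cmod (wave b F (T * x))) \<le> T ^ 4 * (24 * integral\<^sup>L (clip b) M)"
      by (simp add: power_mult_distrib power_one_over field_simps)
    then show ?thesis
      using \<open>1 \<le> T\<close> by (subst (asm) mult_le_cancel_left_pos) auto
  qed
  ultimately have "(1 + x ^ 4) * cmod (wave b F (T * x)) \<le> 25 * (3 * E * \<epsilon> * (pi / T))"
    by (simp add: distrib_right)
  then show ?thesis by (simp add: F_def[abs_def] mult_ac)
qed

text \<open>The inner bound is uniform in v, so integration over v against the bounded factor
  \<open>bump\<close> only multiplies it by a constant depending on b. The argument T (s - v) ranges
  over [-2bT, 2bT], and discs of radius 1 around it explain the window 2bT + 1.\<close>

lemma smoothing_difference:
  assumes "0 < b"
  obtains C where "0 < C"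
    "\<And>T \<epsilon> \<mu>\<^sub>1 \<mu>\<^sub>2 D x. 1 \<le> T \<Longrightarrow> 0 \<le> \<epsilon> \<Longrightarrow> real_distribution \<mu>\<^sub>1 \<Longrightarrow> real_distribution \<mu>\<^sub>2 \<Longrightarrow>
      D holomorphic_on UNIV \<Longrightarrow> (\<And>s. char \<mu>\<^sub>1 s - char \<mu>\<^sub>2 s = D (of_real s)) \<Longrightarrow>
      (\<And>w. \<bar>Im w\<bar> \<le> 1 \<Longrightarrow> \<bar>Re w\<bar> \<le> 2 * b * T + 1 \<Longrightarrow> cmod (D w) \<le> \<epsilon> / (1 + (Re w)\<^sup>2)) \<Longrightarrow>
      (1 + x ^ 4) * \<bar>(\<integral>y. kern b (T * (y - x)) \<partial>\<mu>\<^sub>1) - (\<integral>y. kern b (T * (y - x)) \<partial>\<mu>\<^sub>2)\<bar> \<le> C * \<epsilon> / T"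
proof -
  define E where "E = (b\<^sup>2 + (b + 1)\<^sup>2) ^ 4"
  define C where "C = integral\<^sup>L (clip b) (\<lambda>_. E * (75 * E * pi))"
  have "0 < E" using assms by (auto simp: E_def intro!: zero_less_power add_pos_nonneg)
  have C: "(1 + x ^ 4) * \<bar>(\<integral>y. kern b (T * (y - x)) \<partial>\<mu>\<^sub>1) - (\<integral>y. kern b (T * (y - x)) \<partial>\<mu>\<^sub>2)\<bar> \<le> C * \<epsilon> / T"
    if "1 \<le> T" "0 \<le> \<epsilon>" and \<mu>: "real_distribution \<mu>\<^sub>1" "real_distribution \<mu>\<^sub>2"
      and D: "D holomorphic_on UNIV" "\<And>s. char \<mu>\<^sub>1 s - char \<mu>\<^sub>2 s = D (of_real s)"
        "\<And>w. \<bar>Im w\<bar> \<le> 1 \<Longrightarrow> \<bar>Re w\<bar> \<le> 2 * b * T + 1 \<Longrightarrow> cmod (D w) \<le> \<epsilon> / (1 + (Re w)\<^sup>2)"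
    for T \<epsilon> \<mu>\<^sub>1 \<mu>\<^sub>2 D x
  proof -
    interpret m1: real_distribution \<mu>\<^sub>1 by fact
    interpret m2: real_distribution \<mu>\<^sub>2 by fact
    let ?e = "\<lambda>v. exp (\<i> * of_real (T * x * v)) * bump b (of_real v)"
    let ?w = "\<lambda>\<mu> v. wave b (\<lambda>w. bump b w * char \<mu> (T * (Re w - v))) (- (T * x))"
    let ?d = "\<lambda>v. wave b (\<lambda>w. bump b w * D ((w - of_real v) * of_real T)) (T * (- x))"
    have ci: "integrable (clip b) (\<lambda>s. exp (\<i> * of_real (- (T * x) * s)) *
        (bump b (of_real s) * char \<mu> (T * (s - v))))" if "real_distribution \<mu>" for \<mu> v
    proof -
      interpret m: real_distribution \<mu> by fact
      have "continuous_on UNIV (char \<mu>)"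
        by (simp add: continuous_on_eq_continuous_at m.isCont_char)
      then have "continuous_on UNIV (\<lambda>s. char \<mu> (T * (s - v)))"
        by (rule continuous_on_compose2) (auto intro!: continuous_intros)
      moreover have "continuous_on UNIV (\<lambda>s :: real. bump b (of_real s))"
        by (rule entire_on_reals) (rule bump_holomorphic)
      ultimately show ?thesis
        by (intro integrable_clip continuous_intros)
    qed
    have wd: "?w \<mu>\<^sub>1 v - ?w \<mu>\<^sub>2 v = ?d v" for v
    proof -
      have eq: "D ((of_real s - of_real v) * of_real T) = char \<mu>\<^sub>1 (T * (s - v)) - char \<mu>\<^sub>2 (T * (s - v))" for s
        unfolding D(2) by (simp add: mult.commute)
      have w: "?w \<mu> v = (\<integral>s. exp (\<i> * of_real (- (T * x) * s)) *
        (bump b (of_real s) * char \<mu> (T * (s - v))) \<partial>clip b)" for \<mu>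
        by (simp add: wave_def)
      have "?w \<mu>\<^sub>1 v - ?w \<mu>\<^sub>2 v = (\<integral>s. exp (\<i> * of_real (- (T * x) * s)) *
          (bump b (of_real s) * char \<mu>\<^sub>1 (T * (s - v)))
        - exp (\<i> * of_real (- (T * x) * s)) * (bump b (of_real s) * char \<mu>\<^sub>2 (T * (s - v))) \<partial>clip b)"
        unfolding w by (rule Bochner_Integration.integral_diff[OF ci[OF \<mu>(1)] ci[OF \<mu>(2)], symmetric])
      also have "\<dots> = ?d v"
        unfolding wave_def eq
        by (intro Bochner_Integration.integral_cong refl) (simp add: right_diff_distrib)
      finally show ?thesis .
    qed
    have i: "integrable (clip b) (\<lambda>v. ?e v * ?w \<mu> v)" if "real_distribution \<mu>" for \<mu>
      using smoothing_eq_char(2)[OF that] assms by simp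
    have "complex_of_real ((\<integral>y. kern b (T * (y - x)) \<partial>\<mu>\<^sub>1) - (\<integral>y. kern b (T * (y - x)) \<partial>\<mu>\<^sub>2))
        = (\<integral>v. ?e v * ?w \<mu>\<^sub>1 v - ?e v * ?w \<mu>\<^sub>2 v \<partial>clip b)"
      unfolding of_real_diff smoothing_eq_char(1)[OF \<mu>(1) less_imp_le[OF assms]]
        smoothing_eq_char(1)[OF \<mu>(2) less_imp_le[OF assms]]
      by (rule Bochner_Integration.integral_diff[OF i[OF \<mu>(1)] i[OF \<mu>(2)], symmetric])
    also have "\<dots> = (\<integral>v. ?e v * ?d v \<partial>clip b)"
      by (simp only: right_diff_distrib[symmetric] wd)
    finally have eq: "complex_of_real ((\<integral>y. kern b (T * (y - x)) \<partial>\<mu>\<^sub>1) - (\<integral>y. kern b (T * (y - x)) \<partial>\<mu>\<^sub>2))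
        = (\<integral>v. ?e v * ?d v \<partial>clip b)" .
    have di: "integrable (clip b) (\<lambda>v. ?e v * ?d v)"
      using Bochner_Integration.integrable_diff[OF i[OF \<mu>(1)] i[OF \<mu>(2)]]
      by (simp only: right_diff_distrib[symmetric] wd)
    have "cmod (\<integral>v. ?e v * ?d v \<partial>clip b) \<le> (\<integral>v. cmod (?e v * ?d v) \<partial>clip b)"
      by (rule integral_norm_bound)
    also have "\<dots> \<le> (\<integral>v. E * (75 * E * pi) * (\<epsilon> / T / (1 + x ^ 4)) \<partial>clip b)"
    proof (intro integral_mono integrable_norm di integrable_clip continuous_intros)
      fix v assume "v \<in> space (clip b)"
      then have v: "v \<in> {-b..b}" by simp
      have p: "0 < 1 + x ^ 4" by (simp add: add_pos_nonneg)
      have "(1 + (- x) ^ 4) * cmod (?d v) \<le> 75 * E * pi * \<epsilon> / T"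
        unfolding E_def using assms that v by (intro inner_wave_bound D) auto
      moreover have "(- x) ^ 4 = x ^ 4" by simp
      ultimately have "cmod (?d v) \<le> 75 * E * pi * \<epsilon> / T / (1 + x ^ 4)"
        using p by (simp only: pos_le_divide_eq mult.commute)
      then have "cmod (?d v) \<le> 75 * E * pi * (\<epsilon> / T / (1 + x ^ 4))"
        by (simp only: times_divide_eq_right)
      moreover have "cmod (?e v) \<le> E"
        unfolding norm_mult E_def using v assms norm_bump_le[of "of_real v" b] by auto
      ultimately have "cmod (?e v) * cmod (?d v) \<le> E * (75 * E * pi * (\<epsilon> / T / (1 + x ^ 4)))"
        using \<open>0 < E\<close> by (intro mult_mono) (simp_all only: norm_ge_zero less_imp_le)
      then show "cmod (?e v * ?d v) \<le> E * (75 * E * pi) * (\<epsilon> / T / (1 + x ^ 4))"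
        by (simp only: norm_mult mult.assoc)
    qed
    also have "\<dots> = C * (\<epsilon> / T / (1 + x ^ 4))"
      unfolding C_def by simp
    finally have "\<bar>(\<integral>y. kern b (T * (y - x)) \<partial>\<mu>\<^sub>1) - (\<integral>y. kern b (T * (y - x)) \<partial>\<mu>\<^sub>2)\<bar> \<le> C * (\<epsilon> / T / (1 + x ^ 4))"
      unfolding eq[symmetric] norm_of_real .
    moreover have "0 < 1 + x ^ 4" by (simp add: add_pos_nonneg)
    ultimately show ?thesis by (simp only: times_divide_eq_right pos_le_divide_eq mult.commute[of _ "1 + x ^ 4"])
  qed
  have "0 \<le> C" unfolding C_def using \<open>0 < E\<close> by (intro integral_nonneg_AE) auto
  show ?thesis
  proof (rule that[of "C + 1"])
    show "0 < C + 1" using \<open>0 \<le> C\<close> by simp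
    fix T \<epsilon> :: real and \<mu>\<^sub>1 \<mu>\<^sub>2 D x
    assume *: "1 \<le> T" "0 \<le> \<epsilon>" "real_distribution \<mu>\<^sub>1" "real_distribution \<mu>\<^sub>2" "D holomorphic_on UNIV"
      "\<And>s. char \<mu>\<^sub>1 s - char \<mu>\<^sub>2 s = D (of_real s)"
      "\<And>w. \<bar>Im w\<bar> \<le> 1 \<Longrightarrow> \<bar>Re w\<bar> \<le> 2 * b * T + 1 \<Longrightarrow> cmod (D w) \<le> \<epsilon> / (1 + (Re w)\<^sup>2)"
    have "C * \<epsilon> / T \<le> (C + 1) * \<epsilon> / T"
      using *(1,2) by (intro divide_right_mono mult_right_mono) auto
    with C[OF *, of x]
    show "(1 + x ^ 4) * \<bar>(\<integral>y. kern b (T * (y - x)) \<partial>\<mu>\<^sub>1) - (\<integral>y. kern b (T * (y - x)) \<partial>\<mu>\<^sub>2)\<bar> \<le> (C + 1) * \<epsilon> / T"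
      by linarith
  qed
qed

section \<open>Powers of a characteristic function near the Gaussian\<close>

text \<open>The characteristic function at complex arguments. Truncated scaled steps live on
  [-1, 1], which makes it entire.\<close>

definition cchar :: "real measure \<Rightarrow> complex \<Rightarrow> complex" where
  "cchar \<mu> w = (\<integral>x. exp (\<i> * w * of_real x) \<partial>\<mu>)"

lemma cchar_of_real: "cchar \<mu> (of_real s) = char \<mu> s"
  by (simp add: cchar_def char_def mult.assoc)

lemma norm_integral_le_AE:
  fixes f :: "'a \<Rightarrow> 'b :: {second_countable_topology, banach}"
  assumes "integrable M f" "integrable M g" "AE x in M. norm (f x) \<le> g x"
  shows "norm (integral\<^sup>L M f) \<le> integral\<^sup>L M g"
  by (rule order_trans[OF integral_norm_bound integral_mono_AE]) (use assms in auto)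

lemma norm_exp_imaginary_le:
  assumes "\<bar>x\<bar> \<le> 1"
  shows "cmod (exp (\<i> * w * of_real x)) \<le> exp (cmod w)"
proof -
  have "cmod (\<i> * w * of_real x) \<le> cmod w"
    using assms by (simp add: norm_mult mult_left_le)
  then show ?thesis
    using norm_exp[of "\<i> * w * of_real x"] by (meson exp_le_cancel_iff order_trans)
qed

lemma integrable_bounded_support:
  fixes f :: "real \<Rightarrow> 'a :: {second_countable_topology, banach}"
  assumes "real_distribution \<mu>" "AE x in \<mu>. \<bar>x\<bar> \<le> 1" "f \<in> borel_measurable borel"
    and "\<And>x. \<bar>x\<bar> \<le> 1 \<Longrightarrow> norm (f x) \<le> K"
  shows "integrable \<mu> f"
proof -
  interpret \<mu>: real_distribution \<mu> by fact
  show ?thesis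
    using assms by (intro \<mu>.integrable_const_bound[where B = K]) auto
qed

text \<open>Differentiation under the integral: the error of the difference quotient comes from |exp
  z - 1 - z| \<le> exp |z| |z|^2 with |z| \<le> |h|, so it is of order |h|.\<close>

lemma cchar_holomorphic:
  assumes \<mu>: "real_distribution \<mu>" "AE x in \<mu>. \<bar>x\<bar> \<le> 1"
  shows "cchar \<mu> holomorphic_on UNIV"
proof -
  interpret \<mu>: real_distribution \<mu> by fact
  have "\<exists>d. (cchar \<mu> has_field_derivative d) (at w)" for w
  proof -
    let ?e = "\<lambda>w x. exp (\<i> * w * of_real x) :: complex"
    define d where "d = (\<integral>x. \<i> * of_real x * ?e w x \<partial>\<mu>)"
    have ie: "integrable \<mu> (?e w)" for w
      by (rule integrable_bounded_support[OF \<mu>]) (use norm_exp_imaginary_le in auto)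
    have id: "integrable \<mu> (\<lambda>x. \<i> * of_real x * ?e w x)"
    proof (rule integrable_bounded_support[OF \<mu>, where K = "1 * exp (cmod w)"])
      show "norm (\<i> * of_real x * ?e w x) \<le> 1 * exp (cmod w)" if "\<bar>x\<bar> \<le> 1" for x
        using that norm_exp_imaginary_le[OF that, of w] unfolding norm_mult
        by (intro mult_mono) auto
    qed auto
    have bound: "cmod ((cchar \<mu> (w + h) - cchar \<mu> w) / h - d) \<le> exp (cmod w) * exp 1 * cmod h"
      if h: "h \<noteq> 0" "cmod h \<le> 1" for h
    proof -
      have "cchar \<mu> (w + h) - cchar \<mu> w - h * d = (\<integral>x. ?e (w + h) x - ?e w x - h * (\<i> * of_real x * ?e w x) \<partial>\<mu>)"
        unfolding cchar_def d_def using ie id by simp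
      also have "cmod \<dots> \<le> (\<integral>x. exp (cmod w) * exp 1 * (cmod h)\<^sup>2 \<partial>\<mu>)"
      proof (rule norm_integral_le_AE)
        show "integrable \<mu> (\<lambda>x. ?e (w + h) x - ?e w x - h * (\<i> * of_real x * ?e w x))"
          using ie id by simp
        show "AE x in \<mu>. cmod (?e (w + h) x - ?e w x - h * (\<i> * of_real x * ?e w x))
            \<le> exp (cmod w) * exp 1 * (cmod h)\<^sup>2"
          using \<mu>(2)
        proof eventually_elim
          case (elim x)
          let ?z = "\<i> * h * of_real x"
          have z: "cmod ?z \<le> cmod h"
            using elim by (simp add: norm_mult mult_left_le)
          have "cmod (exp ?z - (\<Sum>i\<le>1. ?z ^ i / fact i)) \<le> exp (cmod ?z) * cmod ?z ^ Suc 1 / fact 1"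
            by (rule Taylor_exp_field)
          then have "cmod (exp ?z - 1 - ?z) \<le> exp (cmod ?z) * (cmod ?z)\<^sup>2"
            by (simp add: algebra_simps power2_eq_square)
          also have "\<dots> \<le> exp 1 * (cmod h)\<^sup>2"
            using z h by (intro mult_mono power_mono) auto
          finally have "cmod (?e w x) * cmod (exp ?z - 1 - ?z) \<le> exp (cmod w) * (exp 1 * (cmod h)\<^sup>2)"
            using norm_exp_imaginary_le[OF elim, of w] by (intro mult_mono) auto
          moreover have "?e (w + h) x - ?e w x - h * (\<i> * of_real x * ?e w x) = ?e w x * (exp ?z - 1 - ?z)"
            by (simp add: exp_add[symmetric] algebra_simps)
          ultimately show ?case by (simp add: norm_mult)
        qed
      qed simp
      also have "\<dots> = exp (cmod w) * exp 1 * (cmod h)\<^sup>2" 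
        by (simp add: \<mu>.prob_space[unfolded \<mu>.space_eq_univ])
      finally have "cmod (cchar \<mu> (w + h) - cchar \<mu> w - h * d) / cmod h \<le> exp (cmod w) * exp 1 * (cmod h)\<^sup>2 / cmod h"
        by (intro divide_right_mono) auto
      moreover have "(cchar \<mu> (w + h) - cchar \<mu> w) / h - d = (cchar \<mu> (w + h) - cchar \<mu> w - h * d) / h"
        using h by (simp add: field_simps)
      ultimately show ?thesis
        using h by (simp add: norm_divide power2_eq_square)
    qed
    have "((\<lambda>h. (cchar \<mu> (w + h) - cchar \<mu> w) / h - d) \<longlongrightarrow> 0) (at 0)"
    proof (rule Lim_null_comparison)
      show "\<forall>\<^sub>F h in at 0. norm ((cchar \<mu> (w + h) - cchar \<mu> w) / h - d) \<le> exp (cmod w) * exp 1 * cmod h"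
        unfolding eventually_at by (rule exI[of _ 1]) (auto intro!: bound)
      show "((\<lambda>h. exp (cmod w) * exp 1 * cmod h) \<longlongrightarrow> 0) (at 0)"
        by (auto intro!: tendsto_eq_intros)
    qed
    then have "(cchar \<mu> has_field_derivative d) (at w)"
      unfolding DERIV_def by (rule LIM_zero_cancel)
    then show ?thesis by blast
  qed
  then show ?thesis
    unfolding holomorphic_on_def field_differentiable_def by (simp)
qed

text \<open>Interpolates between two Taylor remainders: the cubic one where |z| \<le> 1, and the
  quadratic one plus the term z^2/2 where |z| > 1. The condition on Re z keeps the exponential
  factor below 3.\<close>

lemma norm_exp_taylor2:
  assumes "\<bar>Re z\<bar> \<le> 1" "0 \<le> \<delta>" "\<delta> \<le> 1"
  shows "cmod (exp z - (1 + z + z\<^sup>2 / 2)) \<le> 4 * cmod z powr (2 + \<delta>)"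
proof (cases "z = 0")
  case False
  have e3: "exp \<bar>Re z\<bar> \<le> 3"
    using assms(1) exp_le by (meson exp_le_cancel_iff order_trans)
  have 2: "cmod (exp z - (1 + z)) \<le> 3 * (cmod z)\<^sup>2"
  proof -
    have "cmod (exp z - (\<Sum>k\<le>1. z ^ k / fact k)) \<le> exp \<bar>Re z\<bar> * cmod z ^ Suc 1 / fact 1"
      by (rule Taylor_exp)
    also have "\<dots> \<le> 3 * (cmod z)\<^sup>2"
      using e3 by (simp add: power2_eq_square mult_right_mono)
    finally show ?thesis by (simp add: algebra_simps)
  qed
  show ?thesis
  proof (cases "cmod z \<le> 1")
    case True
    have "cmod (exp z - (\<Sum>k\<le>2. z ^ k / fact k)) \<le> exp \<bar>Re z\<bar> * cmod z ^ Suc 2 / fact 2"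
      by (rule Taylor_exp)
    also have "\<dots> \<le> 4 * cmod z ^ 3"
    proof -
      have "exp \<bar>Re z\<bar> * cmod z ^ 3 \<le> 8 * cmod z ^ 3"
        using e3 by (intro mult_right_mono) auto
      then show ?thesis by (simp add: eval_nat_numeral)
    qed
    also have "cmod z ^ 3 = cmod z powr 3"
      using False by (simp add: powr_numeral)
    also have "\<dots> \<le> cmod z powr (2 + \<delta>)"
      using True assms False by (intro powr_mono') auto
    finally show ?thesis by (simp add: eval_nat_numeral algebra_simps)
  next
    case big: False
    have "cmod (exp z - (1 + z + z\<^sup>2 / 2)) \<le> cmod (exp z - (1 + z)) + cmod (z\<^sup>2 / 2)"
      using norm_triangle_ineq4[of "exp z - (1 + z)" "z\<^sup>2 / 2"] by (simp add: algebra_simps)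
    also have "\<dots> \<le> 4 * (cmod z)\<^sup>2"
    proof -
      have "cmod (z\<^sup>2 / 2) = (cmod z)\<^sup>2 / 2" by (simp add: norm_divide norm_power)
      then show ?thesis using 2 zero_le_power2[of "cmod z"] by linarith
    qed
    also have "(cmod z)\<^sup>2 = cmod z powr 2"
      using False by (simp add: powr_numeral)
    also have "\<dots> \<le> cmod z powr (2 + \<delta>)"
      using big assms by (intro powr_mono) auto
    finally show ?thesis by simp
  qed
qed simp

text \<open>Truncation shifts the mean away from 0 and the second moment away from \<open>v\<close>,
  so both enter as errors; the three terms on the right stand for the mean, the second moment and
  the Taylor remainder. Since |x| \<le> 1 and |Im w| \<le> 1, the real part of i w x is at most 1 in
  modulus, as \<open>norm_exp_taylor2\<close> requires.\<close>

lemma cchar_taylor: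
  assumes \<mu>: "real_distribution \<mu>" "AE x in \<mu>. \<bar>x\<bar> \<le> 1"
    and \<delta>: "0 \<le> \<delta>" "\<delta> \<le> 1" and w: "\<bar>Im w\<bar> \<le> 1"
    and m1: "\<bar>\<integral>x. x \<partial>\<mu>\<bar> \<le> e" and m2: "\<bar>(\<integral>x. x\<^sup>2 \<partial>\<mu>) - v\<bar> \<le> e"
    and m3: "(\<integral>x. \<bar>x\<bar> powr (2 + \<delta>) \<partial>\<mu>) \<le> e"
  shows "cmod (cchar \<mu> w - (1 - v * w\<^sup>2 / 2))
    \<le> e * (cmod w + (cmod w)\<^sup>2 / 2 + 4 * cmod w powr (2 + \<delta>))"
proof -
  interpret \<mu>: real_distribution \<mu> by fact
  let ?z = "\<lambda>x :: real. \<i> * w * of_real x"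
  have i1: "integrable \<mu> (\<lambda>x. x)" and i2: "integrable \<mu> (\<lambda>x. x\<^sup>2)"
    by (rule integrable_bounded_support[OF \<mu>, where K = 1]; auto simp: abs_square_le_1)+
  have i3: "integrable \<mu> (\<lambda>x. \<bar>x\<bar> powr (2 + \<delta>))"
    by (rule integrable_bounded_support[OF \<mu>, where K = 1])
      (use \<delta> in \<open>auto intro!: powr_le1\<close>)
  have ie: "integrable \<mu> (\<lambda>x. exp (?z x))"
    by (rule integrable_bounded_support[OF \<mu>]) (use norm_exp_imaginary_le in auto)
  have ip: "integrable \<mu> (\<lambda>x. 1 + ?z x + (?z x)\<^sup>2 / 2)"
  proof -
    have "integrable \<mu> (\<lambda>x. complex_of_real x)" "integrable \<mu> (\<lambda>x. complex_of_real (x\<^sup>2))"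
      using i1 i2 integrable_of_real by blast+
    then show ?thesis
      by (simp add: power_mult_distrib)
  qed
  have p: "(\<integral>x. 1 + ?z x + (?z x)\<^sup>2 / 2 \<partial>\<mu>)
      = 1 + \<i> * w * of_real (\<integral>x. x \<partial>\<mu>) - w\<^sup>2 / 2 * of_real (\<integral>x. x\<^sup>2 \<partial>\<mu>)"
  proof -
    have "integrable \<mu> (\<lambda>x. complex_of_real x)" "integrable \<mu> (\<lambda>x. complex_of_real (x\<^sup>2))"
      using i1 i2 integrable_of_real by blast+
    moreover have "1 + ?z x + (?z x)\<^sup>2 / 2
        = 1 + \<i> * w * of_real x - w\<^sup>2 / 2 * of_real (x\<^sup>2)" for x
      by (simp add: power_mult_distrib)
    ultimately show ?thesis
      by (simp add: integral_complex_of_real[symmetric] \<mu>.prob_space[unfolded \<mu>.space_eq_univ] del: integral_complex_of_real of_real_power)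
  qed
  have "cmod (cchar \<mu> w - (1 + \<i> * w * of_real (\<integral>x. x \<partial>\<mu>) - w\<^sup>2 / 2 * of_real (\<integral>x. x\<^sup>2 \<partial>\<mu>)))
    = cmod (\<integral>x. exp (?z x) - (1 + ?z x + (?z x)\<^sup>2 / 2) \<partial>\<mu>)"
    unfolding cchar_def p[symmetric] using ie ip by (subst Bochner_Integration.integral_diff) auto
  also have "\<dots> \<le> (\<integral>x. 4 * cmod w powr (2 + \<delta>) * \<bar>x\<bar> powr (2 + \<delta>) \<partial>\<mu>)"
  proof (rule norm_integral_le_AE)
    show "integrable \<mu> (\<lambda>x. exp (?z x) - (1 + ?z x + (?z x)\<^sup>2 / 2))"
      using ie ip by simp
    show "AE x in \<mu>. cmod (exp (?z x) - (1 + ?z x + (?z x)\<^sup>2 / 2))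
        \<le> 4 * cmod w powr (2 + \<delta>) * \<bar>x\<bar> powr (2 + \<delta>)"
      using \<mu>(2)
    proof eventually_elim
      case (elim x)
      have "\<bar>Im w * x\<bar> \<le> 1 * 1"
        unfolding abs_mult using elim w by (intro mult_mono) auto
      then have "\<bar>Re (?z x)\<bar> \<le> 1" by simp
      from norm_exp_taylor2[OF this \<delta>] show ?case
        by (simp add: norm_mult powr_mult)
    qed
  qed (use i3 in simp)
  also have "\<dots> \<le> 4 * cmod w powr (2 + \<delta>) * e"
    using m3 by (simp add: mult_left_mono)
  finally have 1: "cmod (cchar \<mu> w - (1 + \<i> * w * of_real (\<integral>x. x \<partial>\<mu>) - w\<^sup>2 / 2 * of_real (\<integral>x. x\<^sup>2 \<partial>\<mu>)))
      \<le> 4 * cmod w powr (2 + \<delta>) * e" .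
  have 2: "cmod (\<i> * w * of_real (\<integral>x. x \<partial>\<mu>)) \<le> cmod w * e"
    using m1 by (simp add: norm_mult mult_left_mono)
  have 3: "cmod (w\<^sup>2 / 2 * of_real ((\<integral>x. x\<^sup>2 \<partial>\<mu>) - v)) \<le> (cmod w)\<^sup>2 / 2 * e"
    unfolding norm_mult norm_divide norm_power norm_of_real
    using m2 by (simp add: mult_left_mono divide_right_mono)
  have "cchar \<mu> w - (1 - v * w\<^sup>2 / 2)
    = (cchar \<mu> w - (1 + \<i> * w * of_real (\<integral>x. x \<partial>\<mu>) - w\<^sup>2 / 2 * of_real (\<integral>x. x\<^sup>2 \<partial>\<mu>)))
      + \<i> * w * of_real (\<integral>x. x \<partial>\<mu>) - w\<^sup>2 / 2 * of_real ((\<integral>x. x\<^sup>2 \<partial>\<mu>) - v)"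
    by (simp add: field_simps)
  also have "cmod \<dots> \<le> 4 * cmod w powr (2 + \<delta>) * e + cmod w * e + (cmod w)\<^sup>2 / 2 * e"
    by (intro order_trans[OF norm_triangle_ineq4] order_trans[OF norm_triangle_ineq] add_mono 1 2 3)
  finally show ?thesis by (simp add: algebra_simps)
qed

section \<open>Comparison of n-th powers\<close>

lemma gaussian_poly_bound: "(1 + a\<^sup>2) ^ 3 * exp (- a\<^sup>2 / 8) \<le> (41472 :: real)"
proof -
  \<comment> \<open>Rests on (1 + x/3)^3 \<le> exp x: with 1 + a^2 = 8 x it gives the constant 24^3
    = 13824, and exp (1/8) \<le> 3 triples it.\<close>
  define x where "x = (1 + a\<^sup>2) / 8"
  have "0 \<le> x" by (simp add: x_def)
  then have "(x / 3) ^ 3 \<le> (1 + x / of_nat 3) ^ 3"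
    by (intro power_mono) auto
  also have "\<dots> \<le> exp x"
    using \<open>0 \<le> x\<close> by (intro exp_ge_one_plus_x_over_n_power_n) auto
  finally have "(1 + a\<^sup>2) ^ 3 \<le> 13824 * exp x"
    by (simp add: x_def power_divide)
  then have "(1 + a\<^sup>2) ^ 3 * exp (- a\<^sup>2 / 8) \<le> 13824 * exp x * exp (- a\<^sup>2 / 8)"
    by (intro mult_right_mono) auto
  also have "\<dots> = 13824 * exp (1 / 8)"
    by (simp add: x_def mult.assoc exp_add[symmetric] add_divide_distrib)
  also have "\<dots> \<le> 13824 * 3"
    using exp_le by (intro mult_left_mono) (auto intro: order_trans[of _ "exp 1"])
  finally show ?thesis by simp
qed

text \<open>The two numbers below are the values at \<open>w = a + \<i> b\<close> of the characteristic function of one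
  truncated, normalised step and of the Gaussian of the same variance \<open>1 / n\<close>.\<close>

lemma norm_one_minus_square_le:
  fixes n :: real
  assumes "\<bar>Im w\<bar> \<le> 1" "(Re w)\<^sup>2 \<le> n" "1 \<le> n"
  shows "cmod (1 - w\<^sup>2 / (2 * of_real n)) \<le> 1 + (5 / 2 - 3 / 8 * (Re w)\<^sup>2) / n"
proof -
  define a b where "a = Re w" and "b = Im w"
  have b: "b\<^sup>2 \<le> 1" using assms by (simp add: b_def abs_square_le_1)
  \<comment> \<open>Since 8 |a| \<le> a^2 + 16, the cross term costs a^2/8 of the gain a^2/2 from
    the real part. This is the origin of 3/8 and, together with b^2/2, of 5/2.\<close>
  have ab: "\<bar>a * b\<bar> \<le> a\<^sup>2 / 8 + 2"
  proof -
    have "\<bar>a * b\<bar> \<le> \<bar>a\<bar> * 1"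
      unfolding abs_mult using assms by (intro mult_left_mono) (auto simp: b_def)
    moreover have "0 \<le> (\<bar>a\<bar> - 4)\<^sup>2" by simp
    then have "8 * \<bar>a\<bar> \<le> a\<^sup>2 + 16" by (simp add: power2_eq_square algebra_simps)
    ultimately show ?thesis by simp
  qed
  have Re: "Re (1 - w\<^sup>2 / (2 * of_real n)) = 1 - (a\<^sup>2 - b\<^sup>2) / (2 * n)"
    and Im: "Im (1 - w\<^sup>2 / (2 * of_real n)) = - (a * b) / n"
  proof -
    have "w\<^sup>2 / (2 * of_real n) = w\<^sup>2 / of_real (2 * n)" by simp
    then show "Re (1 - w\<^sup>2 / (2 * of_real n)) = 1 - (a\<^sup>2 - b\<^sup>2) / (2 * n)"
      "Im (1 - w\<^sup>2 / (2 * of_real n)) = - (a * b) / n"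
      by (simp_all only: minus_complex.sel Re_divide_of_real Im_divide_of_real)
        (simp_all add: a_def b_def power2_eq_square)
  qed
  have "cmod (1 - w\<^sup>2 / (2 * of_real n)) \<le> \<bar>1 - (a\<^sup>2 - b\<^sup>2) / (2 * n)\<bar> + \<bar>a * b\<bar> / n"
    using cmod_le[of "1 - w\<^sup>2 / (2 * of_real n)"] assms unfolding Re Im by simp
  also have "\<bar>1 - (a\<^sup>2 - b\<^sup>2) / (2 * n)\<bar> = 1 - (a\<^sup>2 - b\<^sup>2) / (2 * n)"
  proof -
    have "a\<^sup>2 - b\<^sup>2 \<le> 2 * n"
      using assms(2,3) zero_le_power2[of b] unfolding a_def by linarith
    then show ?thesis using assms by simp
  qed
  also have "\<dots> + \<bar>a * b\<bar> / n \<le> (1 - (a\<^sup>2 - 1) / (2 * n)) + (a\<^sup>2 / 8 + 2) / n"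
    using ab b assms by (intro add_mono diff_left_mono divide_right_mono) auto
  also have "\<dots> = 1 + (5 / 2 - 3 / 8 * a\<^sup>2) / n"
    using assms by (simp add: field_simps)
  finally show ?thesis by (simp add: a_def)
qed

text \<open>Both \<open>z\<close> and the Gaussian factor g have modulus at most some R with R^(n -
  1) \<le> exp 3 * exp (-a^2/8), so the telescoped difference of the powers is at most n R^(n - 1)
  |z - g|. As |z - g| is of order n^(-1 - \<delta>/2) (1 + a^2)^2, the factor n cancels, and the
  Gaussian absorbs the polynomial with one factor 1/(1 + a^2) to spare. Smallness of
  \<open>a\<^sub>0\<close> makes the remainder of order 2 + \<delta> a small part of the quadratic
  term.\<close>

lemma power_difference_estimate:
  fixes \<delta> B a\<^sub>0 :: real and n :: nat
  assumes \<delta>: "0 < \<delta>" "\<delta> \<le> 1" and B: "1 \<le> B"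
    and a0: "0 < a\<^sub>0" "a\<^sub>0 \<le> 1 / 2" "4 * B * (2 * a\<^sub>0) powr \<delta> \<le> 1 / 16"
    and n: "2 \<le> n" "2 \<le> a\<^sub>0 * sqrt n" "B * n powr (- \<delta> / 2) \<le> 1 / 16"
    and w: "\<bar>Im w\<bar> \<le> 1" "\<bar>Re w\<bar> \<le> a\<^sub>0 * sqrt n + 1"
    and z: "cmod (z - (1 - w\<^sup>2 / (2 * of_nat n)))
      \<le> B * n powr (- 1 - \<delta> / 2) * (cmod w + (cmod w)\<^sup>2 / 2 + 4 * cmod w powr (2 + \<delta>))"
  shows "cmod (z ^ n - exp (- w\<^sup>2 / 2)) \<le> 28 * exp 3 * 41472 * B * n powr (- \<delta> / 2) / (1 + (Re w)\<^sup>2)"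
proof -
  define N where "N = real n"
  have N: "2 \<le> N" using n by (simp add: N_def)
  define a where "a = Re w"
  define \<theta> where "\<theta> = B * N powr (- \<delta> / 2)"
  have \<theta>: "0 \<le> \<theta>" "\<theta> \<le> 1 / 16" using B n by (auto simp: \<theta>_def N_def)
  have e: "B * n powr (- 1 - \<delta> / 2) = \<theta> / N"
  proof -
    have "N powr (- 1 - \<delta> / 2) = N powr (- \<delta> / 2 + - 1)" by (simp add: algebra_simps)
    also have "\<dots> = N powr (- \<delta> / 2) / N"
      unfolding powr_add using N powr_minus_divide[of N 1] by simp
    finally show ?thesis by (simp add: \<theta>_def N_def)
  qed
  have s1: "1 \<le> sqrt N" using N by simp
  have sq: "(sqrt N)\<^sup>2 = N" using N by simp
  have a: "\<bar>a\<bar> \<le> 2 * a\<^sub>0 * sqrt N"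
    using w n by (simp add: a_def N_def)
  have "(2 * a\<^sub>0 * sqrt N)\<^sup>2 \<le> (1 * sqrt N)\<^sup>2"
    using a0 N by (intro power_mono mult_right_mono) auto
  moreover have "a\<^sup>2 \<le> (2 * a\<^sub>0 * sqrt N)\<^sup>2"
    using a by (intro abs_le_square_iff[THEN iffD1]) auto
  ultimately have a2: "a\<^sup>2 \<le> N" using sq by simp
  have w2: "(cmod w)\<^sup>2 \<le> a\<^sup>2 + 1"
    using w(1) by (simp add: cmod_power2 a_def abs_square_le_1)
  have w1: "cmod w \<le> (1 + (cmod w)\<^sup>2) / 2"
    using zero_le_power2[of "cmod w - 1"] by (simp add: power2_eq_square algebra_simps)
  have wT: "cmod w / sqrt N \<le> 2 * a\<^sub>0"
  proof -
    have "cmod w \<le> \<bar>Re w\<bar> + \<bar>Im w\<bar>" by (rule cmod_le)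
    also have "\<dots> \<le> 2 * a\<^sub>0 * sqrt N" using w n by (simp add: N_def)
    finally show ?thesis using s1 by (simp add: field_simps)
  qed
  \<comment> \<open>In |w|^(2 + \<delta>) the surplus |w|^\<delta> is at most (2
    \<open>a\<^sub>0\<close> sqrt N)^\<delta>, and the power of N cancels against N^(-\<delta>/2) in
    \<open>\<theta>\<close>. What is left is |w|^2 with a small constant.\<close>
  have high: "\<theta> / N * (4 * cmod w powr (2 + \<delta>)) \<le> (cmod w)\<^sup>2 / (16 * N)"
  proof -
    have "\<theta> * cmod w powr (2 + \<delta>) = B * (cmod w)\<^sup>2 * (cmod w / sqrt N) powr \<delta>"
    proof -
      have "N powr (- \<delta> / 2) = (sqrt N) powr (- \<delta>)"
        using N by (simp add: powr_half_sqrt[symmetric] powr_powr)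
      also have "\<dots> = 1 / sqrt N powr \<delta>" by (rule powr_minus_divide)
      finally have "\<theta> = B / sqrt N powr \<delta>" by (simp add: \<theta>_def)
      moreover have "cmod w powr (2 + \<delta>) = (cmod w)\<^sup>2 * cmod w powr \<delta>"
        by (cases "w = 0") (simp_all add: powr_add powr_numeral)
      moreover have "(cmod w / sqrt N) powr \<delta> = cmod w powr \<delta> / sqrt N powr \<delta>"
        using N by (intro powr_divide)
      ultimately show ?thesis by simp
    qed
    also have "\<dots> \<le> B * (cmod w)\<^sup>2 * (2 * a\<^sub>0) powr \<delta>"
      using wT B \<delta> s1 by (intro mult_left_mono powr_mono2) auto
    finally have "4 * (\<theta> * cmod w powr (2 + \<delta>)) \<le> (4 * B * (2 * a\<^sub>0) powr \<delta>) * (cmod w)\<^sup>2"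
      by (simp add: mult_ac)
    also have "\<dots> \<le> 1 / 16 * (cmod w)\<^sup>2"
      by (intro mult_right_mono a0(3)) auto
    finally show ?thesis using N by (simp add: field_simps)
  qed
  \<comment> \<open>The coefficient of a^2 is -3/8 + 1/16 + 1/16 = -1/4: the decay of 1 - w^2/(2n),
    weakened by the lower order error and by the remainder \<open>high\<close>. The constants add up
    to less than 3.\<close>
  define R where "R = exp ((3 - a\<^sup>2 / 4) / N)"
  define g where "g = exp (- w\<^sup>2 / (2 * of_nat n))"
  have gn: "g ^ n = exp (- w\<^sup>2 / 2)"
    using n by (simp add: g_def exp_of_nat_mult[symmetric])
  have zR: "cmod z \<le> R"
  proof -
    have "cmod z \<le> cmod (1 - w\<^sup>2 / (2 * of_nat n)) + cmod (z - (1 - w\<^sup>2 / (2 * of_nat n)))"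
      by (rule norm_triangle_sub)
    also have "\<dots> \<le> (1 + (5 / 2 - 3 / 8 * a\<^sup>2) / N)
        + (\<theta> / N * (cmod w + (cmod w)\<^sup>2 / 2) + (cmod w)\<^sup>2 / (16 * N))"
    proof (rule add_mono)
      show "cmod (1 - w\<^sup>2 / (2 * of_nat n)) \<le> 1 + (5 / 2 - 3 / 8 * a\<^sup>2) / N"
        using norm_one_minus_square_le[OF w(1), of N] a2 N by (simp add: N_def a_def)
      show "cmod (z - (1 - w\<^sup>2 / (2 * of_nat n))) \<le> \<theta> / N * (cmod w + (cmod w)\<^sup>2 / 2) + (cmod w)\<^sup>2 / (16 * N)"
        using z high unfolding e by (simp add: distrib_left)
    qed
    also have "\<dots> \<le> (1 + (5 / 2 - 3 / 8 * a\<^sup>2) / N) + ((a\<^sup>2 + 3 / 2) / 16 / N + (a\<^sup>2 + 1) / (16 * N))"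
    proof (intro add_mono order_refl)
      have "\<theta> * (cmod w + (cmod w)\<^sup>2 / 2) \<le> 1 / 16 * (a\<^sup>2 + 3 / 2)"
        using w1 w2 \<theta> by (intro mult_mono) auto
      then have "\<theta> * (cmod w + (cmod w)\<^sup>2 / 2) \<le> (a\<^sup>2 + 3 / 2) / 16" by simp
      then have "\<theta> * (cmod w + (cmod w)\<^sup>2 / 2) / N \<le> (a\<^sup>2 + 3 / 2) / 16 / N"
        using N by (intro divide_right_mono) auto
      then show "\<theta> / N * (cmod w + (cmod w)\<^sup>2 / 2) \<le> (a\<^sup>2 + 3 / 2) / 16 / N"
        by (simp only: times_divide_eq_left)
      show "(cmod w)\<^sup>2 / (16 * N) \<le> (a\<^sup>2 + 1) / (16 * N)"
        using w2 N by (intro divide_right_mono) auto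
    qed
    also have "\<dots> \<le> 1 + (3 - a\<^sup>2 / 4) / N"
      using N by (simp add: field_simps)
    also have "\<dots> \<le> R" unfolding R_def by (rule exp_ge_add_one_self)
    finally show ?thesis .
  qed
  have gR: "cmod g \<le> R"
  proof -
    have "Re (- w\<^sup>2 / (2 * of_nat n)) = (- a\<^sup>2 + (Im w)\<^sup>2) / (2 * N)"
    proof -
      have "- w\<^sup>2 / (2 * of_nat n) = - w\<^sup>2 / of_real (2 * N)" by (simp add: N_def)
      then show ?thesis
        by (simp only: Re_divide_of_real) (simp add: a_def power2_eq_square)
    qed
    also have "\<dots> \<le> (- a\<^sup>2 + 1) / (2 * N)"
      using w(1) N by (intro divide_right_mono add_left_mono) (auto simp: abs_square_le_1)
    also have "\<dots> \<le> (3 - a\<^sup>2 / 4) / N"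
      using N zero_le_power2[of a] by (simp add: field_simps)
    finally show ?thesis unfolding g_def R_def norm_exp_eq_Re by simp
  qed
  \<comment> \<open>The hypothesis compares \<open>z\<close> with 1 - w^2/(2n). Passing on to g =
    exp (-w^2/(2n)) costs |w|^4/N^2, which is below (\<open>\<theta>\<close>/N) |w|^4 because 1/N
    \<le> N^(-\<delta>/2) and B \<ge> 1.\<close>
  have diff: "cmod (z - g) \<le> 28 * (\<theta> / N) * (1 + a\<^sup>2)\<^sup>2"
  proof -
    let ?u = "- w\<^sup>2 / (2 * of_nat n)"
    have u: "cmod ?u = (cmod w)\<^sup>2 / (2 * N)" using N by (simp add: norm_divide norm_power N_def norm_mult)
    also have "\<dots> \<le> 1" using w2 a2 N by (simp add: field_simps)
    finally have u1: "cmod ?u \<le> 1" .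
    have "cmod (exp ?u - (\<Sum>i\<le>1. ?u ^ i / fact i)) \<le> exp (cmod ?u) * cmod ?u ^ Suc 1 / fact 1"
      by (rule Taylor_exp_field)
    then have "cmod (g - (1 - w\<^sup>2 / (2 * of_nat n))) \<le> exp (cmod ?u) * (cmod ?u)\<^sup>2"
      by (simp add: g_def power2_eq_square)
    also have "\<dots> \<le> 4 * (cmod ?u)\<^sup>2"
      using u1 exp_le by (intro mult_right_mono) (auto intro: order_trans[of _ "exp 1"])
    also have "\<dots> = (cmod w) ^ 4 / N\<^sup>2"
      unfolding u by (simp add: power_divide power_mult_distrib flip: power_mult)
    also have "\<dots> \<le> \<theta> / N * cmod w ^ 4"
    proof -
      have "1 / N = N powr (- 1)" using N powr_minus_divide[of N 1] by simp
      also have "\<dots> \<le> 1 * N powr (- \<delta> / 2)"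
        unfolding mult_1 using N \<delta> by (intro powr_mono) auto
      also have "\<dots> \<le> \<theta>" unfolding \<theta>_def by (intro mult_right_mono B) auto
      finally have "1 / N * (cmod w ^ 4 / N) \<le> \<theta> * (cmod w ^ 4 / N)"
        using N by (intro mult_right_mono) auto
      then show ?thesis by (simp add: power2_eq_square)
    qed
    finally have g: "cmod (g - (1 - w\<^sup>2 / (2 * of_nat n))) \<le> \<theta> / N * cmod w ^ 4" .
    have "cmod (z - g) \<le> cmod (z - (1 - w\<^sup>2 / (2 * of_nat n))) + cmod (g - (1 - w\<^sup>2 / (2 * of_nat n)))"
      by (metis dist_norm dist_commute dist_triangle)
    also have "\<dots> \<le> \<theta> / N * (cmod w + (cmod w)\<^sup>2 / 2 + 4 * cmod w powr (2 + \<delta>)) + \<theta> / N * cmod w ^ 4"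
      using z g unfolding e by (rule add_mono)
    also have "\<dots> = \<theta> / N * (cmod w + (cmod w)\<^sup>2 / 2 + 4 * cmod w powr (2 + \<delta>) + cmod w ^ 4)"
      by (simp add: distrib_left)
    also have "\<dots> \<le> \<theta> / N * (7 * (1 + (cmod w)\<^sup>2)\<^sup>2)"
    proof (intro mult_left_mono)
      define y where "y = (cmod w)\<^sup>2"
      have y: "0 \<le> y" "y\<^sup>2 = cmod w ^ 4" "(1 + y)\<^sup>2 = 1 + 2 * y + y\<^sup>2"
        by (simp_all add: y_def power2_eq_square algebra_simps flip: power_mult) (simp add: eval_nat_numeral)
      have "cmod w powr (2 + \<delta>) \<le> 1 + y\<^sup>2"
      proof (cases "cmod w \<le> 1")
        case True
        then have "cmod w powr (2 + \<delta>) \<le> 1" using \<delta> by (intro powr_le1) auto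
        then show ?thesis using zero_le_power2[of y] by linarith
      next
        case False
        then have "cmod w powr (2 + \<delta>) \<le> cmod w powr 4" using \<delta> by (intro powr_mono) auto
        also have "\<dots> = y\<^sup>2" using False y by (simp add: powr_numeral)
        finally show ?thesis by simp
      qed
      moreover have "X + q / 2 + 4 * P + Q \<le> 7 * (1 + 2 * q + Q)"
        if "P \<le> 1 + Q" "X \<le> (1 + q) / 2" "0 \<le> q" "0 \<le> Q" for X P Q q :: real
        using that by (simp add: algebra_simps)
      ultimately show "cmod w + (cmod w)\<^sup>2 / 2 + 4 * cmod w powr (2 + \<delta>) + cmod w ^ 4 \<le> 7 * (1 + (cmod w)\<^sup>2)\<^sup>2"
        unfolding y_def[symmetric] y(2)[symmetric] y(3)
        using w1[folded y_def] y(1) zero_le_power2 by blast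
    qed (use \<theta> N in auto)
    also have "\<dots> \<le> \<theta> / N * (7 * (2 * (1 + a\<^sup>2))\<^sup>2)"
    proof -
      have "1 + (cmod w)\<^sup>2 \<le> 2 + a\<^sup>2" using w2 by simp
      also have "\<dots> \<le> 2 * (1 + a\<^sup>2)" by simp
      finally show ?thesis
        using \<theta> N by (intro mult_left_mono power_mono) auto
    qed
    also have "\<dots> = 28 * (\<theta> / N) * (1 + a\<^sup>2)\<^sup>2"
      by (simp only: power_mult_distrib) simp
    finally show ?thesis .
  qed
  have "0 < R" by (simp add: R_def)
  have "cmod (z ^ n - g ^ n) \<le> n * R ^ (n - 1) * cmod (z - g)"
  proof -
    have "cmod ((z / R) ^ n - (g / R) ^ n) \<le> n * cmod (z / R - g / R)"
      using zR gR \<open>0 < R\<close> by (intro norm_power_diff) (auto simp: norm_divide)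
    also have "(z / R) ^ n - (g / R) ^ n = (z ^ n - g ^ n) / R ^ n"
      by (simp add: power_divide diff_divide_distrib)
    also have "z / R - g / R = (z - g) / R" by (simp add: diff_divide_distrib)
    finally have "cmod (z ^ n - g ^ n) / R ^ n \<le> n * (cmod (z - g) / R)"
      using \<open>0 < R\<close> by (simp add: norm_divide norm_power)
    then have "cmod (z ^ n - g ^ n) \<le> n * (cmod (z - g) / R) * R ^ n"
      using \<open>0 < R\<close> by (simp add: pos_divide_le_eq)
    also have "R ^ n = R * R ^ (n - 1)"
      using n by (simp add: power_eq_if)
    finally show ?thesis using \<open>0 < R\<close> by (simp add: mult_ac)
  qed
  also have "\<dots> \<le> n * (exp 3 * exp (- a\<^sup>2 / 8)) * (28 * (\<theta> / N) * (1 + a\<^sup>2)\<^sup>2)"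
  proof (intro mult_mono diff)
    have "R ^ (n - 1) = exp (real (n - 1) * ((3 - a\<^sup>2 / 4) / N))"
      by (simp only: R_def exp_of_nat_mult)
    \<comment> \<open>Only n - 1 factors are left, but n - 1 \<ge> n/2, so the rate 1/4 is at worst
      halved to 1/8.\<close>
    moreover have "real (n - 1) * ((3 - a\<^sup>2 / 4) / N) \<le> 3 + - a\<^sup>2 / 8"
    proof -
      have "real (n - 1) = N - 1" using n by (simp add: N_def of_nat_diff)
      moreover have "(N - 1) * (3 - a\<^sup>2 / 4) \<le> (3 + - a\<^sup>2 / 8) * N"
      proof -
        have "0 \<le> a\<^sup>2 * (N - 2)" using N by simp
        then have "2 * a\<^sup>2 \<le> a\<^sup>2 * N" by (simp add: algebra_simps)
        moreover have "3 * N - 3 - q / 4 + p / 4 \<le> 3 * N - q / 8" if "2 * p \<le> q" for p q :: real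
          using that by simp
        moreover have "(N - 1) * (3 - a\<^sup>2 / 4) = 3 * N - 3 - a\<^sup>2 * N / 4 + a\<^sup>2 / 4"
          "(3 + - a\<^sup>2 / 8) * N = 3 * N - a\<^sup>2 * N / 8"
          by (simp_all add: field_simps)
        ultimately show ?thesis by metis
      qed
      ultimately show ?thesis using N by (simp add: pos_divide_le_eq)
    qed
    ultimately show "R ^ (n - 1) \<le> exp 3 * exp (- a\<^sup>2 / 8)"
      by (simp only: exp_add[symmetric] exp_le_cancel_iff)
  qed (use \<open>0 < R\<close> in auto)
  also have "\<dots> = 28 * exp 3 * \<theta> * ((1 + a\<^sup>2) ^ 3 * exp (- a\<^sup>2 / 8)) / (1 + a\<^sup>2)"
  proof -
    have "1 + a\<^sup>2 \<noteq> 0" by (metis add_nonneg_eq_0_iff zero_le_one zero_le_power2 zero_neq_one)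
    then show ?thesis using N by (simp add: N_def power3_eq_cube power2_eq_square)
  qed
  also have "\<dots> \<le> 28 * exp 3 * \<theta> * 41472 / (1 + a\<^sup>2)"
    using \<theta> by (intro divide_right_mono mult_left_mono gaussian_poly_bound) auto
  finally show ?thesis unfolding gn by (simp add: \<theta>_def N_def a_def mult_ac)
qed

text \<open>The entire function \<open>D\<close> is the n-th power of \<open>cchar\<close> minus exp
  (-w^2/2). The three moment hypotheses leave room for exactly the errors that truncation at sqrt n
  produces, and the constants depend on \<delta> and B only.\<close>

lemma char_power_estimate:
  fixes \<delta> B :: real
  assumes \<delta>: "0 < \<delta>" "\<delta> \<le> 1" and B: "1 \<le> B"
  obtains a\<^sub>0 C and n\<^sub>0 :: nat where "0 < a\<^sub>0" "0 < C" "0 < n\<^sub>0"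
    "\<And>n \<mu>. n\<^sub>0 \<le> n \<Longrightarrow> real_distribution \<mu> \<Longrightarrow> AE x in \<mu>. \<bar>x\<bar> \<le> 1 \<Longrightarrow>
      \<bar>\<integral>x. x \<partial>\<mu>\<bar> \<le> B * real n powr (- 1 - \<delta> / 2) \<Longrightarrow>
      \<bar>(\<integral>x. x\<^sup>2 \<partial>\<mu>) - 1 / n\<bar> \<le> B * real n powr (- 1 - \<delta> / 2) \<Longrightarrow>
      (\<integral>x. \<bar>x\<bar> powr (2 + \<delta>) \<partial>\<mu>) \<le> B * real n powr (- 1 - \<delta> / 2) \<Longrightarrow>
      \<exists>D. D holomorphic_on UNIV \<and>
        (\<forall>s. char \<mu> s ^ n - char std_normal_distribution s = D (of_real s)) \<and>
        (\<forall>w. \<bar>Im w\<bar> \<le> 1 \<longrightarrow> \<bar>Re w\<bar> \<le> a\<^sub>0 * sqrt n + 1 \<longrightarrow>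
          cmod (D w) \<le> C * real n powr (- \<delta> / 2) / (1 + (Re w)\<^sup>2))"
proof -
  \<comment> \<open>Solves 4 B (2 a)^\<delta> = 1/16, the smallness condition of
    \<open>power_difference_estimate\<close>.\<close>
  define a\<^sub>0 where "a\<^sub>0 = (1 / (64 * B)) powr (1 / \<delta>) / 2"
  have a0: "0 < a\<^sub>0" "a\<^sub>0 \<le> 1 / 2" "4 * B * (2 * a\<^sub>0) powr \<delta> \<le> 1 / 16"
    using B \<delta> by (auto simp: a\<^sub>0_def powr_powr intro!: powr_le1)
  have "(\<lambda>n :: nat. a\<^sub>0 * sqrt n) \<in> \<omega>(\<lambda>_. 1)"
    using a0 by real_asymp
  then have "\<forall>\<^sub>F n :: nat in sequentially. 2 \<le> a\<^sub>0 * sqrt n"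
    using smallomegaD[of "\<lambda>n :: nat. a\<^sub>0 * sqrt n" _ "\<lambda>_. 1" 2] a0 by simp
  moreover have "((\<lambda>n :: nat. B * n powr (- \<delta> / 2)) \<longlongrightarrow> 0) sequentially"
    using \<delta> by real_asymp
  then have "\<forall>\<^sub>F n :: nat in sequentially. B * n powr (- \<delta> / 2) < 1 / 16"
    by (rule order_tendstoD) simp
  ultimately have "\<forall>\<^sub>F n :: nat in sequentially. (2 :: nat) \<le> n \<and> 2 \<le> a\<^sub>0 * sqrt n \<and> B * n powr (- \<delta> / 2) \<le> 1 / 16"
    using eventually_ge_at_top[of "2 :: nat"] by eventually_elim auto
  then obtain n\<^sub>0 where n0: "\<And>n :: nat. n\<^sub>0 \<le> n \<Longrightarrow>
      (2 :: nat) \<le> n \<and> 2 \<le> a\<^sub>0 * sqrt n \<and> B * n powr (- \<delta> / 2) \<le> 1 / 16"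
    unfolding eventually_sequentially by blast
  show ?thesis
  proof (rule that[of a\<^sub>0 "28 * exp 3 * 41472 * B" "max 1 n\<^sub>0"])
    fix n :: nat and \<mu>
    assume n: "max 1 n\<^sub>0 \<le> n" and \<mu>: "real_distribution \<mu>" "AE x in \<mu>. \<bar>x\<bar> \<le> 1"
      and m: "\<bar>\<integral>x. x \<partial>\<mu>\<bar> \<le> B * real n powr (- 1 - \<delta> / 2)"
        "\<bar>(\<integral>x. x\<^sup>2 \<partial>\<mu>) - 1 / n\<bar> \<le> B * real n powr (- 1 - \<delta> / 2)"
        "(\<integral>x. \<bar>x\<bar> powr (2 + \<delta>) \<partial>\<mu>) \<le> B * real n powr (- 1 - \<delta> / 2)"
    define D where "D w = cchar \<mu> w ^ n - exp (- w\<^sup>2 / 2)" for w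
    have "D holomorphic_on UNIV"
      unfolding D_def by (intro holomorphic_intros cchar_holomorphic \<mu>) auto
    moreover have "char \<mu> s ^ n - char std_normal_distribution s = D (of_real s)" for s
      by (simp add: D_def cchar_of_real char_std_normal_distribution exp_of_real[symmetric])
    moreover have "cmod (D w) \<le> 28 * exp 3 * 41472 * B * real n powr (- \<delta> / 2) / (1 + (Re w)\<^sup>2)"
      if w: "\<bar>Im w\<bar> \<le> 1" "\<bar>Re w\<bar> \<le> a\<^sub>0 * sqrt n + 1" for w
    proof -
      have "cmod (cchar \<mu> w - (1 - of_real (1 / n) * w\<^sup>2 / 2))
        \<le> B * real n powr (- 1 - \<delta> / 2) * (cmod w + (cmod w)\<^sup>2 / 2 + 4 * cmod w powr (2 + \<delta>))"
        using \<delta> by (intro cchar_taylor \<mu> m w) auto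
      then have "cmod (cchar \<mu> w - (1 - w\<^sup>2 / (2 * of_nat n)))
        \<le> B * real n powr (- 1 - \<delta> / 2) * (cmod w + (cmod w)\<^sup>2 / 2 + 4 * cmod w powr (2 + \<delta>))"
        by (simp add: mult.commute)
      then show ?thesis
        unfolding D_def using n0[of n] n
        by (intro power_difference_estimate[OF \<delta> B a0 _ _ _ w]) auto
    qed
    ultimately show "\<exists>D. D holomorphic_on UNIV \<and>
        (\<forall>s. char \<mu> s ^ n - char std_normal_distribution s = D (of_real s)) \<and>
        (\<forall>w. \<bar>Im w\<bar> \<le> 1 \<longrightarrow> \<bar>Re w\<bar> \<le> a\<^sub>0 * sqrt n + 1 \<longrightarrow>
          cmod (D w) \<le> 28 * exp 3 * 41472 * B * real n powr (- \<delta> / 2) / (1 + (Re w)\<^sup>2))"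
      by blast
  qed (use a0 B in auto)
qed

section \<open>Maximal couplings\<close>

lemma measure_eqI_nn_integral:
  assumes "sets M = sets N"
    and "\<And>h. h \<in> borel_measurable N \<Longrightarrow> integral\<^sup>N M h = integral\<^sup>N N h"
  shows "M = N"
proof (rule measure_eqI)
  fix X assume "X \<in> sets M"
  then have X: "X \<in> sets M" "X \<in> sets N" using assms(1) by auto
  then have "emeasure M X = (\<integral>\<^sup>+ x. indicator X x \<partial>M)" by simp
  also have "\<dots> = (\<integral>\<^sup>+ x. indicator X x \<partial>N)" using X by (intro assms(2)) simp
  finally show "emeasure M X = emeasure N X" using X by simp
qed (fact assms(1))

text \<open>The randomisation: keep the value of the first coordinate with probability \<open>w\<close>, and replace
  it by an independent sample from \<open>\<rho>\<close> otherwise.\<close>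

lemma nn_integral_resample:
  assumes "prob_space M" "prob_space \<rho>"
    and [measurable]: "w \<in> borel_measurable M" and w: "\<And>m. w m \<le> (1 :: ennreal)"
    and [measurable]: "H \<in> borel_measurable (M \<Otimes>\<^sub>M (count_space (UNIV :: bool set) \<Otimes>\<^sub>M \<rho>))"
  shows "integral\<^sup>N (density (M \<Otimes>\<^sub>M (count_space (UNIV :: bool set) \<Otimes>\<^sub>M \<rho>))
      (\<lambda>(m, b, z). if b then w m else 1 - w m)) H
    = (\<integral>\<^sup>+ m. w m * (\<integral>\<^sup>+ z. H (m, True, z) \<partial>\<rho>) + (1 - w m) * (\<integral>\<^sup>+ z. H (m, False, z) \<partial>\<rho>) \<partial>M)"
proof -
  interpret M: prob_space M by fact
  interpret \<rho>: prob_space \<rho> by fact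
  interpret b: sigma_finite_measure "count_space (UNIV :: bool set)"
    by (rule sigma_finite_measure_count_space_finite) simp
  interpret b\<rho>: pair_sigma_finite "count_space (UNIV :: bool set)" \<rho> ..
  let ?W = "\<lambda>(m, b, z). if b then w m else 1 - w m"
  have [measurable]: "?W \<in> borel_measurable (M \<Otimes>\<^sub>M (count_space (UNIV :: bool set) \<Otimes>\<^sub>M \<rho>))"
    by measurable
  have "integral\<^sup>N (density (M \<Otimes>\<^sub>M (count_space UNIV \<Otimes>\<^sub>M \<rho>)) ?W) H
    = (\<integral>\<^sup>+ t. ?W t * H t \<partial>(M \<Otimes>\<^sub>M (count_space UNIV \<Otimes>\<^sub>M \<rho>)))"
    by (rule nn_integral_density) measurable
  also have "\<dots> = (\<integral>\<^sup>+ m. (\<integral>\<^sup>+ t. ?W (m, t) * H (m, t) \<partial>(count_space UNIV \<Otimes>\<^sub>M \<rho>)) \<partial>M)"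
    by (rule b\<rho>.P.nn_integral_fst[symmetric]) measurable
  also have "\<dots> = (\<integral>\<^sup>+ m. w m * (\<integral>\<^sup>+ z. H (m, True, z) \<partial>\<rho>) + (1 - w m) * (\<integral>\<^sup>+ z. H (m, False, z) \<partial>\<rho>) \<partial>M)"
  proof (rule nn_integral_cong)
    fix m assume m: "m \<in> space M"
    have "(\<integral>\<^sup>+ t. ?W (m, t) * H (m, t) \<partial>(count_space UNIV \<Otimes>\<^sub>M \<rho>))
      = (\<integral>\<^sup>+ b. (\<integral>\<^sup>+ z. ?W (m, b, z) * H (m, b, z) \<partial>\<rho>) \<partial>count_space UNIV)"
      using m by (intro \<rho>.nn_integral_fst[symmetric]) measurable
    also have "\<dots> = (\<integral>\<^sup>+ z. w m * H (m, True, z) \<partial>\<rho>) + (\<integral>\<^sup>+ z. (1 - w m) * H (m, False, z) \<partial>\<rho>)"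
      by (subst nn_integral_count_space_finite) (simp_all add: UNIV_bool add.commute)
    also have "\<dots> = w m * (\<integral>\<^sup>+ z. H (m, True, z) \<partial>\<rho>) + (1 - w m) * (\<integral>\<^sup>+ z. H (m, False, z) \<partial>\<rho>)"
      using m by (subst (1 2) nn_integral_cmult) measurable
    finally show "(\<integral>\<^sup>+ t. ?W (m, t) * H (m, t) \<partial>(count_space UNIV \<Otimes>\<^sub>M \<rho>))
      = w m * (\<integral>\<^sup>+ z. H (m, True, z) \<partial>\<rho>) + (1 - w m) * (\<integral>\<^sup>+ z. H (m, False, z) \<partial>\<rho>)" .
  qed
  finally show ?thesis .
qed

text \<open>Both densities have mass 1, so the positive parts of f - g and g - f have the same mass
  \<open>\<tau>\<close>; \<open>\<rho>\<close> is the positive part of g - f divided by it. The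
  identity is multiplied by \<open>\<tau>\<close> so that it also covers the case f = g almost
  everywhere.\<close>

lemma excess_density:
  fixes f g :: "real \<Rightarrow> real"
  assumes [measurable]: "f \<in> borel_measurable borel" "g \<in> borel_measurable borel"
    and nonneg: "\<And>x. 0 \<le> f x" "\<And>x. 0 \<le> g x"
    and f1: "(\<integral>\<^sup>+ x. f x \<partial>lborel) = 1" and g1: "(\<integral>\<^sup>+ x. g x \<partial>lborel) = 1"
  defines "\<tau> \<equiv> \<integral>\<^sup>+ x. ennreal (f x - g x) \<partial>lborel"
  obtains \<rho> where "prob_space \<rho>" "sets \<rho> = sets borel"
    "\<And>h. h \<in> borel_measurable borel \<Longrightarrow> \<tau> * integral\<^sup>N \<rho> h = (\<integral>\<^sup>+ x. ennreal (g x - f x) * h x \<partial>lborel)"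
proof -
  have pw: "ennreal (f x - g x) + ennreal (g x) = ennreal (g x - f x) + ennreal (f x)" for x
    using nonneg[of x] by (cases "f x \<le> g x") (simp_all add: ennreal_neg flip: ennreal_plus)
  have "\<tau> + 1 = (\<integral>\<^sup>+ x. ennreal (g x - f x) \<partial>lborel) + 1"
    unfolding \<tau>_def
    by (subst (1) g1[symmetric], subst f1[symmetric])
      (simp add: nn_integral_add[symmetric] pw)
  then have \<tau>: "\<tau> = (\<integral>\<^sup>+ x. ennreal (g x - f x) \<partial>lborel)"
    by (metis ennreal_add_diff_cancel_right ennreal_one_neq_top)
  have "\<tau> \<le> (\<integral>\<^sup>+ x. f x \<partial>lborel)"
    unfolding \<tau>_def using nonneg by (intro nn_integral_mono ennreal_leI) simp
  then have fin: "\<tau> \<noteq> \<infinity>" using f1 by (auto simp: top_unique)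
  show ?thesis
  proof (cases "\<tau> = 0")
    case True
    show ?thesis
    \<comment> \<open>With \<open>\<tau>\<close> = 0 there is nothing to normalise and both sides of
      the identity vanish, so any probability law serves.\<close>
    proof (rule that[of "density lborel g"])
      show "prob_space (density lborel g)"
        by (rule prob_spaceI) (simp add: emeasure_density g1)
      fix h :: "real \<Rightarrow> ennreal" assume "h \<in> borel_measurable borel"
      have "AE x in lborel. ennreal (g x - f x) = 0"
        using True unfolding \<tau> by (subst (asm) nn_integral_0_iff_AE) auto
      then have "AE x in lborel. ennreal (g x - f x) * h x = 0"
        by eventually_elim simp
      then have "(\<integral>\<^sup>+ x. ennreal (g x - f x) * h x \<partial>lborel) = (\<integral>\<^sup>+ x. 0 \<partial>(lborel :: real measure))"
        by (rule nn_integral_cong_AE)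
      then show "\<tau> * integral\<^sup>N (density lborel g) h = (\<integral>\<^sup>+ x. ennreal (g x - f x) * h x \<partial>lborel)"
        using True by simp
    qed simp
  next
    case False
    show ?thesis
    proof (rule that[of "density lborel (\<lambda>x. ennreal (g x - f x) / \<tau>)"])
      show "prob_space (density lborel (\<lambda>x. ennreal (g x - f x) / \<tau>))"
        using False fin
        by (intro prob_spaceI) (simp add: emeasure_density nn_integral_divide \<tau>[symmetric] ennreal_divide_self
              top.not_eq_extremum)
      fix h :: "real \<Rightarrow> ennreal" assume [measurable]: "h \<in> borel_measurable borel"
      have "integral\<^sup>N (density lborel (\<lambda>x. ennreal (g x - f x) / \<tau>)) h
        = (\<integral>\<^sup>+ x. ennreal (g x - f x) * h x / \<tau> \<partial>lborel)"
        by (subst nn_integral_density) (simp_all add: divide_ennreal_def mult_ac)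
      also have "\<dots> = (\<integral>\<^sup>+ x. ennreal (g x - f x) * h x \<partial>lborel) / \<tau>"
        by (rule nn_integral_divide) simp
      finally show "\<tau> * integral\<^sup>N (density lborel (\<lambda>x. ennreal (g x - f x) / \<tau>)) h
        = (\<integral>\<^sup>+ x. ennreal (g x - f x) * h x \<partial>lborel)"
        using False fin by (simp add: ennreal_times_divide mult.commute[of \<tau>] ennreal_mult_divide_eq)
    qed simp
  qed
qed

text \<open>Keep Y with probability min(f, g)/f and otherwise draw from the excess law of g over f:
  the kept part contributes min(f, g) to the second marginal, the redrawn part the positive part of
  g - f, and together they give g. The coupling is built over the space that carries A and Y, so A
  may have any law: a kept value costs c (A - Y), and a redrawn one is charged by the weak triangle
  inequality.\<close>

lemma maximal_coupling:
  fixes f g :: "real \<Rightarrow> real" and c :: "real \<Rightarrow> ennreal"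
  assumes "prob_space M" and [measurable]: "A \<in> borel_measurable M" "Y \<in> borel_measurable M"
    and Y: "distr M borel Y = density lborel f"
    and [measurable]: "f \<in> borel_measurable borel" "g \<in> borel_measurable borel"
    and nonneg: "\<And>x. 0 \<le> f x" "\<And>x. 0 \<le> g x"
    and g1: "(\<integral>\<^sup>+ x. g x \<partial>lborel) = 1"
    and [measurable]: "c \<in> borel_measurable borel"
    and c: "\<And>a b. c (a + b) \<le> 2 * (c a + c b)" "\<And>a. c (- a) = c a"
  shows "\<exists>Q\<in>couplings (distr M borel A) (density lborel g).
    (\<integral>\<^sup>+ z. c (fst z - snd z) \<partial>Q)
      \<le> 2 * (\<integral>\<^sup>+ m. c (A m - Y m) \<partial>M) + 4 * (\<integral>\<^sup>+ x. ennreal \<bar>f x - g x\<bar> * c x \<partial>lborel)"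
proof -
  interpret M: prob_space M by fact
  have Yint: "(\<integral>\<^sup>+ m. h (Y m) \<partial>M) = (\<integral>\<^sup>+ x. f x * h x \<partial>lborel)"
    if [measurable]: "h \<in> borel_measurable borel" for h :: "real \<Rightarrow> ennreal"
  proof -
    have "(\<integral>\<^sup>+ m. h (Y m) \<partial>M) = integral\<^sup>N (distr M borel Y) h"
      by (simp add: nn_integral_distr)
    then show ?thesis unfolding Y by (simp add: nn_integral_density)
  qed
  have f1: "(\<integral>\<^sup>+ x. f x \<partial>lborel) = 1"
    using Yint[of "\<lambda>_. 1"] by (simp add: M.emeasure_space_1)
  define \<tau> where "\<tau> = (\<integral>\<^sup>+ x. ennreal (f x - g x) \<partial>lborel)"
  obtain \<rho> where \<rho>: "prob_space \<rho>" and [measurable_cong]: "sets \<rho> = sets borel"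
    and \<rho>int: "\<And>h. h \<in> borel_measurable borel \<Longrightarrow> \<tau> * integral\<^sup>N \<rho> h = (\<integral>\<^sup>+ x. ennreal (g x - f x) * h x \<partial>lborel)"
    using excess_density[of f g] nonneg f1 g1 unfolding \<tau>_def by auto
  interpret \<rho>: prob_space \<rho> by fact
  \<comment> \<open>Where f vanishes the value 0 keeps the identity f w = min(f, g).\<close>
  define w where "w y = (if f y = 0 then 0 else ennreal (min (f y) (g y) / f y))" for y
  have [measurable]: "w \<in> borel_measurable borel" unfolding w_def by measurable
  have w1: "w y \<le> 1" for y
  proof -
    have "min (f y) (g y) / f y \<le> 1" using nonneg[of y] by (cases "f y = 0") auto
    then show ?thesis unfolding w_def by auto
  qed
  have fw: "ennreal (f y) * w y = ennreal (min (f y) (g y))" for y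
    using nonneg[of y] by (auto simp: w_def min_def ennreal_mult'[symmetric])
  have fw': "ennreal (f y) * (1 - w y) = ennreal (f y - g y)" for y
  proof (cases "f y = 0")
    case False
    then have "ennreal (f y) * (1 - w y) = ennreal (f y * (1 - min (f y) (g y) / f y))"
      using nonneg[of y] by (simp add: w_def ennreal_mult' ennreal_minus flip: ennreal_1)
    also have "f y * (1 - min (f y) (g y) / f y) = max (f y - g y) 0"
      using False by (simp add: field_simps min_def max_def)
    finally show ?thesis by (simp add: ennreal_max_0' max.commute)
  qed (use nonneg[of y] in \<open>simp add: ennreal_neg\<close>)
  have ww: "w y + (1 - w y) = 1" for y
    using w1 by (metis add_diff_inverse_ennreal)
  define N where "N = density (M \<Otimes>\<^sub>M (count_space (UNIV :: bool set) \<Otimes>\<^sub>M \<rho>))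
      (\<lambda>(m, b, z). if b then w (Y m) else 1 - w (Y m))"
  have N: "integral\<^sup>N N H = (\<integral>\<^sup>+ m. w (Y m) * (\<integral>\<^sup>+ z. H (m, True, z) \<partial>\<rho>)
      + (1 - w (Y m)) * (\<integral>\<^sup>+ z. H (m, False, z) \<partial>\<rho>) \<partial>M)"
    if "H \<in> borel_measurable (M \<Otimes>\<^sub>M (count_space (UNIV :: bool set) \<Otimes>\<^sub>M \<rho>))" for H
    unfolding N_def using that w1 by (intro nn_integral_resample) (auto intro: assms \<rho>)
  have [measurable_cong]: "sets N = sets (M \<Otimes>\<^sub>M (count_space (UNIV :: bool set) \<Otimes>\<^sub>M \<rho>))"
    by (simp add: N_def)
  have "emeasure N (space N) = (\<integral>\<^sup>+ t. 1 \<partial>N)" by simp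
  also have "\<dots> = 1"
    by (subst N) (simp_all add: ww \<rho>.emeasure_space_1 M.emeasure_space_1)
  finally interpret N: prob_space N by (rule prob_spaceI)
  define Z where "Z = (\<lambda>(m, b, z). (A m, if b then Y m else z :: real))"
  have [measurable]: "Z \<in> N \<rightarrow>\<^sub>M borel"
    unfolding Z_def borel_prod[symmetric] by measurable
  define Q where "Q = distr N borel Z"
  have [measurable]: "(fst :: real \<times> real \<Rightarrow> real) \<in> borel_measurable borel"
    "(snd :: real \<times> real \<Rightarrow> real) \<in> borel_measurable borel"
    by (simp_all flip: borel_prod)
  have Q: "integral\<^sup>N Q h = (\<integral>\<^sup>+ m. w (Y m) * h (A m, Y m) + (1 - w (Y m)) * (\<integral>\<^sup>+ z. h (A m, z) \<partial>\<rho>) \<partial>M)"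
    if h: "h \<in> borel_measurable borel" for h
  proof -
    have [measurable]: "h \<in> borel_measurable (borel \<Otimes>\<^sub>M borel)" using h by (simp add: borel_prod)
    have "integral\<^sup>N Q h = (\<integral>\<^sup>+ t. h (Z t) \<partial>N)"
      unfolding Q_def using h by (simp add: nn_integral_distr)
    also have "\<dots> = (\<integral>\<^sup>+ m. w (Y m) * h (A m, Y m) + (1 - w (Y m)) * (\<integral>\<^sup>+ z. h (A m, z) \<partial>\<rho>) \<partial>M)"
      by (subst N) (simp_all add: Z_def \<rho>.emeasure_space_1)
    finally show ?thesis .
  qed
  have "Q \<in> couplings (distr M borel A) (density lborel g)"
    unfolding couplings_def
  proof (intro CollectI conjI)
    show "prob_space Q" unfolding Q_def by (rule N.prob_space_distr) simp
    show "distr Q borel fst = distr M borel A"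
    proof (rule measure_eqI_nn_integral)
      fix h :: "real \<Rightarrow> ennreal" assume "h \<in> borel_measurable (distr M borel A)"
      then have [measurable]: "h \<in> borel_measurable borel" by simp
      have "integral\<^sup>N (distr Q borel fst) h = (\<integral>\<^sup>+ z. h (fst z) \<partial>Q)"
        by (subst nn_integral_distr) (simp_all add: Q_def)
      also have "\<dots> = (\<integral>\<^sup>+ m. w (Y m) * h (A m) + (1 - w (Y m)) * h (A m) \<partial>M)"
        by (subst Q) (simp_all add: \<rho>.emeasure_space_1 borel_measurable_continuous_onI)
      also have "\<dots> = integral\<^sup>N (distr M borel A) h"
        by (simp add: distrib_right[symmetric] ww nn_integral_distr)
      finally show "integral\<^sup>N (distr Q borel fst) h = integral\<^sup>N (distr M borel A) h" .
    qed simp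
    show "distr Q borel snd = density lborel g"
    proof (rule measure_eqI_nn_integral)
      fix h :: "real \<Rightarrow> ennreal" assume "h \<in> borel_measurable (density lborel g)"
      then have [measurable]: "h \<in> borel_measurable borel" by simp
      have "integral\<^sup>N (distr Q borel snd) h = (\<integral>\<^sup>+ z. h (snd z) \<partial>Q)"
        by (subst nn_integral_distr) (simp_all add: Q_def)
      also have "\<dots> = (\<integral>\<^sup>+ m. w (Y m) * h (Y m) + (1 - w (Y m)) * integral\<^sup>N \<rho> h \<partial>M)"
        by (subst Q) (simp_all add: borel_measurable_continuous_onI)
      also have "\<dots> = (\<integral>\<^sup>+ x. f x * (w x * h x + (1 - w x) * integral\<^sup>N \<rho> h) \<partial>lborel)"
        by (rule Yint) measurable
      also have "\<dots> = (\<integral>\<^sup>+ x. ennreal (min (f x) (g x)) * h x + ennreal (f x - g x) * integral\<^sup>N \<rho> h \<partial>lborel)"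
        by (simp add: distrib_left mult.assoc[symmetric] fw fw')
      also have "\<dots> = (\<integral>\<^sup>+ x. ennreal (min (f x) (g x)) * h x \<partial>lborel) + \<tau> * integral\<^sup>N \<rho> h"
        by (subst nn_integral_add) (simp_all add: nn_integral_multc \<tau>_def)
      also have "\<dots> = (\<integral>\<^sup>+ x. ennreal (min (f x) (g x)) * h x + ennreal (g x - f x) * h x \<partial>lborel)"
        by (subst nn_integral_add) (simp_all add: \<rho>int)
      also have "\<dots> = (\<integral>\<^sup>+ x. ennreal (g x) * h x \<partial>lborel)"
      proof (rule nn_integral_cong)
        fix x
        have "ennreal (min (f x) (g x)) + ennreal (g x - f x) = ennreal (g x)"
          using nonneg[of x] by (cases "f x \<le> g x") (simp_all add: ennreal_neg flip: ennreal_plus)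
        then show "ennreal (min (f x) (g x)) * h x + ennreal (g x - f x) * h x = ennreal (g x) * h x"
          by (simp add: distrib_right[symmetric])
      qed
      also have "\<dots> = integral\<^sup>N (density lborel g) h" by (simp add: nn_integral_density)
      finally show "integral\<^sup>N (distr Q borel snd) h = integral\<^sup>N (density lborel g) h" .
    qed simp
  qed (simp add: Q_def)
  moreover have "(\<integral>\<^sup>+ z. c (fst z - snd z) \<partial>Q)
      \<le> 2 * (\<integral>\<^sup>+ m. c (A m - Y m) \<partial>M) + 4 * (\<integral>\<^sup>+ x. ennreal \<bar>f x - g x\<bar> * c x \<partial>lborel)"
  proof -
    \<comment> \<open>The weak triangle inequality twice, from A to Y and from Y through 0 to z, so
      the last two terms carry the factor 2 * 2.\<close>
    have Az: "c (A m - z) \<le> 2 * c (A m - Y m) + 4 * (c (Y m) + c z)" for m z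
    proof -
      have "c (Y m - z) \<le> 2 * (c (Y m) + c z)"
        using c(1)[of "Y m" "- z"] by (simp add: c(2))
      then have "2 * (c (A m - Y m) + c (Y m - z)) \<le> 2 * (c (A m - Y m) + 2 * (c (Y m) + c z))"
        by (intro mult_left_mono add_left_mono) auto
      then have "c (A m - z) \<le> 2 * (c (A m - Y m) + 2 * (c (Y m) + c z))"
        using c(1)[of "A m - Y m" "Y m - z"] by (auto intro: order_trans)
      then show ?thesis by (simp add: distrib_left mult.assoc[symmetric])
    qed
    have "(\<lambda>z :: real \<times> real. c (fst z - snd z)) \<in> borel_measurable (borel \<Otimes>\<^sub>M borel)"
      by measurable
    then have "(\<lambda>z :: real \<times> real. c (fst z - snd z)) \<in> borel_measurable borel"
      by (simp add: borel_prod)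
    then have "(\<integral>\<^sup>+ z. c (fst z - snd z) \<partial>Q)
      = (\<integral>\<^sup>+ m. w (Y m) * c (A m - Y m) + (1 - w (Y m)) * (\<integral>\<^sup>+ z. c (A m - z) \<partial>\<rho>) \<partial>M)"
      by (subst Q) simp_all
    also have "\<dots> \<le> (\<integral>\<^sup>+ m. w (Y m) * (2 * c (A m - Y m))
        + (1 - w (Y m)) * (2 * c (A m - Y m) + 4 * (c (Y m) + integral\<^sup>N \<rho> c)) \<partial>M)"
    proof (intro nn_integral_mono add_mono mult_left_mono)
      fix m
      show "c (A m - Y m) \<le> 2 * c (A m - Y m)"
        using mult_right_mono[of 1 2 "c (A m - Y m)"] by simp
      have "(\<integral>\<^sup>+ z. c (A m - z) \<partial>\<rho>) \<le> (\<integral>\<^sup>+ z. 2 * c (A m - Y m) + 4 * (c (Y m) + c z) \<partial>\<rho>)"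
        by (intro nn_integral_mono Az)
      also have "\<dots> = 2 * c (A m - Y m) + 4 * (c (Y m) + integral\<^sup>N \<rho> c)"
        by (simp add: nn_integral_add nn_integral_cmult \<rho>.emeasure_space_1)
      finally show "(\<integral>\<^sup>+ z. c (A m - z) \<partial>\<rho>) \<le> 2 * c (A m - Y m) + 4 * (c (Y m) + integral\<^sup>N \<rho> c)" .
    qed auto
    also have "\<dots> = (\<integral>\<^sup>+ m. 2 * c (A m - Y m) + 4 * ((1 - w (Y m)) * (c (Y m) + integral\<^sup>N \<rho> c)) \<partial>M)"
    proof (rule nn_integral_cong)
      fix m
      have "w (Y m) * (2 * c (A m - Y m)) + (1 - w (Y m)) * (2 * c (A m - Y m) + 4 * (c (Y m) + integral\<^sup>N \<rho> c))
        = (w (Y m) + (1 - w (Y m))) * (2 * c (A m - Y m)) + 4 * ((1 - w (Y m)) * (c (Y m) + integral\<^sup>N \<rho> c))"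
        by (simp only: distrib_left distrib_right mult_ac add_ac)
      then show "w (Y m) * (2 * c (A m - Y m)) + (1 - w (Y m)) * (2 * c (A m - Y m) + 4 * (c (Y m) + integral\<^sup>N \<rho> c))
        = 2 * c (A m - Y m) + 4 * ((1 - w (Y m)) * (c (Y m) + integral\<^sup>N \<rho> c))"
        by (simp only: ww mult_1)
    qed
    also have "\<dots> = 2 * (\<integral>\<^sup>+ m. c (A m - Y m) \<partial>M)
        + 4 * (\<integral>\<^sup>+ m. (1 - w (Y m)) * (c (Y m) + integral\<^sup>N \<rho> c) \<partial>M)"
      by (simp add: nn_integral_add nn_integral_cmult)
    \<comment> \<open>A redraw costs c at the old value, weighted by the positive part of f - g, and
      c at the new value, weighted by the positive part of g - f; the two weights add up to |f -
      g|.\<close>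
    also have "(\<integral>\<^sup>+ m. (1 - w (Y m)) * (c (Y m) + integral\<^sup>N \<rho> c) \<partial>M)
        = (\<integral>\<^sup>+ x. f x * ((1 - w x) * (c x + integral\<^sup>N \<rho> c)) \<partial>lborel)"
      by (rule Yint) measurable
    also have "\<dots> = (\<integral>\<^sup>+ x. ennreal (f x - g x) * c x + ennreal (f x - g x) * integral\<^sup>N \<rho> c \<partial>lborel)"
      by (simp add: mult.assoc[symmetric] fw' distrib_left)
    also have "\<dots> = (\<integral>\<^sup>+ x. ennreal (f x - g x) * c x \<partial>lborel) + \<tau> * integral\<^sup>N \<rho> c"
      by (subst nn_integral_add) (simp_all add: nn_integral_multc \<tau>_def)
    also have "\<dots> = (\<integral>\<^sup>+ x. ennreal (f x - g x) * c x + ennreal (g x - f x) * c x \<partial>lborel)"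
      by (subst nn_integral_add) (simp_all add: \<rho>int)
    also have "\<dots> = (\<integral>\<^sup>+ x. ennreal \<bar>f x - g x\<bar> * c x \<partial>lborel)"
    proof (rule nn_integral_cong)
      fix x
      have "ennreal (f x - g x) + ennreal (g x - f x) = ennreal \<bar>f x - g x\<bar>"
        by (cases "f x \<le> g x") (simp_all add: ennreal_neg)
      then show "ennreal (f x - g x) * c x + ennreal (g x - f x) * c x = ennreal \<bar>f x - g x\<bar> * c x"
        by (simp add: distrib_right[symmetric])
    qed
    finally show ?thesis .
  qed
  ultimately show ?thesis by blast
qed

section \<open>The cost function and the central limit theorem\<close>

definition cost :: "real \<Rightarrow> real \<Rightarrow> real" where
  "cost \<delta> d = \<bar>d\<bar> powr \<delta> + d\<^sup>2"

lemma cost_nonneg [simp]: "0 \<le> cost \<delta> d" by (simp add: cost_def)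

lemma cost_minus [simp]: "cost \<delta> (- d) = cost \<delta> d" by (simp add: cost_def)

lemma measurable_cost [measurable]: "cost \<delta> \<in> borel_measurable borel"
  unfolding cost_def by measurable

text \<open>A share x/(a + b) of the total lies in [0, 1], so raising it to a power \<delta> \<le> 1
  does not decrease it; the shares of a and b sum to 1.\<close>

lemma powr_add_le:
  fixes a b \<delta> :: real
  assumes "0 < \<delta>" "\<delta> \<le> 1" "0 \<le> a" "0 \<le> b"
  shows "(a + b) powr \<delta> \<le> a powr \<delta> + b powr \<delta>"
proof (cases "a + b = 0")
  case False
  then have s: "0 < a + b" using assms by simp
  have *: "x / (a + b) * (a + b) powr \<delta> \<le> x powr \<delta>" if "0 \<le> x" "x \<le> a + b" for x
  proof (cases "x = 0")
    case False
    have "x / (a + b) = (x / (a + b)) powr 1" using that s by simp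
    also have "\<dots> \<le> (x / (a + b)) powr \<delta>" using that s assms False by (intro powr_mono') auto
    also have "\<dots> = x powr \<delta> / (a + b) powr \<delta>" using that s by (intro powr_divide)
    finally show ?thesis using s by (simp add: pos_le_divide_eq)
  qed simp
  have "(a + b) powr \<delta> = a / (a + b) * (a + b) powr \<delta> + b / (a + b) * (a + b) powr \<delta>"
    using s by (simp add: add_divide_distrib[symmetric] distrib_right[symmetric])
  also have "\<dots> \<le> a powr \<delta> + b powr \<delta>"
    using assms by (intro add_mono *) auto
  finally show ?thesis .
qed (use assms in auto)

lemma abs_sum_powr_le:
  fixes f :: "'a \<Rightarrow> real"
  assumes "0 < \<delta>" "\<delta> \<le> 1" "finite I"
  shows "\<bar>\<Sum>i\<in>I. f i\<bar> powr \<delta> \<le> (\<Sum>i\<in>I. \<bar>f i\<bar> powr \<delta>)"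
  using assms(3)
proof (induction I rule: finite_induct)
  case (insert i I)
  have "\<bar>\<Sum>i\<in>insert i I. f i\<bar> powr \<delta> \<le> (\<bar>f i\<bar> + \<bar>\<Sum>i\<in>I. f i\<bar>) powr \<delta>"
    using insert assms by (intro powr_mono2) auto
  also have "\<dots> \<le> \<bar>f i\<bar> powr \<delta> + \<bar>\<Sum>i\<in>I. f i\<bar> powr \<delta>"
    using assms by (intro powr_add_le) auto
  finally show ?case using insert by simp
qed simp

lemma cost_add_le:
  assumes "0 < \<delta>" "\<delta> \<le> 1"
  shows "cost \<delta> (a + b) \<le> 2 * (cost \<delta> a + cost \<delta> b)"
proof -
  have "\<bar>a + b\<bar> powr \<delta> \<le> (\<bar>a\<bar> + \<bar>b\<bar>) powr \<delta>"
    using assms by (intro powr_mono2) auto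
  also have "\<dots> \<le> \<bar>a\<bar> powr \<delta> + \<bar>b\<bar> powr \<delta>"
    using assms by (intro powr_add_le) auto
  also have "\<dots> \<le> 2 * (\<bar>a\<bar> powr \<delta> + \<bar>b\<bar> powr \<delta>)" by simp
  finally have 1: "\<bar>a + b\<bar> powr \<delta> \<le> 2 * (\<bar>a\<bar> powr \<delta> + \<bar>b\<bar> powr \<delta>)" .
  have 2: "(a + b)\<^sup>2 \<le> 2 * (a\<^sup>2 + b\<^sup>2)"
    using zero_le_power2[of "a - b"] by (simp add: power2_eq_square algebra_simps)
  from 1 2 show ?thesis unfolding cost_def by (simp add: algebra_simps)
qed

lemma ennreal_cost_add_le:
  assumes "0 < \<delta>" "\<delta> \<le> 1"
  shows "ennreal (cost \<delta> (a + b)) \<le> 2 * (ennreal (cost \<delta> a) + ennreal (cost \<delta> b))"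
proof -
  have "ennreal (cost \<delta> (a + b)) \<le> ennreal (2 * (cost \<delta> a + cost \<delta> b))"
    by (rule ennreal_leI[OF cost_add_le[OF assms]])
  then show ?thesis by (simp add: ennreal_mult)
qed

lemma cost_le: 
  assumes "0 < \<delta>" "\<delta> \<le> 1"
  shows "cost \<delta> d \<le> 2 * (1 + d\<^sup>2)"
proof -
  have "\<bar>d\<bar> powr \<delta> \<le> 1 + d\<^sup>2"
  proof (cases "\<bar>d\<bar> \<le> 1")
    case True
    then have "\<bar>d\<bar> powr \<delta> \<le> 1" using assms by (intro powr_le1) auto
    then show ?thesis by (simp add: add_increasing2)
  next
    case False
    then have "\<bar>d\<bar> powr \<delta> \<le> \<bar>d\<bar> powr 2" using assms by (intro powr_mono) auto
    also have "\<dots> = d\<^sup>2" using False by (simp add: powr_numeral)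
    finally show ?thesis by simp
  qed
  then show ?thesis unfolding cost_def by simp
qed

text \<open>The \<delta> part scales by T^(-\<delta>) exactly and the square by the smaller T^(-2).
  With T = sqrt n this is how a quantity that stays bounded before scaling yields the rate
  n^(-\<delta>/2).\<close>

lemma cost_divide_le:
  assumes "0 < \<delta>" "\<delta> \<le> 1" "1 \<le> T"
  shows "cost \<delta> (u / T) \<le> T powr (- \<delta>) * cost \<delta> u"
proof -
  have "(\<bar>u\<bar> / T) powr \<delta> = T powr (- \<delta>) * \<bar>u\<bar> powr \<delta>"
    using assms by (simp add: powr_divide powr_minus_divide)
  moreover have "(u / T)\<^sup>2 \<le> T powr (- \<delta>) * u\<^sup>2"
  proof -
    have "1 / T\<^sup>2 = T powr (- 2)" using assms powr_minus_divide[of T 2] by (simp add: powr_numeral)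
    also have "\<dots> \<le> T powr (- \<delta>)" using assms by (intro powr_mono) auto
    finally have "1 / T\<^sup>2 * u\<^sup>2 \<le> T powr (- \<delta>) * u\<^sup>2" by (intro mult_right_mono) auto
    then show ?thesis by (simp add: power_divide)
  qed
  ultimately show ?thesis using assms by (simp add: cost_def distrib_left)
qed

section \<open>The normalised kernel and the smoothed normal density\<close>

definition kern_mass :: "real \<Rightarrow> real" where
  "kern_mass b = (\<integral>y. kern b y \<partial>lborel)"

text \<open>The fifth moment matches the factor |y| (1 + y^4) of
  \<open>std_normal_lipschitz\<close>; decay of order 8 leaves room for the integrable 1/(1 +
  y^2).\<close>

lemma integrable_kern_moment:
  assumes "0 \<le> b"
  shows "integrable lborel (\<lambda>y. (1 + \<bar>y\<bar> ^ 5) * kern b y)"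
proof -
  obtain C where C: "0 < C" "\<And>y. (1 + y ^ 8) * kern b y \<le> C"
    using kern_decay[OF assms] by blast
  show ?thesis
  proof (rule Bochner_Integration.integrable_bound)
    show "integrable lborel (\<lambda>y. 4 * C * (1 / (1 + y\<^sup>2)))"
      by (intro integrable_mult_right integrable_inverse_square)
    show "AE y in lborel. norm ((1 + \<bar>y\<bar> ^ 5) * kern b y) \<le> norm (4 * C * (1 / (1 + y\<^sup>2)))"
    proof (rule AE_I2)
      fix y :: real
      have p: "\<bar>y\<bar> ^ k \<le> 1 + y ^ 8" if "k \<le> 8" for k
      proof (cases "\<bar>y\<bar> \<le> 1")
        case True
        then have "\<bar>y\<bar> ^ k \<le> 1" by (intro power_le_one) auto
        moreover have "0 \<le> y ^ 8" by simp
        ultimately show ?thesis by linarith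
      next
        case False
        then have "\<bar>y\<bar> ^ k \<le> \<bar>y\<bar> ^ 8" using that by (intro power_increasing) auto
        then show ?thesis by simp
      qed
      have "(1 + y\<^sup>2) * (1 + \<bar>y\<bar> ^ 5) = 1 + \<bar>y\<bar> ^ 2 + \<bar>y\<bar> ^ 5 + \<bar>y\<bar> ^ 7"
      proof -
        have "(1 + t ^ 2) * (1 + t ^ 5) = 1 + t ^ 2 + t ^ 5 + t ^ 7" for t :: real
          by (simp add: distrib_left distrib_right flip: power_add)
        from this[of "\<bar>y\<bar>"] show ?thesis by simp
      qed
      also have "\<dots> \<le> (1 + y ^ 8) + (1 + y ^ 8) + (1 + y ^ 8) + (1 + y ^ 8)"
        by (intro add_mono p) auto
      also have "\<dots> = 4 * (1 + y ^ 8)" by simp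
      finally have "(1 + y\<^sup>2) * (1 + \<bar>y\<bar> ^ 5) * kern b y \<le> 4 * (1 + y ^ 8) * kern b y"
        by (intro mult_right_mono) auto
      also have "\<dots> \<le> 4 * C" unfolding mult.assoc by (intro mult_left_mono C(2)) auto
      finally have "(1 + y\<^sup>2) * ((1 + \<bar>y\<bar> ^ 5) * kern b y) \<le> 4 * C" by (simp only: mult.assoc)
      moreover have "0 < 1 + y\<^sup>2" by (simp add: add_pos_nonneg)
      ultimately have "(1 + \<bar>y\<bar> ^ 5) * kern b y \<le> 4 * C / (1 + y\<^sup>2)"
        by (simp only: pos_le_divide_eq mult.commute)
      then show "norm ((1 + \<bar>y\<bar> ^ 5) * kern b y) \<le> norm (4 * C * (1 / (1 + y\<^sup>2)))"
        using C(1) by simp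
    qed
  qed measurable
qed

lemma integrable_kern_le:
  assumes "0 \<le> b" "f \<in> borel_measurable borel" "\<And>y. \<bar>f y\<bar> \<le> K * (1 + \<bar>y\<bar> ^ 5)"
  shows "integrable lborel (\<lambda>y. f y * kern b y)"
proof (rule Bochner_Integration.integrable_bound)
  show "integrable lborel (\<lambda>y. K * ((1 + \<bar>y\<bar> ^ 5) * kern b y))"
    by (intro integrable_mult_right integrable_kern_moment assms)
  have K: "0 \<le> K" using assms(3)[of 0] by simp
  show "AE y in lborel. norm (f y * kern b y) \<le> norm (K * ((1 + \<bar>y\<bar> ^ 5) * kern b y))"
  proof (rule AE_I2)
    fix y
    have "\<bar>f y\<bar> * kern b y \<le> K * (1 + \<bar>y\<bar> ^ 5) * kern b y"
      using assms(3) by (intro mult_right_mono) auto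
    then show "norm (f y * kern b y) \<le> norm (K * ((1 + \<bar>y\<bar> ^ 5) * kern b y))"
      using K by (simp add: abs_mult mult.assoc)
  qed
qed (use assms(2) in simp)

text \<open>A continuous function that vanishes almost everywhere has no nonempty open set of
  nonzero values, but \<open>kern\<close> is nonzero at 0: there the transform is the integral of
  (b^2 - u^2)^4 over [-b, b], that is 256/315 b^9.\<close>

lemma kern_mass_pos:
  assumes "0 < b"
  shows "0 < kern_mass b"
proof -
  have i: "integrable lborel (kern b)"
    using integrable_kern_le[of b "\<lambda>_. 1" 1] assms by simp
  have "kern_mass b \<noteq> 0"
  proof
    assume "kern_mass b = 0"
    then have ae: "AE y in lborel. kern b y = 0"
      unfolding kern_mass_def using i by (subst (asm) integral_nonneg_eq_0_iff_AE) auto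
    moreover have "open {y. kern b y \<noteq> 0}"
      by (intro open_Collect_neq continuous_kern continuous_intros)
    moreover have "kern b 0 \<noteq> 0"
    proof
      assume "kern b 0 = 0"
      then have "wave b (bump b) 0 = 0" by (simp add: kern_def)
      moreover have "wave b (bump b) 0 = of_real (\<integral>u. (b\<^sup>2 - u\<^sup>2) ^ 4 \<partial>clip b)"
        unfolding wave_def integral_complex_of_real[symmetric]
        by (intro Bochner_Integration.integral_cong refl) (simp add: bump_def)
      ultimately have z: "(\<integral>u. (b\<^sup>2 - u\<^sup>2) ^ 4 \<partial>clip b) = 0" by simp
      have c: "continuous_on UNIV (\<lambda>u. (b\<^sup>2 - u\<^sup>2) ^ 4)" by (intro continuous_intros)
      define F :: "real \<Rightarrow> real" where "F u = b^8 * u - 4/3 * b^6 * u^3 + 6/5 * b^4 * u^5 - 4/7 * b\<^sup>2 * u^7 + u^9 / 9" for u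
      have "(F has_real_derivative (b\<^sup>2 - u\<^sup>2) ^ 4) (at u)" for u
        unfolding F_def by (auto intro!: derivative_eq_intros simp: eval_nat_numeral algebra_simps)
      then have "(\<integral>u. (b\<^sup>2 - u\<^sup>2) ^ 4 \<partial>clip b) = F b - F (- b)"
        using assms
        by (intro integral_clip_FTC c) (auto simp: has_real_derivative_iff_has_vector_derivative)
      also have "\<dots> = 256 / 315 * b ^ 9"
        by (simp add: F_def eval_nat_numeral algebra_simps)
      finally show False using z assms by simp
    qed
    moreover have "{y. kern b y \<noteq> 0} \<in> null_sets lborel"
    proof (rule AE_iff_null_sets[THEN iffD2])
      show "{y. kern b y \<noteq> 0} \<in> sets lborel" by measurable
      show "AE y in lborel. y \<notin> {y. kern b y \<noteq> 0}" using ae by simp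
    qed
    then have "negligible {y. kern b y \<noteq> 0}"
      by (simp add: negligible_iff_null_sets null_sets_completionI)
    ultimately show False
      using open_not_negligible by blast
  qed
  moreover have "0 \<le> kern_mass b" unfolding kern_mass_def by (intro integral_nonneg_AE) auto
  ultimately show ?thesis by simp
qed

text \<open>The density at x of S - U/T, where S has law \<open>\<mu>\<close> and U is independent
  of it with density \<open>kern b\<close> divided by \<open>kern_mass b\<close>.\<close>

definition smooth :: "real \<Rightarrow> real \<Rightarrow> real measure \<Rightarrow> real \<Rightarrow> real" where
  "smooth b T \<mu> x = T / kern_mass b * (\<integral>y. kern b (T * (y - x)) \<partial>\<mu>)"

text \<open>By the mean value theorem the difference is y times the derivative at some \<xi> within
  |y| of x. The derivative stays bounded after multiplication by 1 + \<xi>^4, and 1 + x^4 \<le> 8 (1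
  + \<xi>^4) (1 + y^4) moves the weight to x at the price of 1 + y^4.\<close>

lemma std_normal_lipschitz:
  obtains C where "0 < C"
    "\<And>x y. \<bar>std_normal_density (x + y) - std_normal_density x\<bar> \<le> C * (\<bar>y\<bar> * (1 + y ^ 4)) / (1 + x ^ 4)"
proof -
  have d: "\<bar>\<xi> * std_normal_density \<xi>\<bar> * (1 + \<xi> ^ 4) \<le> 41472" for \<xi>
  proof -
    have "\<bar>\<xi>\<bar> \<le> 1 + \<xi>\<^sup>2"
      using zero_le_power2[of "\<bar>\<xi>\<bar> - 1"] by (simp add: power2_eq_square algebra_simps)
    moreover have "1 + \<xi> ^ 4 \<le> (1 + \<xi>\<^sup>2)\<^sup>2"
      by (simp add: power2_eq_square algebra_simps) (simp add: eval_nat_numeral)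
    ultimately have "\<bar>\<xi>\<bar> * (1 + \<xi> ^ 4) \<le> (1 + \<xi>\<^sup>2) * (1 + \<xi>\<^sup>2)\<^sup>2"
      by (intro mult_mono) auto
    also have "\<dots> = (1 + \<xi>\<^sup>2) ^ 3" by (simp add: eval_nat_numeral)
    finally have 1: "\<bar>\<xi>\<bar> * (1 + \<xi> ^ 4) \<le> (1 + \<xi>\<^sup>2) ^ 3" .
    have 2: "std_normal_density \<xi> \<le> exp (- \<xi>\<^sup>2 / 8)"
    proof -
      have "1 / sqrt (2 * pi) \<le> 1" using pi_gt3 by simp
      then have "std_normal_density \<xi> \<le> 1 * exp (- \<xi>\<^sup>2 / 2)"
        unfolding std_normal_density_def by (intro mult_right_mono) auto
      also have "\<dots> \<le> exp (- \<xi>\<^sup>2 / 8)" by simp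
      finally show ?thesis .
    qed
    have "(\<bar>\<xi>\<bar> * (1 + \<xi> ^ 4)) * std_normal_density \<xi> \<le> (1 + \<xi>\<^sup>2) ^ 3 * exp (- \<xi>\<^sup>2 / 8)"
      using 1 2 by (intro mult_mono) auto
    also have "\<dots> \<le> 41472" by (rule gaussian_poly_bound)
    finally show ?thesis by (simp add: abs_mult mult_ac)
  qed
  have "\<bar>std_normal_density (x + y) - std_normal_density x\<bar> \<le> 8 * 41472 * (\<bar>y\<bar> * (1 + y ^ 4)) / (1 + x ^ 4)" for x y
  proof -
    have der: "(std_normal_density has_real_derivative - \<xi> * std_normal_density \<xi>) (at \<xi>)" for \<xi>
    proof -
      have "((\<lambda>x. k * exp (- x\<^sup>2 / 2)) has_real_derivative - \<xi> * (k * exp (- \<xi>\<^sup>2 / 2))) (at \<xi>)" for k :: real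
        by (auto intro!: derivative_eq_intros)
      then show ?thesis unfolding std_normal_density_def .
    qed
    have "\<exists>\<xi>. \<bar>x - \<xi>\<bar> \<le> \<bar>y\<bar> \<and>
      std_normal_density (x + y) - std_normal_density x = y * (- \<xi> * std_normal_density \<xi>)"
    proof (cases y "0 :: real" rule: linorder_cases)
      case less
      from MVT2[of "x + y" x std_normal_density, OF _ der] less
      obtain \<xi> where "x + y < \<xi>" "\<xi> < x"
        "std_normal_density x - std_normal_density (x + y) = (x - (x + y)) * (- \<xi> * std_normal_density \<xi>)"
        by auto
      then show ?thesis using less by (intro exI[of _ \<xi>]) (auto simp: algebra_simps)
    next
      case greater
      from MVT2[of x "x + y" std_normal_density, OF _ der] greater
      obtain \<xi> where "x < \<xi>" "\<xi> < x + y"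
        "std_normal_density (x + y) - std_normal_density x = (x + y - x) * (- \<xi> * std_normal_density \<xi>)"
        by auto
      then show ?thesis using greater by (intro exI[of _ \<xi>]) auto
    qed auto
    then obtain \<xi> where \<xi>: "\<bar>x - \<xi>\<bar> \<le> \<bar>y\<bar>"
      "std_normal_density (x + y) - std_normal_density x = y * (- \<xi> * std_normal_density \<xi>)"
      by blast
    have x4: "x ^ 4 \<le> 8 * (\<xi> ^ 4 + y ^ 4)"
    proof -
      have sq: "(a + c)\<^sup>2 \<le> 2 * (a\<^sup>2 + c\<^sup>2)" for a c :: real
        using zero_le_power2[of "a - c"] by (simp add: power2_eq_square algebra_simps)
      have "\<bar>x\<bar> \<le> \<bar>\<xi>\<bar> + \<bar>y\<bar>" using \<xi>(1) by linarith
      then have "\<bar>x\<bar>\<^sup>2 \<le> (\<bar>\<xi>\<bar> + \<bar>y\<bar>)\<^sup>2" by (intro power_mono) auto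
      also have "\<dots> \<le> 2 * (\<xi>\<^sup>2 + y\<^sup>2)" using sq[of "\<bar>\<xi>\<bar>" "\<bar>y\<bar>"] by simp
      finally have "(x\<^sup>2)\<^sup>2 \<le> (2 * (\<xi>\<^sup>2 + y\<^sup>2))\<^sup>2" by (intro power_mono) auto
      also have "\<dots> \<le> 4 * (2 * ((\<xi>\<^sup>2)\<^sup>2 + (y\<^sup>2)\<^sup>2))"
        unfolding power_mult_distrib using sq[of "\<xi>\<^sup>2" "y\<^sup>2"] by simp
      finally show ?thesis by (simp flip: power_mult)
    qed
    have "1 + x ^ 4 \<le> 8 * ((1 + \<xi> ^ 4) * (1 + y ^ 4))"
    proof -
      have "1 + c \<le> 8 * ((1 + p) * (1 + q))" if "c \<le> 8 * (p + q)" "0 \<le> p * q" for c p q :: real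
        using that by (simp add: algebra_simps)
      then show ?thesis using x4 by simp
    qed
    then have "\<bar>\<xi> * std_normal_density \<xi>\<bar> * (1 + x ^ 4)
        \<le> \<bar>\<xi> * std_normal_density \<xi>\<bar> * (8 * ((1 + \<xi> ^ 4) * (1 + y ^ 4)))"
      by (intro mult_left_mono) auto
    also have "\<dots> = 8 * (\<bar>\<xi> * std_normal_density \<xi>\<bar> * (1 + \<xi> ^ 4)) * (1 + y ^ 4)"
      by (simp only: mult_ac)
    also have "\<dots> \<le> 8 * 41472 * (1 + y ^ 4)"
      by (intro mult_right_mono mult_left_mono d) auto
    finally have "\<bar>y\<bar> * (\<bar>\<xi> * std_normal_density \<xi>\<bar> * (1 + x ^ 4)) \<le> \<bar>y\<bar> * (8 * 41472 * (1 + y ^ 4))"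
      by (intro mult_left_mono) auto
    then have "\<bar>std_normal_density (x + y) - std_normal_density x\<bar> * (1 + x ^ 4) \<le> 8 * 41472 * (\<bar>y\<bar> * (1 + y ^ 4))"
      unfolding \<xi>(2) by (simp add: abs_mult mult_ac)
    moreover have "0 < 1 + x ^ 4" by (simp add: add_pos_nonneg)
    ultimately show ?thesis by (simp only: pos_le_divide_eq)
  qed
  then show ?thesis by (intro that[of "8 * 41472"]) auto
qed

lemma integral_kern_scaled:
  fixes h :: "real \<Rightarrow> real"
  assumes "0 < T"
  shows "T * (\<integral>y. kern b (T * (y - x)) * h y \<partial>lborel) = (\<integral>u. h (x + u / T) * kern b u \<partial>lborel)"
proof -
  have "(\<integral>y. kern b (T * (y - x)) * h y \<partial>lborel)
      = \<bar>1 / T\<bar> *\<^sub>R (\<integral>u. kern b (T * ((x + 1 / T * u) - x)) * h (x + 1 / T * u) \<partial>lborel)"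
    using assms by (intro lborel_integral_real_affine) auto
  then show ?thesis using assms by (simp add: mult.commute)
qed

text \<open>After the substitution y = x + u/T the difference is an average over the kernel of
  increments of the normal density across a distance u/T; \<open>std_normal_lipschitz\<close> bounds
  it by 1/T times a moment of the kernel.\<close>

lemma smooth_std_normal:
  assumes "0 < b"
  obtains C where "0 < C" "\<And>T x. 1 \<le> T \<Longrightarrow>
    \<bar>smooth b T std_normal_distribution x - std_normal_density x\<bar> \<le> C / T / (1 + x ^ 4)"
proof -
  obtain L where L: "0 < L" "\<And>x y. \<bar>std_normal_density (x + y) - std_normal_density x\<bar> \<le> L * (\<bar>y\<bar> * (1 + y ^ 4)) / (1 + x ^ 4)"
    using std_normal_lipschitz by blast
  define J where "J = (\<integral>u. (\<bar>u\<bar> * (1 + u ^ 4)) * kern b u \<partial>lborel)"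
  have m: "0 < kern_mass b" by (rule kern_mass_pos[OF assms])
  have iJ: "integrable lborel (\<lambda>u. (\<bar>u\<bar> * (1 + u ^ 4)) * kern b u)"
  proof (rule integrable_kern_le[where K = 2])
    show "\<bar>\<bar>y\<bar> * (1 + y ^ 4)\<bar> \<le> 2 * (1 + \<bar>y\<bar> ^ 5)" for y :: real
    proof -
      have "\<bar>y\<bar> \<le> 1 + \<bar>y\<bar> ^ 5"
      proof (cases "\<bar>y\<bar> \<le> 1")
        case False
        then have "\<bar>y\<bar> ^ 1 \<le> \<bar>y\<bar> ^ 5" by (intro power_increasing) auto
        then show ?thesis by simp
      qed (simp add: add_increasing2)
      moreover have "\<bar>y\<bar> * (1 + y ^ 4) = \<bar>y\<bar> + \<bar>y\<bar> ^ 5"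
        by (simp add: distrib_left eval_nat_numeral abs_mult[symmetric] mult.assoc[symmetric])
      ultimately show ?thesis by (simp add: abs_mult)
    qed
  qed (use assms in auto)
  have "0 \<le> J" unfolding J_def by (intro integral_nonneg_AE) auto
  have ik: "integrable lborel (kern b)"
    using integrable_kern_le[of b "\<lambda>_. 1" 1] assms by simp
  show ?thesis
  proof (rule that[of "L * J / kern_mass b + 1"])
    show "0 < L * J / kern_mass b + 1" using L(1) m \<open>0 \<le> J\<close> by (auto intro: add_nonneg_pos)
    fix T x :: real assume T: "1 \<le> T"
    have ig: "integrable lborel (\<lambda>u. std_normal_density (x + u / T) * kern b u)"
    proof (rule integrable_kern_le[where K = 1])
      show "\<bar>std_normal_density (x + y / T)\<bar> \<le> 1 * (1 + \<bar>y\<bar> ^ 5)" for y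
      proof -
        have "1 / sqrt (2 * pi) \<le> 1" using pi_gt3 by simp
        then have "std_normal_density (x + y / T) \<le> 1 * 1"
          unfolding std_normal_density_def by (intro mult_mono) auto
        then show ?thesis by (simp add: add_increasing2)
      qed
    qed (use assms in auto)
    have "smooth b T std_normal_distribution x
        = (\<integral>u. std_normal_density (x + u / T) * kern b u \<partial>lborel) / kern_mass b"
    proof -
      have "(\<integral>y. kern b (T * (y - x)) \<partial>std_normal_distribution) = (\<integral>y. kern b (T * (y - x)) * std_normal_density y \<partial>lborel)"
        by (subst integral_density) (auto simp: mult.commute)
      then show ?thesis
        unfolding smooth_def using integral_kern_scaled[of T b x std_normal_density] T by simp
    qed
    moreover have "std_normal_density x = (\<integral>u. std_normal_density x * kern b u \<partial>lborel) / kern_mass b"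
      using m by (simp add: kern_mass_def)
    ultimately have eq: "smooth b T std_normal_distribution x - std_normal_density x
        = (\<integral>u. std_normal_density (x + u / T) * kern b u - std_normal_density x * kern b u \<partial>lborel) / kern_mass b"
      using ig ik by (simp add: Bochner_Integration.integral_diff diff_divide_distrib)
    have norm: "\<bar>(\<integral>u. std_normal_density (x + u / T) * kern b u - std_normal_density x * kern b u \<partial>lborel) / kern_mass b\<bar>
        \<le> (\<integral>u. L / T / (1 + x ^ 4) * ((\<bar>u\<bar> * (1 + u ^ 4)) * kern b u) \<partial>lborel) / kern_mass b"
    proof -
      have "norm (\<integral>u. std_normal_density (x + u / T) * kern b u - std_normal_density x * kern b u \<partial>lborel)
        \<le> (\<integral>u. L / T / (1 + x ^ 4) * ((\<bar>u\<bar> * (1 + u ^ 4)) * kern b u) \<partial>lborel)"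
      proof (rule norm_integral_le_AE)
        show "AE u in lborel. norm (std_normal_density (x + u / T) * kern b u - std_normal_density x * kern b u)
          \<le> L / T / (1 + x ^ 4) * ((\<bar>u\<bar> * (1 + u ^ 4)) * kern b u)"
        proof (rule AE_I2)
          fix u
          have "norm (std_normal_density (x + u / T) * kern b u - std_normal_density x * kern b u)
            = \<bar>std_normal_density (x + u / T) - std_normal_density x\<bar> * kern b u"
            by (simp add: left_diff_distrib[symmetric] abs_mult)
          also have "\<dots> \<le> L * (\<bar>u / T\<bar> * (1 + (u / T) ^ 4)) / (1 + x ^ 4) * kern b u"
            by (intro mult_right_mono L(2)) auto
          also have "\<dots> \<le> L * (\<bar>u\<bar> / T * (1 + u ^ 4)) / (1 + x ^ 4) * kern b u"
          proof -
            have "(u / T) ^ 4 \<le> u ^ 4"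
            proof -
              have "\<bar>u / T\<bar> ^ 4 \<le> \<bar>u\<bar> ^ 4"
                using T mult_left_mono[of 1 T "\<bar>u\<bar>"] by (intro power_mono) (auto simp: abs_divide divide_le_eq)
              moreover have "\<bar>z\<bar> ^ 4 = z ^ 4" for z :: real by (rule power_even_abs) simp
              ultimately show ?thesis by metis
            qed
            then show ?thesis
              using L(1) T
              by (intro mult_right_mono divide_right_mono mult_left_mono mult_mono)
                (auto simp: abs_divide)
          qed
          also have "\<dots> = L / T / (1 + x ^ 4) * ((\<bar>u\<bar> * (1 + u ^ 4)) * kern b u)" by simp
          finally show "norm (std_normal_density (x + u / T) * kern b u - std_normal_density x * kern b u)
            \<le> L / T / (1 + x ^ 4) * ((\<bar>u\<bar> * (1 + u ^ 4)) * kern b u)" .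
        qed
      qed (use ig ik iJ in auto)
      then show ?thesis
        unfolding abs_divide abs_of_pos[OF m] real_norm_def by (rule divide_right_mono) (use m in simp)
    qed
    have "(\<integral>u. L / T / (1 + x ^ 4) * ((\<bar>u\<bar> * (1 + u ^ 4)) * kern b u) \<partial>lborel) / kern_mass b
        = L / T / (1 + x ^ 4) * J / kern_mass b"
      unfolding J_def by (simp only: integral_mult_right_zero)
    moreover have "L / T / (1 + x ^ 4) * J / kern_mass b = L * J / kern_mass b / T / (1 + x ^ 4)"
      by (simp add: mult.commute)
    moreover have "L * J / kern_mass b / T / (1 + x ^ 4) \<le> (L * J / kern_mass b + 1) / T / (1 + x ^ 4)"
      by (intro divide_right_mono) (use T in \<open>simp_all add: add_increasing2\<close>)
    ultimately show "\<bar>smooth b T std_normal_distribution x - std_normal_density x\<bar>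
      \<le> (L * J / kern_mass b + 1) / T / (1 + x ^ 4)"
      using norm unfolding eq by linarith
  qed
qed

text \<open>Cross terms factor by independence. Means may be nonzero because truncation destroys the
  centring; they enter through the square of the sum of their moduli.\<close>

lemma (in prob_space) expectation_sum_square_le:
  fixes W :: "'i \<Rightarrow> 'a \<Rightarrow> real"
  assumes "finite I" "indep_vars (\<lambda>_. borel) W I"
    and "\<And>i. i \<in> I \<Longrightarrow> integrable M (W i)" "\<And>i. i \<in> I \<Longrightarrow> integrable M (\<lambda>x. (W i x)\<^sup>2)"
  shows "integrable M (\<lambda>x. (\<Sum>i\<in>I. W i x)\<^sup>2)"
    and "expectation (\<lambda>x. (\<Sum>i\<in>I. W i x)\<^sup>2)
      \<le> (\<Sum>i\<in>I. expectation (\<lambda>x. (W i x)\<^sup>2)) + (\<Sum>i\<in>I. \<bar>expectation (W i)\<bar>)\<^sup>2"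
proof -
  have "integrable M (\<lambda>x. (\<Sum>i\<in>I. W i x)\<^sup>2) \<and> expectation (\<lambda>x. (\<Sum>i\<in>I. W i x)\<^sup>2)
      \<le> (\<Sum>i\<in>I. expectation (\<lambda>x. (W i x)\<^sup>2)) + (\<Sum>i\<in>I. \<bar>expectation (W i)\<bar>)\<^sup>2"
    using assms
  proof (induction I rule: finite_induct)
    case (insert j I)
    let ?S = "\<lambda>x. \<Sum>i\<in>I. W i x"
    have ind: "indep_vars (\<lambda>_. borel) W I"
      using insert.prems(1) by (rule indep_vars_subset) auto
    have IH: "integrable M (\<lambda>x. (?S x)\<^sup>2)" "expectation (\<lambda>x. (?S x)\<^sup>2)
      \<le> (\<Sum>i\<in>I. expectation (\<lambda>x. (W i x)\<^sup>2)) + (\<Sum>i\<in>I. \<bar>expectation (W i)\<bar>)\<^sup>2"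
      using insert.IH[OF ind] insert.prems by auto
    have jS: "indep_var borel (W j) borel ?S"
      using insert.hyps insert.prems(1) by (intro indep_vars_sum) auto
    have iS: "integrable M ?S" using insert.prems by auto
    have ij: "integrable M (W j)" "integrable M (\<lambda>x. (W j x)\<^sup>2)" using insert.prems by auto
    have prod: "integrable M (\<lambda>x. W j x * ?S x)" "expectation (\<lambda>x. W j x * ?S x) = expectation (W j) * expectation ?S"
      by (rule indep_var_integrable[OF jS ij(1) iS] indep_var_lebesgue_integral[OF jS ij(1) iS])+
    have eq: "(\<Sum>i\<in>insert j I. W i x)\<^sup>2 = (W j x)\<^sup>2 + (2 * (W j x * ?S x) + (?S x)\<^sup>2)" for x
      using insert.hyps by (simp add: power2_sum)
    have ES: "\<bar>expectation ?S\<bar> \<le> (\<Sum>i\<in>I. \<bar>expectation (W i)\<bar>)"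
      using insert.prems by (subst Bochner_Integration.integral_sum) auto
    have "integrable M (\<lambda>x. (\<Sum>i\<in>insert j I. W i x)\<^sup>2)"
      unfolding eq using ij prod IH by auto
    moreover have "expectation (\<lambda>x. (\<Sum>i\<in>insert j I. W i x)\<^sup>2)
      = expectation (\<lambda>x. (W j x)\<^sup>2) + (2 * (expectation (W j) * expectation ?S) + expectation (\<lambda>x. (?S x)\<^sup>2))"
      unfolding eq using ij prod IH by simp
    moreover have "expectation (W j) * expectation ?S \<le> \<bar>expectation (W j)\<bar> * (\<Sum>i\<in>I. \<bar>expectation (W i)\<bar>)"
    proof -
      have "expectation (W j) * expectation ?S \<le> \<bar>expectation (W j)\<bar> * \<bar>expectation ?S\<bar>"
        by (metis abs_ge_self abs_mult)
      also have "\<dots> \<le> \<bar>expectation (W j)\<bar> * (\<Sum>i\<in>I. \<bar>expectation (W i)\<bar>)"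
        using ES by (intro mult_left_mono) auto
      finally show ?thesis .
    qed
    moreover have "a + (2 * p + b) \<le> a + s + (e + t)\<^sup>2"
      if "p \<le> e * t" "b \<le> s + t\<^sup>2" for a p b s e t :: real
    proof -
      have "(e + t)\<^sup>2 = e\<^sup>2 + t\<^sup>2 + 2 * (e * t)" by (simp add: power2_eq_square algebra_simps)
      then show ?thesis using that zero_le_power2[of e] by linarith
    qed
    ultimately show ?case
      using IH(2) insert.hyps by (simp add: add.assoc[symmetric])
  qed simp
  then show "integrable M (\<lambda>x. (\<Sum>i\<in>I. W i x)\<^sup>2)"
    "expectation (\<lambda>x. (\<Sum>i\<in>I. W i x)\<^sup>2)
      \<le> (\<Sum>i\<in>I. expectation (\<lambda>x. (W i x)\<^sup>2)) + (\<Sum>i\<in>I. \<bar>expectation (W i)\<bar>)\<^sup>2"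
    by auto
qed

section \<open>Truncation of the steps\<close>

definition trunc :: "real \<Rightarrow> real \<Rightarrow> real" where
  "trunc T x = (if \<bar>x\<bar> \<le> T then x / T else 0)"

text \<open>Large values are removed rather than capped, so \<open>trunc\<close> and
  \<open>excess\<close> are never both nonzero and their squares add up as well.\<close>

definition excess :: "real \<Rightarrow> real \<Rightarrow> real" where
  "excess T x = (if \<bar>x\<bar> \<le> T then 0 else x / T)"

lemma measurable_trunc [measurable]: "trunc T \<in> borel_measurable borel"
  and measurable_excess [measurable]: "excess T \<in> borel_measurable borel"
  unfolding trunc_def excess_def by measurable

lemma trunc_add_excess: "trunc T x + excess T x = x / T"
  by (simp add: trunc_def excess_def)

lemma abs_trunc_le: "0 < T \<Longrightarrow> \<bar>trunc T x\<bar> \<le> 1"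
  by (simp add: trunc_def abs_divide divide_le_eq)

text \<open>Where the excess is nonzero its modulus is at least 1, so every power up to 2 + \<delta>
  is dominated by the highest one. With T = sqrt n all these moments are of order n^(-1 -
  \<delta>/2).\<close>

lemma excess_powr_le:
  assumes "0 < T" "a \<le> 2 + \<delta>" "0 \<le> \<delta>"
  shows "\<bar>excess T x\<bar> powr a \<le> \<bar>x\<bar> powr (2 + \<delta>) / T powr (2 + \<delta>)"
proof (cases "\<bar>x\<bar> \<le> T")
  case False
  then have "1 \<le> \<bar>x / T\<bar>" using assms by (simp add: abs_divide le_divide_eq)
  then have "\<bar>x / T\<bar> powr a \<le> \<bar>x / T\<bar> powr (2 + \<delta>)" using assms by (intro powr_mono) auto
  also have "\<dots> = \<bar>x\<bar> powr (2 + \<delta>) / T powr (2 + \<delta>)"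
    using assms by (simp add: abs_divide powr_divide)
  finally show ?thesis using False by (simp add: excess_def)
qed (simp add: excess_def)

lemma trunc_powr_le:
  assumes "0 < T" "0 \<le> \<delta>"
  shows "\<bar>trunc T x\<bar> powr (2 + \<delta>) \<le> \<bar>x\<bar> powr (2 + \<delta>) / T powr (2 + \<delta>)"
  using assms by (auto simp: trunc_def abs_divide powr_divide)

locale normalised_step = prob_space M for M :: "'a measure" +
  fixes X :: "'a \<Rightarrow> real" and \<delta> :: real
  assumes rv [measurable]: "X \<in> borel_measurable M"
    and delta: "0 < \<delta>" "\<delta> \<le> 1"
    and moment: "integrable M (\<lambda>x. \<bar>X x\<bar> powr (2 + \<delta>))"
    and mean: "expectation X = 0" and var: "expectation (\<lambda>x. (X x)\<^sup>2) = 1"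
begin

definition "L = expectation (\<lambda>x. \<bar>X x\<bar> powr (2 + \<delta>))"

lemma L_nonneg: "0 \<le> L" unfolding L_def by (intro integral_nonneg_AE) auto

lemma integrable_square: "integrable M (\<lambda>x. (X x)\<^sup>2)"
  \<comment> \<open>A square that is not integrable would have integral 0 by convention, not
    1.\<close>
  using var not_integrable_integral_eq by fastforce

lemma integrable_X: "integrable M X"
  by (rule square_integrable_imp_integrable[OF rv integrable_square])

text \<open>All error terms of the truncation, of whatever order, are dominated by (|x|/T)^(2 +
  \<delta>) and are therefore handled by one estimate.\<close>

lemma small_moment:
  assumes T: "0 < T" and f: "f \<in> borel_measurable borel" "\<And>x. \<bar>f x\<bar> \<le> \<bar>x\<bar> powr (2 + \<delta>) / T powr (2 + \<delta>)"
  shows "integrable M (\<lambda>x. f (X x))" "expectation (\<lambda>x. \<bar>f (X x)\<bar>) \<le> L / T powr (2 + \<delta>)"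
proof -
  have [measurable]: "f \<in> borel_measurable borel" by fact
  have i: "integrable M (\<lambda>x. \<bar>X x\<bar> powr (2 + \<delta>) / T powr (2 + \<delta>))" using moment by simp
  show 1: "integrable M (\<lambda>x. f (X x))"
    by (rule Bochner_Integration.integrable_bound[OF i]) (use f in auto)
  have "expectation (\<lambda>x. \<bar>f (X x)\<bar>) \<le> expectation (\<lambda>x. \<bar>X x\<bar> powr (2 + \<delta>) / T powr (2 + \<delta>))"
    using 1 i f by (intro integral_mono) auto
  then show "expectation (\<lambda>x. \<bar>f (X x)\<bar>) \<le> L / T powr (2 + \<delta>)" by (simp add: L_def)
qed

lemma excess_moments:
  assumes T: "0 < T"
  shows "integrable M (\<lambda>x. excess T (X x))" "\<bar>expectation (\<lambda>x. excess T (X x))\<bar> \<le> L / T powr (2 + \<delta>)"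
    "integrable M (\<lambda>x. (excess T (X x))\<^sup>2)" "expectation (\<lambda>x. (excess T (X x))\<^sup>2) \<le> L / T powr (2 + \<delta>)"
    "integrable M (\<lambda>x. \<bar>excess T (X x)\<bar> powr \<delta>)" "expectation (\<lambda>x. \<bar>excess T (X x)\<bar> powr \<delta>) \<le> L / T powr (2 + \<delta>)"
proof -
  have p: "\<bar>excess T x\<bar> powr a \<le> \<bar>x\<bar> powr (2 + \<delta>) / T powr (2 + \<delta>)" if "a \<le> 2 + \<delta>" for a x
    using T that delta by (intro excess_powr_le) auto
  have 1: "\<bar>excess T x\<bar> \<le> \<bar>x\<bar> powr (2 + \<delta>) / T powr (2 + \<delta>)" for x
    using p[of 1 x] delta by simp
  have 2: "\<bar>(excess T x)\<^sup>2\<bar> \<le> \<bar>x\<bar> powr (2 + \<delta>) / T powr (2 + \<delta>)" for x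
    using p[of 2 x] delta by (cases "excess T x = 0") (auto simp: powr_numeral)
  have 3: "\<bar>\<bar>excess T x\<bar> powr \<delta>\<bar> \<le> \<bar>x\<bar> powr (2 + \<delta>) / T powr (2 + \<delta>)" for x
    using p[of \<delta> x] delta by simp
  show "integrable M (\<lambda>x. excess T (X x))" by (rule small_moment[OF T _ 1]) simp
  have "\<bar>expectation (\<lambda>x. excess T (X x))\<bar> \<le> expectation (\<lambda>x. \<bar>excess T (X x)\<bar>)" by (rule integral_abs_bound)
  also have "\<dots> \<le> L / T powr (2 + \<delta>)" by (rule small_moment[OF T _ 1]) simp
  finally show "\<bar>expectation (\<lambda>x. excess T (X x))\<bar> \<le> L / T powr (2 + \<delta>)" .
  show "integrable M (\<lambda>x. (excess T (X x))\<^sup>2)" by (rule small_moment(1)[OF T _ 2]) simp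
  show "expectation (\<lambda>x. (excess T (X x))\<^sup>2) \<le> L / T powr (2 + \<delta>)"
    using small_moment(2)[OF T _ 2] by simp
  show "integrable M (\<lambda>x. \<bar>excess T (X x)\<bar> powr \<delta>)" by (rule small_moment(1)[OF T _ 3]) simp
  show "expectation (\<lambda>x. \<bar>excess T (X x)\<bar> powr \<delta>) \<le> L / T powr (2 + \<delta>)"
    using small_moment(2)[OF T _ 3] by simp
qed

text \<open>The scaled step has mean 0 and second moment 1/T^2, and \<open>trunc\<close> differs
  from it by \<open>excess\<close>; hence the errors in both moments are moments of the
  excess.\<close>

lemma trunc_moments:
  assumes T: "0 < T"
  shows "\<bar>expectation (\<lambda>x. trunc T (X x))\<bar> \<le> L / T powr (2 + \<delta>)"
    "\<bar>expectation (\<lambda>x. (trunc T (X x))\<^sup>2) - 1 / T\<^sup>2\<bar> \<le> L / T powr (2 + \<delta>)"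
    "expectation (\<lambda>x. \<bar>trunc T (X x)\<bar> powr (2 + \<delta>)) \<le> L / T powr (2 + \<delta>)"
proof -
  have "trunc T x = x / T - excess T x" for x using trunc_add_excess[of T x] by simp
  then have "expectation (\<lambda>x. trunc T (X x)) = - expectation (\<lambda>x. excess T (X x))"
    using integrable_X excess_moments(1)[OF T] mean by simp
  then show "\<bar>expectation (\<lambda>x. trunc T (X x))\<bar> \<le> L / T powr (2 + \<delta>)"
    using excess_moments(2)[OF T] by simp
  have "(trunc T x)\<^sup>2 = x\<^sup>2 / T\<^sup>2 - (excess T x)\<^sup>2" for x
    by (simp add: trunc_def excess_def power_divide)
  then have "expectation (\<lambda>x. (trunc T (X x))\<^sup>2) = 1 / T\<^sup>2 - expectation (\<lambda>x. (excess T (X x))\<^sup>2)"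
    using integrable_square excess_moments(3)[OF T] var by simp
  moreover have "0 \<le> expectation (\<lambda>x. (excess T (X x))\<^sup>2)" by (intro integral_nonneg_AE) auto
  ultimately show "\<bar>expectation (\<lambda>x. (trunc T (X x))\<^sup>2) - 1 / T\<^sup>2\<bar> \<le> L / T powr (2 + \<delta>)"
    using excess_moments(4)[OF T] by simp
  show "expectation (\<lambda>x. \<bar>trunc T (X x)\<bar> powr (2 + \<delta>)) \<le> L / T powr (2 + \<delta>)"
    using small_moment(2)[OF T, of "\<lambda>x. \<bar>trunc T x\<bar> powr (2 + \<delta>)"] trunc_powr_le[OF T] delta
    by simp
qed

end

section \<open>Noise from the kernel, and couplings with the normal law\<close>

definition kern_law :: "real \<Rightarrow> real measure" where
  "kern_law b = density lborel (\<lambda>u. ennreal (kern b u / kern_mass b))"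

lemma sets_kern_law [measurable_cong]: "sets (kern_law b) = sets borel"
  by (simp add: kern_law_def)

lemma integrable_kern: "0 < b \<Longrightarrow> integrable lborel (kern b)"
  using integrable_kern_le[of b "\<lambda>_. 1" 1] by simp

lemma prob_space_kern_law:
  assumes "0 < b"
  shows "prob_space (kern_law b)"
proof (rule prob_spaceI)
  have "emeasure (kern_law b) (space (kern_law b)) = (\<integral>\<^sup>+ u. ennreal (kern b u / kern_mass b) \<partial>lborel)"
    by (simp add: kern_law_def emeasure_density)
  also have "\<dots> = ennreal (\<integral>u. kern b u / kern_mass b \<partial>lborel)"
    using integrable_kern[OF assms] kern_mass_pos[OF assms] by (intro nn_integral_eq_integral) auto
  also have "(\<integral>u. kern b u / kern_mass b \<partial>lborel) = 1"
    using kern_mass_pos[OF assms] by (simp add: kern_mass_def)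
  finally show "emeasure (kern_law b) (space (kern_law b)) = 1" by simp
qed

lemma measurable_smooth:
  assumes "prob_space M" and [measurable]: "S \<in> borel_measurable M"
  shows "smooth b T (distr M borel S) \<in> borel_measurable borel"
proof -
  interpret M: prob_space M by fact
  have "(\<lambda>x. \<integral>m. kern b (T * (S m - x)) \<partial>M) \<in> borel_measurable borel"
    by (rule M.borel_measurable_lebesgue_integral) measurable
  then show ?thesis
    unfolding smooth_def by (simp add: integral_distr)
qed

text \<open>For fixed s the substitution u = T (s - x), with Jacobian T, turns the law of s - u/T
  into a density in x; Tonelli's theorem then averages this density over S.\<close>

lemma distr_add_kern:
  assumes "prob_space M" and [measurable]: "S \<in> borel_measurable M" and b: "0 < b" and T: "0 < T"
  shows "distr (M \<Otimes>\<^sub>M kern_law b) borel (\<lambda>(m, u). S m - u / T)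
    = density lborel (\<lambda>x. ennreal (smooth b T (distr M borel S) x))"
proof (rule measure_eqI_nn_integral)
  interpret M: prob_space M by fact
  interpret K: prob_space "kern_law b" by (rule prob_space_kern_law[OF b])
  interpret P: pair_sigma_finite M "lborel :: real measure" ..
  have km: "0 < kern_mass b" by (rule kern_mass_pos[OF b])
  obtain C where C: "\<And>y. (1 + y ^ 8) * kern b y \<le> C" using kern_decay[of b] b by auto
  have kb: "kern b y \<le> C" for y
  proof -
    have "1 * kern b y \<le> (1 + y ^ 8) * kern b y" by (intro mult_right_mono) auto
    then show ?thesis using C[of y] by simp
  qed
  have sm: "(\<integral>\<^sup>+ m. ennreal (T * kern b (T * (S m - x)) / kern_mass b) \<partial>M) = ennreal (smooth b T (distr M borel S) x)" for x
  proof -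
    have i: "integrable M (\<lambda>m. kern b (T * (S m - x)))"
      by (rule M.integrable_const_bound[where B = C]) (auto simp: kb)
    have "(\<integral>\<^sup>+ m. ennreal (T * kern b (T * (S m - x)) / kern_mass b) \<partial>M)
      = ennreal (\<integral>m. T * kern b (T * (S m - x)) / kern_mass b \<partial>M)"
      using i T km by (intro nn_integral_eq_integral) auto
    also have "(\<integral>m. T * kern b (T * (S m - x)) / kern_mass b \<partial>M) = smooth b T (distr M borel S) x"
      by (simp add: smooth_def integral_distr)
    finally show ?thesis .
  qed
  note [measurable] = measurable_smooth[OF \<open>prob_space M\<close> \<open>S \<in> borel_measurable M\<close>, of b T]
  fix h :: "real \<Rightarrow> ennreal"
  assume "h \<in> borel_measurable (density lborel (\<lambda>x. ennreal (smooth b T (distr M borel S) x)))"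
  then have [measurable]: "h \<in> borel_measurable borel" by simp
  have inner: "(\<integral>\<^sup>+ u. h (s - u / T) \<partial>kern_law b) = (\<integral>\<^sup>+ x. ennreal (T * kern b (T * (s - x)) / kern_mass b) * h x \<partial>lborel)" for s
  proof -
    have "(\<integral>\<^sup>+ u. h (s - u / T) \<partial>kern_law b) = (\<integral>\<^sup>+ u. ennreal (kern b u / kern_mass b) * h (s - u / T) \<partial>lborel)"
      unfolding kern_law_def by (rule nn_integral_density) measurable
    also have "\<dots> = ennreal \<bar>- T\<bar> * (\<integral>\<^sup>+ x. ennreal (kern b (T * s + - T * x) / kern_mass b) * h (s - (T * s + - T * x) / T) \<partial>lborel)"
      using T by (intro nn_integral_real_affine) auto
    also have "\<dots> = (\<integral>\<^sup>+ x. ennreal T * (ennreal (kern b (T * s + - T * x) / kern_mass b) * h (s - (T * s + - T * x) / T)) \<partial>lborel)"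
      using T by (subst nn_integral_cmult) auto
    also have "\<dots> = (\<integral>\<^sup>+ x. ennreal (T * kern b (T * (s - x)) / kern_mass b) * h x \<partial>lborel)"
    proof (rule nn_integral_cong)
      fix x
      have 1: "s - (T * s + - T * x) / T = x" using T by (simp add: field_simps)
      have 2: "T * s + - T * x = T * (s - x)" by (simp add: algebra_simps)
      show "ennreal T * (ennreal (kern b (T * s + - T * x) / kern_mass b) * h (s - (T * s + - T * x) / T))
        = ennreal (T * kern b (T * (s - x)) / kern_mass b) * h x"
        unfolding 1 unfolding 2 using T km by (simp add: mult.assoc[symmetric] ennreal_mult'[symmetric])
    qed
    finally show ?thesis .
  qed
  have "integral\<^sup>N (distr (M \<Otimes>\<^sub>M kern_law b) borel (\<lambda>(m, u). S m - u / T)) h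
      = (\<integral>\<^sup>+ z. h (S (fst z) - snd z / T) \<partial>(M \<Otimes>\<^sub>M kern_law b))"
    by (subst nn_integral_distr) (auto simp: split_beta')
  also have "\<dots> = (\<integral>\<^sup>+ m. (\<integral>\<^sup>+ u. h (S m - u / T) \<partial>kern_law b) \<partial>M)"
    by (subst K.nn_integral_fst[symmetric]) auto
  also have "\<dots> = (\<integral>\<^sup>+ m. (\<integral>\<^sup>+ x. ennreal (T * kern b (T * (S m - x)) / kern_mass b) * h x \<partial>lborel) \<partial>M)"
    by (simp only: inner)
  also have "\<dots> = (\<integral>\<^sup>+ x. (\<integral>\<^sup>+ m. ennreal (T * kern b (T * (S m - x)) / kern_mass b) * h x \<partial>M) \<partial>lborel)"
    by (rule P.Fubini'[symmetric]) measurable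
  also have "\<dots> = (\<integral>\<^sup>+ x. ennreal (smooth b T (distr M borel S) x) * h x \<partial>lborel)"
    by (simp add: nn_integral_multc sm)
  also have "\<dots> = integral\<^sup>N (density lborel (\<lambda>x. ennreal (smooth b T (distr M borel S) x))) h"
    by (subst nn_integral_density) auto
  finally show "integral\<^sup>N (distr (M \<Otimes>\<^sub>M kern_law b) borel (\<lambda>(m, u). S m - u / T)) h
    = integral\<^sup>N (density lborel (\<lambda>x. ennreal (smooth b T (distr M borel S) x))) h" .
qed simp

lemma nn_integral_std_normal: "(\<integral>\<^sup>+ x. ennreal (std_normal_density x) \<partial>lborel) = 1"
proof -
  interpret N: prob_space std_normal_distribution by (rule prob_space_normal_density) simp
  show ?thesis using N.emeasure_space_1 by (simp add: emeasure_density)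
qed

text \<open>\<open>maximal_coupling\<close> on the product space with the normal coordinate as Y, so
  that f = g and the density term vanishes. The bound carries no rate; it serves the finitely many
  small n.\<close>

lemma independent_coupling:
  assumes "prob_space M" and [measurable]: "A \<in> borel_measurable M" and \<delta>: "0 < \<delta>" "\<delta> \<le> 1"
  shows "\<exists>Q\<in>couplings (distr M borel A) std_normal_distribution.
    (\<integral>\<^sup>+ z. ennreal (cost \<delta> (fst z - snd z)) \<partial>Q)
      \<le> 4 * (\<integral>\<^sup>+ m. ennreal (cost \<delta> (A m)) \<partial>M) + 4 * (\<integral>\<^sup>+ x. ennreal (cost \<delta> x) \<partial>std_normal_distribution)"
proof -
  let ?N = "std_normal_distribution"
  interpret M: prob_space M by fact
  interpret N: prob_space ?N by (rule prob_space_normal_density) simp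
  interpret P: pair_sigma_finite M ?N ..
  interpret MN: prob_space "M \<Otimes>\<^sub>M ?N" by (rule prob_space_pair) unfold_locales
  have A: "distr (M \<Otimes>\<^sub>M ?N) borel (\<lambda>z. A (fst z)) = distr M borel A"
    using N.distr_pair_fst[of M] by (subst distr_distr[symmetric, where N = M, unfolded comp_def]) auto
  have Y: "distr (M \<Otimes>\<^sub>M ?N) borel snd = ?N"
  proof -
    have "distr (M \<Otimes>\<^sub>M ?N) ?N snd = ?N"
    proof (rule measure_eqI_nn_integral)
      fix h :: "real \<Rightarrow> ennreal" assume h: "h \<in> borel_measurable ?N"
      then have [measurable]: "h \<in> borel_measurable borel" by simp
      have "integral\<^sup>N (distr (M \<Otimes>\<^sub>M ?N) ?N snd) h = (\<integral>\<^sup>+ z. h (snd z) \<partial>(M \<Otimes>\<^sub>M ?N))"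
        by (subst nn_integral_distr) auto
      also have "\<dots> = (\<integral>\<^sup>+ m. integral\<^sup>N ?N h \<partial>M)"
        by (subst N.nn_integral_fst[symmetric]) auto
      finally show "integral\<^sup>N (distr (M \<Otimes>\<^sub>M ?N) ?N snd) h = integral\<^sup>N ?N h"
        by (simp add: M.emeasure_space_1)
    qed simp
    then show ?thesis by (simp cong: distr_cong)
  qed
  have "\<exists>Q\<in>couplings (distr (M \<Otimes>\<^sub>M ?N) borel (\<lambda>z. A (fst z))) (density lborel std_normal_density).
    (\<integral>\<^sup>+ z. ennreal (cost \<delta> (fst z - snd z)) \<partial>Q)
      \<le> 2 * (\<integral>\<^sup>+ z. ennreal (cost \<delta> (A (fst z) - snd z)) \<partial>(M \<Otimes>\<^sub>M ?N))
        + 4 * (\<integral>\<^sup>+ x. ennreal \<bar>std_normal_density x - std_normal_density x\<bar> * ennreal (cost \<delta> x) \<partial>lborel)"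
    by (rule maximal_coupling[OF MN.prob_space_axioms _ _ Y _ _ _ _ nn_integral_std_normal _
          ennreal_cost_add_le[OF \<delta>]]) simp_all
  then obtain Q where Q: "Q \<in> couplings (distr M borel A) ?N"
    "(\<integral>\<^sup>+ z. ennreal (cost \<delta> (fst z - snd z)) \<partial>Q)
      \<le> 2 * (\<integral>\<^sup>+ z. ennreal (cost \<delta> (A (fst z) - snd z)) \<partial>(M \<Otimes>\<^sub>M ?N))"
    unfolding A by auto
  have "(\<integral>\<^sup>+ z. ennreal (cost \<delta> (A (fst z) - snd z)) \<partial>(M \<Otimes>\<^sub>M ?N))
    = (\<integral>\<^sup>+ m. (\<integral>\<^sup>+ x. ennreal (cost \<delta> (A m - x)) \<partial>?N) \<partial>M)"
    by (subst N.nn_integral_fst[symmetric]) auto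
  also have "\<dots> \<le> (\<integral>\<^sup>+ m. (\<integral>\<^sup>+ x. 2 * (ennreal (cost \<delta> (A m)) + ennreal (cost \<delta> x)) \<partial>?N) \<partial>M)"
    using ennreal_cost_add_le[OF \<delta>, of "A _" "- _"] by (intro nn_integral_mono) simp
  also have "\<dots> = (\<integral>\<^sup>+ m. 2 * (ennreal (cost \<delta> (A m)) + (\<integral>\<^sup>+ x. ennreal (cost \<delta> x) \<partial>?N)) \<partial>M)"
    by (subst nn_integral_cmult, simp, subst nn_integral_add) (simp_all add: N.emeasure_space_1[simplified])
  also have "\<dots> = 2 * ((\<integral>\<^sup>+ m. ennreal (cost \<delta> (A m)) \<partial>M) + (\<integral>\<^sup>+ x. ennreal (cost \<delta> x) \<partial>?N))"
    by (subst nn_integral_cmult, simp, subst nn_integral_add) (simp_all add: M.emeasure_space_1)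
  finally have "2 * (\<integral>\<^sup>+ z. ennreal (cost \<delta> (A (fst z) - snd z)) \<partial>(M \<Otimes>\<^sub>M ?N))
    \<le> 2 * (2 * ((\<integral>\<^sup>+ m. ennreal (cost \<delta> (A m)) \<partial>M) + (\<integral>\<^sup>+ x. ennreal (cost \<delta> x) \<partial>?N)))"
    by (rule mult_left_mono) simp
  also have "\<dots> = 4 * (\<integral>\<^sup>+ m. ennreal (cost \<delta> (A m)) \<partial>M) + 4 * (\<integral>\<^sup>+ x. ennreal (cost \<delta> x) \<partial>?N)"
    by (simp add: distrib_left mult.assoc[symmetric])
  finally show ?thesis using Q by (intro bexI[of _ Q]) (auto intro: order_trans)
qed

lemma distr_power_char:
  assumes "prob_space M" "prob_space.indep_vars M (\<lambda>_. borel) X (UNIV :: nat set)"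
    and same: "\<And>i. distr M borel (X i) = distr M borel (X 0)" and [measurable]: "f \<in> borel_measurable borel"
  shows "char (distr M borel (\<lambda>m. \<Sum>i<n. f (X i m))) s = char (distr M borel (\<lambda>m. f (X 0 m))) s ^ n"
proof -
  interpret prob_space M by fact
  have [measurable]: "X i \<in> borel_measurable M" for i
    using assms(2) by (auto simp: indep_vars_def)
  have "indep_vars (\<lambda>_. borel) (\<lambda>i m. f (X i m)) UNIV"
    by (rule indep_vars_compose2[OF assms(2)]) simp
  then have "indep_vars (\<lambda>_. borel) (\<lambda>i m. f (X i m)) {..<n}"
    by (rule indep_vars_subset) simp
  from char_distr_sum[OF this]
  have "char (distr M borel (\<lambda>m. \<Sum>i<n. f (X i m))) s = (\<Prod>i<n. char (distr M borel (\<lambda>m. f (X i m))) s)" .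
  also have "\<dots> = (\<Prod>i<n. char (distr M borel (\<lambda>m. f (X 0 m))) s)"
  proof (rule prod.cong[OF refl])
    fix i
    have "distr M borel (\<lambda>m. f (X i m)) = distr (distr M borel (X i)) borel f"
      by (subst distr_distr) (auto simp: comp_def)
    also have "\<dots> = distr M borel (\<lambda>m. f (X 0 m))"
      unfolding same[of i] by (subst distr_distr) (auto simp: comp_def)
    finally show "char (distr M borel (\<lambda>m. f (X i m))) s = char (distr M borel (\<lambda>m. f (X 0 m))) s" by simp
  qed
  finally show ?thesis by simp
qed

text \<open>The difference is split at the smoothed normal density. One part compares characteristic
  functions; the other is the smoothing error of order 1/T, and 1/T \<le> n^(-\<delta>/2) as
  \<delta> \<le> 1.\<close>

lemma smoothed_density_close:
  assumes "prob_space M" "prob_space.indep_vars M (\<lambda>_. borel) X (UNIV :: nat set)"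
    and same: "\<And>i. distr M borel (X i) = distr M borel (X 0)" and step: "normalised_step M (X 0) \<delta>"
  obtains b C and n\<^sub>0 :: nat where "0 < b" "0 < C" "0 < n\<^sub>0"
    "\<And>n x. n\<^sub>0 \<le> n \<Longrightarrow>
      \<bar>smooth b (sqrt n) (distr M borel (\<lambda>m. \<Sum>i<n. trunc (sqrt n) (X i m))) x - std_normal_density x\<bar>
        \<le> C * n powr (- \<delta> / 2) / (1 + x ^ 4)"
proof -
  interpret step: normalised_step M "X 0" \<delta> by fact
  have [measurable]: "X i \<in> borel_measurable M" for i
    using assms(2) by (auto simp: step.indep_vars_def)
  define B where "B = max 1 step.L"
  obtain a\<^sub>0 C\<^sub>1 and n\<^sub>0 :: nat where a0: "0 < a\<^sub>0" and C1: "0 < C\<^sub>1" and n0: "0 < n\<^sub>0"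
    and est: "\<And>n \<mu>. n\<^sub>0 \<le> n \<Longrightarrow> real_distribution \<mu> \<Longrightarrow> AE x in \<mu>. \<bar>x\<bar> \<le> 1 \<Longrightarrow>
      \<bar>\<integral>x. x \<partial>\<mu>\<bar> \<le> B * real n powr (- 1 - \<delta> / 2) \<Longrightarrow>
      \<bar>(\<integral>x. x\<^sup>2 \<partial>\<mu>) - 1 / n\<bar> \<le> B * real n powr (- 1 - \<delta> / 2) \<Longrightarrow>
      (\<integral>x. \<bar>x\<bar> powr (2 + \<delta>) \<partial>\<mu>) \<le> B * real n powr (- 1 - \<delta> / 2) \<Longrightarrow>
      \<exists>D. D holomorphic_on UNIV \<and>
        (\<forall>s. char \<mu> s ^ n - char std_normal_distribution s = D (of_real s)) \<and>
        (\<forall>w. \<bar>Im w\<bar> \<le> 1 \<longrightarrow> \<bar>Re w\<bar> \<le> a\<^sub>0 * sqrt n + 1 \<longrightarrow>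
          cmod (D w) \<le> C\<^sub>1 * real n powr (- \<delta> / 2) / (1 + (Re w)\<^sup>2))"
    using char_power_estimate[of \<delta> B] step.delta unfolding B_def by (metis max.cobounded1)
  \<comment> \<open>With T = sqrt n the frequencies of the scaled kernel fill |s| \<le> 2bT =
    \<open>a\<^sub>0\<close> sqrt n, the window where the power estimate holds.\<close>
  define b where "b = a\<^sub>0 / 2"
  have b: "0 < b" using a0 by (simp add: b_def)
  obtain C\<^sub>2 where C2: "0 < C\<^sub>2" and diff: "\<And>T \<epsilon> \<mu>\<^sub>1 \<mu>\<^sub>2 D x. 1 \<le> T \<Longrightarrow> 0 \<le> \<epsilon> \<Longrightarrow> real_distribution \<mu>\<^sub>1 \<Longrightarrow> real_distribution \<mu>\<^sub>2 \<Longrightarrow>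
      D holomorphic_on UNIV \<Longrightarrow> (\<And>s. char \<mu>\<^sub>1 s - char \<mu>\<^sub>2 s = D (of_real s)) \<Longrightarrow>
      (\<And>w. \<bar>Im w\<bar> \<le> 1 \<Longrightarrow> \<bar>Re w\<bar> \<le> 2 * b * T + 1 \<Longrightarrow> cmod (D w) \<le> \<epsilon> / (1 + (Re w)\<^sup>2)) \<Longrightarrow>
      (1 + x ^ 4) * \<bar>(\<integral>y. kern b (T * (y - x)) \<partial>\<mu>\<^sub>1) - (\<integral>y. kern b (T * (y - x)) \<partial>\<mu>\<^sub>2)\<bar> \<le> C\<^sub>2 * \<epsilon> / T"
    using smoothing_difference[OF b] by blast
  obtain C\<^sub>3 where C3: "0 < C\<^sub>3" and smN: "\<And>T x. 1 \<le> T \<Longrightarrow>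
    \<bar>smooth b T std_normal_distribution x - std_normal_density x\<bar> \<le> C\<^sub>3 / T / (1 + x ^ 4)"
    using smooth_std_normal[OF b] by blast
  have km: "0 < kern_mass b" by (rule kern_mass_pos[OF b])
  define C where "C = C\<^sub>2 * C\<^sub>1 / kern_mass b + C\<^sub>3"
  show ?thesis
  proof (rule that[OF b _ n0])
    show "0 < C" using C1 C2 C3 km by (simp add: C_def add_pos_pos)
    fix n :: nat and x :: real assume n: "n\<^sub>0 \<le> n"
    define T where "T = sqrt n"
    have T: "1 \<le> T" using n n0 by (simp add: T_def)
    have n1: "1 \<le> real n" using n n0 by simp
    have TL: "step.L / T powr (2 + \<delta>) \<le> B * real n powr (- 1 - \<delta> / 2)"
    proof -
      have "T powr (2 + \<delta>) = real n powr (1 + \<delta> / 2)"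
        using n1 unfolding T_def by (simp add: powr_half_sqrt[symmetric] powr_powr add_divide_distrib)
      then have "step.L / T powr (2 + \<delta>) = step.L * real n powr (- (1 + \<delta> / 2))"
        using powr_minus_divide[of "real n" "1 + \<delta> / 2"] by simp
      also have "\<dots> \<le> B * real n powr (- (1 + \<delta> / 2))"
        by (intro mult_right_mono) (auto simp: B_def)
      also have "- (1 + \<delta> / 2) = - 1 - \<delta> / 2" by simp
      finally show ?thesis .
    qed
    define \<mu> where "\<mu> = distr M borel (\<lambda>m. trunc T (X 0 m))"
    define \<nu> where "\<nu> = distr M borel (\<lambda>m. \<Sum>i<n. trunc T (X i m))"
    have rd: "real_distribution \<mu>" "real_distribution \<nu>" "real_distribution std_normal_distribution"
      unfolding \<mu>_def \<nu>_def
      by (simp_all add: step.real_distribution_distr real_dist_normal_dist)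
    have "\<exists>D. D holomorphic_on UNIV \<and>
        (\<forall>s. char \<mu> s ^ n - char std_normal_distribution s = D (of_real s)) \<and>
        (\<forall>w. \<bar>Im w\<bar> \<le> 1 \<longrightarrow> \<bar>Re w\<bar> \<le> a\<^sub>0 * sqrt n + 1 \<longrightarrow>
          cmod (D w) \<le> C\<^sub>1 * real n powr (- \<delta> / 2) / (1 + (Re w)\<^sup>2))"
    proof (rule est[OF n rd(1)])
      have T0: "0 < T" using T by simp
      have T2: "T\<^sup>2 = n" using n1 by (simp add: T_def)
      show "AE x in \<mu>. \<bar>x\<bar> \<le> 1"
        unfolding \<mu>_def using abs_trunc_le[OF T0] by (subst AE_distr_iff) auto
      show "\<bar>\<integral>x. x \<partial>\<mu>\<bar> \<le> B * real n powr (- 1 - \<delta> / 2)"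
        unfolding \<mu>_def using step.trunc_moments(1)[OF T0] TL by (subst integral_distr) auto
      show "\<bar>(\<integral>x. x\<^sup>2 \<partial>\<mu>) - 1 / n\<bar> \<le> B * real n powr (- 1 - \<delta> / 2)"
        unfolding \<mu>_def using step.trunc_moments(2)[OF T0] TL T2 by (subst integral_distr) auto
      show "(\<integral>x. \<bar>x\<bar> powr (2 + \<delta>) \<partial>\<mu>) \<le> B * real n powr (- 1 - \<delta> / 2)"
        unfolding \<mu>_def using step.trunc_moments(3)[OF T0] TL by (subst integral_distr) auto
    qed
    then obtain D where D: "D holomorphic_on UNIV"
        "\<And>s. char \<mu> s ^ n - char std_normal_distribution s = D (of_real s)"
        "\<And>w. \<bar>Im w\<bar> \<le> 1 \<Longrightarrow> \<bar>Re w\<bar> \<le> a\<^sub>0 * sqrt n + 1 \<Longrightarrow>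
          cmod (D w) \<le> C\<^sub>1 * real n powr (- \<delta> / 2) / (1 + (Re w)\<^sup>2)"
      by blast
    have ch: "char \<nu> s = char \<mu> s ^ n" for s
      unfolding \<nu>_def \<mu>_def by (rule distr_power_char[OF assms(1-3)]) simp
    define E where "E = \<bar>(\<integral>y. kern b (T * (y - x)) \<partial>\<nu>) - (\<integral>y. kern b (T * (y - x)) \<partial>std_normal_distribution)\<bar>"
    have x4: "0 < 1 + x ^ 4" by (simp add: add_pos_nonneg)
    have "(1 + x ^ 4) * E \<le> C\<^sub>2 * (C\<^sub>1 * real n powr (- \<delta> / 2)) / T"
      unfolding E_def
    proof (rule diff[OF T _ rd(2,3) D(1)])
      show "char \<nu> s - char std_normal_distribution s = D (of_real s)" for s
        unfolding ch by (rule D(2))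
      show "cmod (D w) \<le> C\<^sub>1 * real n powr (- \<delta> / 2) / (1 + (Re w)\<^sup>2)"
        if "\<bar>Im w\<bar> \<le> 1" "\<bar>Re w\<bar> \<le> 2 * b * T + 1" for w
        using that by (intro D(3)) (auto simp: b_def T_def)
    qed (use C1 in simp)
    then have "E \<le> C\<^sub>2 * (C\<^sub>1 * real n powr (- \<delta> / 2)) / T / (1 + x ^ 4)"
      using x4 by (simp only: pos_le_divide_eq mult.commute)
    then have "T / kern_mass b * E \<le> T / kern_mass b * (C\<^sub>2 * (C\<^sub>1 * real n powr (- \<delta> / 2)) / T / (1 + x ^ 4))"
      using T km by (intro mult_left_mono) auto
    also have "\<dots> = C\<^sub>2 * C\<^sub>1 / kern_mass b * (real n powr (- \<delta> / 2) / (1 + x ^ 4))"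
      using T by simp
    also have "T / kern_mass b * E = \<bar>smooth b T \<nu> x - smooth b T std_normal_distribution x\<bar>"
    proof -
      have "0 \<le> T / kern_mass b" using T km by simp
      then show ?thesis
        by (simp only: smooth_def E_def right_diff_distrib[symmetric] abs_mult abs_of_nonneg)
    qed
    finally have 1: "\<bar>smooth b T \<nu> x - smooth b T std_normal_distribution x\<bar>
      \<le> C\<^sub>2 * C\<^sub>1 / kern_mass b * (real n powr (- \<delta> / 2) / (1 + x ^ 4))" .
    have "1 / T \<le> real n powr (- \<delta> / 2)"
    proof -
      have "1 / T = real n powr (- (1 / 2))"
        using powr_minus_divide[of "real n" "1 / 2"] n1 by (simp add: T_def powr_half_sqrt)
      also have "\<dots> \<le> real n powr (- \<delta> / 2)" using n1 step.delta by (intro powr_mono) auto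
      finally show ?thesis .
    qed
    then have "C\<^sub>3 * (1 / T / (1 + x ^ 4)) \<le> C\<^sub>3 * (real n powr (- \<delta> / 2) / (1 + x ^ 4))"
      using C3 x4 by (intro mult_left_mono divide_right_mono) simp_all
    with smN[OF T, of x]
    have 2: "\<bar>smooth b T std_normal_distribution x - std_normal_density x\<bar> \<le> C\<^sub>3 * (real n powr (- \<delta> / 2) / (1 + x ^ 4))"
      by simp
    have "\<bar>smooth b T \<nu> x - std_normal_density x\<bar> \<le> (C\<^sub>2 * C\<^sub>1 / kern_mass b + C\<^sub>3) * (real n powr (- \<delta> / 2) / (1 + x ^ 4))"
      using 1 2 unfolding distrib_right by linarith
    then show "\<bar>smooth b (sqrt n) (distr M borel (\<lambda>m. \<Sum>i<n. trunc (sqrt n) (X i m))) x - std_normal_density x\<bar>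
        \<le> C * n powr (- \<delta> / 2) / (1 + x ^ 4)"
      by (simp add: C_def \<nu>_def T_def)
  qed
qed

lemma cost_kern_moment:
  assumes b: "0 < b" and \<delta>: "0 < \<delta>" "\<delta> \<le> 1"
  obtains K where "0 \<le> K" "(\<integral>\<^sup>+ u. ennreal (cost \<delta> u) \<partial>kern_law b) = ennreal K"
proof -
  have km: "0 < kern_mass b" by (rule kern_mass_pos[OF b])
  have i: "integrable lborel (\<lambda>u. cost \<delta> u * kern b u)"
  proof (rule integrable_kern_le[where K = 4])
    show "\<bar>cost \<delta> y\<bar> \<le> 4 * (1 + \<bar>y\<bar> ^ 5)" for y
    proof -
      have "y\<^sup>2 \<le> 1 + \<bar>y\<bar> ^ 5"
      proof (cases "\<bar>y\<bar> \<le> 1")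
        case True
        then have "y\<^sup>2 \<le> 1" by (simp add: abs_square_le_1)
        then show ?thesis by (simp add: add_increasing2)
      next
        case False
        then have "\<bar>y\<bar> ^ 2 \<le> \<bar>y\<bar> ^ 5" by (intro power_increasing) auto
        then show ?thesis by simp
      qed
      moreover have "c \<le> 4 * (1 + p)" if "t \<le> 1 + p" "0 \<le> p" "c \<le> 2 * (1 + t)" for c p t :: real
        using that by (simp add: algebra_simps)
      ultimately show ?thesis
        using cost_le[OF \<delta>, of y] zero_le_power[OF abs_ge_zero[of y], of 5]
        unfolding abs_of_nonneg[OF cost_nonneg] by blast
    qed
  qed (use b in auto)
  have "(\<integral>\<^sup>+ u. ennreal (cost \<delta> u) \<partial>kern_law b) = (\<integral>\<^sup>+ u. ennreal (cost \<delta> u * kern b u / kern_mass b) \<partial>lborel)"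
    unfolding kern_law_def using km
    by (subst nn_integral_density) (auto simp: ennreal_mult'[symmetric] mult.commute intro!: nn_integral_cong)
  also have "\<dots> = ennreal (\<integral>u. cost \<delta> u * kern b u / kern_mass b \<partial>lborel)"
    using i km by (intro nn_integral_eq_integral) auto
  finally show ?thesis
    using km by (intro that) (auto intro!: integral_nonneg_AE)
qed

text \<open>The cost is at most 2 (1 + x^2), and (1 + x^2)^2 \<le> 2 (1 + x^4). So a density error
  with weight 1/(1 + x^4) has a finite total cost.\<close>

lemma cost_over_quartic_le:
  assumes \<delta>: "0 < \<delta>" "\<delta> \<le> 1"
  shows "cost \<delta> x / (1 + x ^ 4) \<le> 4 * (1 / (1 + x\<^sup>2))"
proof -
  have p: "0 < 1 + x ^ 4" "0 < 1 + x\<^sup>2" by (simp_all add: add_pos_nonneg)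
  have "(1 + x\<^sup>2) * (1 + x\<^sup>2) \<le> 2 * (1 + x ^ 4)"
    using zero_le_power2[of "x\<^sup>2 - 1"] by (simp add: power2_eq_square algebra_simps eval_nat_numeral)
  then have "2 * ((1 + x\<^sup>2) * (1 + x\<^sup>2)) \<le> 2 * (2 * (1 + x ^ 4))"
    by (rule mult_left_mono) simp
  moreover have "cost \<delta> x * (1 + x\<^sup>2) \<le> 2 * (1 + x\<^sup>2) * (1 + x\<^sup>2)"
    using cost_le[OF \<delta>] p by (intro mult_right_mono) auto
  moreover have "c \<le> 4 * s" if "2 * (t * t) \<le> 2 * (2 * s)" "c \<le> 2 * t * t" for c s t :: real
    using that by simp
  ultimately have "cost \<delta> x * (1 + x\<^sup>2) \<le> 4 * (1 + x ^ 4)" by blast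
  then show ?thesis using p by (simp add: divide_le_eq le_divide_eq mult.commute)
qed

text \<open>Each of the n pieces has moments of order n^(-1 - \<delta>/2), with total q = L
  n^(-\<delta>/2). The \<delta> part of the cost is subadditive and contributes q; the square
  contributes q plus the squared sum of the means, at most q^2 \<le> L q.\<close>

lemma (in prob_space) excess_sum_cost:
  assumes ind: "indep_vars (\<lambda>_. borel) X (UNIV :: nat set)"
    and same: "\<And>i. distr M borel (X i) = distr M borel (X 0)" and step: "normalised_step M (X 0) \<delta>"
    and n: "1 \<le> n"
  shows "(\<integral>\<^sup>+ m. ennreal (cost \<delta> (\<Sum>i<n. excess (sqrt n) (X i m))) \<partial>M)
    \<le> ennreal ((2 * normalised_step.L M (X 0) \<delta> + (normalised_step.L M (X 0) \<delta>)\<^sup>2) * n powr (- \<delta> / 2))"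
proof -
  interpret step: normalised_step M "X 0" \<delta> by fact
  let ?L = "step.L"
  have [measurable]: "X i \<in> borel_measurable M" for i
    using ind by (auto simp: indep_vars_def)
  define T where "T = sqrt n"
  have T: "1 \<le> T" "0 < T" using n by (simp_all add: T_def)
  define W where "W i m = excess T (X i m)" for i m
  define R where "R m = (\<Sum>i<n. W i m)" for m
  define e where "e = ?L / T powr (2 + \<delta>)"
  have [measurable]: "W i \<in> borel_measurable M" for i unfolding W_def by measurable
  have mom: "integrable M (\<lambda>m. f (W i m)) = integrable M (\<lambda>m. f (excess T (X 0 m)))"
    "expectation (\<lambda>m. f (W i m)) = expectation (\<lambda>m. f (excess T (X 0 m)))"
    if [measurable]: "f \<in> borel_measurable borel" for i and f :: "real \<Rightarrow> real"
  proof -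
    have "integrable (distr M borel (X i)) (\<lambda>x. f (excess T x)) = integrable M (\<lambda>m. f (excess T (X i m)))" for i
      by (rule integrable_distr_eq) auto
    moreover have "(\<integral>x. f (excess T x) \<partial>distr M borel (X i)) = expectation (\<lambda>m. f (excess T (X i m)))" for i
      by (rule integral_distr) auto
    ultimately show "integrable M (\<lambda>m. f (W i m)) = integrable M (\<lambda>m. f (excess T (X 0 m)))"
      "expectation (\<lambda>m. f (W i m)) = expectation (\<lambda>m. f (excess T (X 0 m)))"
      unfolding W_def using same[of i] by metis+
  qed
  have W1: "integrable M (W i)" "\<bar>expectation (W i)\<bar> \<le> e" for i
    using mom[of "\<lambda>x. x" i] step.excess_moments(1,2)[OF T(2)] by (simp_all add: e_def)
  have W2: "integrable M (\<lambda>m. (W i m)\<^sup>2)" "expectation (\<lambda>m. (W i m)\<^sup>2) \<le> e" for i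
    using mom[of "\<lambda>x. x\<^sup>2" i] step.excess_moments(3,4)[OF T(2)] by (simp_all add: e_def)
  have Wd: "integrable M (\<lambda>m. \<bar>W i m\<bar> powr \<delta>)" "expectation (\<lambda>m. \<bar>W i m\<bar> powr \<delta>) \<le> e" for i
    using mom[of "\<lambda>x. \<bar>x\<bar> powr \<delta>" i] step.excess_moments(5,6)[OF T(2)] by (simp_all add: e_def)
  have e0: "0 \<le> e" using step.L_nonneg by (simp add: e_def)
  have "indep_vars (\<lambda>_. borel) (\<lambda>i m. excess T (X i m)) UNIV"
    by (rule indep_vars_compose2[OF ind]) simp
  then have indW: "indep_vars (\<lambda>_. borel) W {..<n}"
    unfolding W_def[abs_def] by (rule indep_vars_subset) simp
  note sq = expectation_sum_square_le[OF _ indW W1(1) W2(1), simplified]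
  have iRd: "integrable M (\<lambda>m. \<Sum>i<n. \<bar>W i m\<bar> powr \<delta>)" using Wd by auto
  have icost: "integrable M (\<lambda>m. (\<Sum>i<n. \<bar>W i m\<bar> powr \<delta>) + (R m)\<^sup>2)"
    using iRd sq(1) by (simp add: R_def)
  have "(\<integral>\<^sup>+ m. ennreal (cost \<delta> (R m)) \<partial>M) \<le> (\<integral>\<^sup>+ m. ennreal ((\<Sum>i<n. \<bar>W i m\<bar> powr \<delta>) + (R m)\<^sup>2) \<partial>M)"
    unfolding cost_def R_def using step.delta
    by (intro nn_integral_mono ennreal_leI add_mono abs_sum_powr_le) auto
  also have "\<dots> = ennreal (expectation (\<lambda>m. (\<Sum>i<n. \<bar>W i m\<bar> powr \<delta>) + (R m)\<^sup>2))"
    by (intro nn_integral_eq_integral icost) (auto intro!: add_nonneg_nonneg sum_nonneg)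
  also have "\<dots> \<le> ennreal ((2 * ?L + ?L\<^sup>2) * n powr (- \<delta> / 2))"
  proof (rule ennreal_leI)
    define q where "q = real n * e"
    have q: "q = ?L * n powr (- \<delta> / 2)"
    proof -
      have "T powr (2 + \<delta>) = n * n powr (\<delta> / 2)"
      proof -
        have "T powr (2 + \<delta>) = real n powr (1 + \<delta> / 2)"
          using n unfolding T_def by (simp add: powr_half_sqrt[symmetric] powr_powr add_divide_distrib)
        then show ?thesis using n by (simp add: powr_add)
      qed
      then show ?thesis
        using n powr_minus_divide[of "real n" "\<delta> / 2"] by (simp add: q_def e_def)
    qed
    have "expectation (\<lambda>m. (\<Sum>i<n. \<bar>W i m\<bar> powr \<delta>) + (R m)\<^sup>2)
        = (\<Sum>i<n. expectation (\<lambda>m. \<bar>W i m\<bar> powr \<delta>)) + expectation (\<lambda>m. (R m)\<^sup>2)"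
      using iRd sq(1) Wd by (simp add: R_def)
    also have "\<dots> \<le> (\<Sum>i<n. e) + ((\<Sum>i<n. e) + (\<Sum>i<n. e)\<^sup>2)"
    proof (intro add_mono sum_mono Wd)
      have "expectation (\<lambda>m. (R m)\<^sup>2) \<le> (\<Sum>i<n. expectation (\<lambda>x. (W i x)\<^sup>2)) + (\<Sum>i<n. \<bar>expectation (W i)\<bar>)\<^sup>2"
        using sq(2) by (simp add: R_def)
      also have "\<dots> \<le> (\<Sum>i<n. e) + (\<Sum>i<n. e)\<^sup>2"
        by (intro add_mono sum_mono W2 power_mono W1 sum_nonneg) auto
      finally show "expectation (\<lambda>m. (R m)\<^sup>2) \<le> (\<Sum>i<n. e) + (\<Sum>i<n. e)\<^sup>2" .
    qed
    also have "\<dots> = 2 * q + q * q" by (simp add: q_def power2_eq_square)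
    also have "\<dots> \<le> 2 * q + ?L * q"
    proof -
      have "n powr (- \<delta> / 2) \<le> 1" using n step.delta powr_mono[of "- \<delta> / 2" 0 "real n"] by simp
      then have "q \<le> ?L" unfolding q using step.L_nonneg by (simp add: mult_left_le)
      then show ?thesis using e0 by (intro add_left_mono mult_right_mono) (auto simp: q_def)
    qed
    also have "\<dots> = (2 * ?L + ?L\<^sup>2) * n powr (- \<delta> / 2)"
      unfolding q by (simp add: power2_eq_square algebra_simps)
    finally show "expectation (\<lambda>m. (\<Sum>i<n. \<bar>W i m\<bar> powr \<delta>) + (R m)\<^sup>2) \<le> (2 * ?L + ?L\<^sup>2) * n powr (- \<delta> / 2)" .
  qed
  finally show ?thesis by (simp add: R_def W_def T_def)
qed

text \<open>Y is the sum of the truncated scaled steps minus noise. Then A - Y splits into A minus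
  the normalised walk, the sum of the excesses and the noise, each charged through the weak triangle
  inequality, while the density of Y is compared with the normal one by
  \<open>smoothed_density_close\<close>. A is left free so that the logarithm of the population can
  be inserted.\<close>

lemma clt_coupling:
  assumes M: "prob_space M" and ind: "prob_space.indep_vars M (\<lambda>_. borel) X (UNIV :: nat set)"
    and same: "\<And>i. distr M borel (X i) = distr M borel (X 0)" and step: "normalised_step M (X 0) \<delta>"
  obtains C where "0 < C" "\<And>n A. 1 \<le> n \<Longrightarrow> A \<in> borel_measurable M \<Longrightarrow>
    \<exists>Q\<in>couplings (distr M borel A) std_normal_distribution.
      (\<integral>\<^sup>+ z. ennreal (cost \<delta> (fst z - snd z)) \<partial>Q)
        \<le> ennreal (C * n powr (- \<delta> / 2))
          + 8 * (\<integral>\<^sup>+ m. ennreal (cost \<delta> (A m - (\<Sum>i<n. X i m) / sqrt n)) \<partial>M)"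
proof -
  interpret step: normalised_step M "X 0" \<delta> by fact
  note \<delta> = step.delta
  have [measurable]: "X i \<in> borel_measurable M" for i
    using ind by (auto simp: step.indep_vars_def)
  obtain b C\<^sub>1 and n\<^sub>0 :: nat where b: "0 < b" and C1: "0 < C\<^sub>1" and n0: "0 < n\<^sub>0"
    and close: "\<And>n x. n\<^sub>0 \<le> n \<Longrightarrow>
      \<bar>smooth b (sqrt n) (distr M borel (\<lambda>m. \<Sum>i<n. trunc (sqrt n) (X i m))) x - std_normal_density x\<bar>
        \<le> C\<^sub>1 * n powr (- \<delta> / 2) / (1 + x ^ 4)"
    using smoothed_density_close[OF M ind same step] by blast
  obtain K where K: "0 \<le> K" "(\<integral>\<^sup>+ u. ennreal (cost \<delta> u) \<partial>kern_law b) = ennreal K"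
    using cost_kern_moment[OF b \<delta>] by blast
  define L where "L = 2 * step.L + (step.L)\<^sup>2"
  have L: "0 \<le> L" using step.L_nonneg by (simp add: L_def)
  \<comment> \<open>The first three terms are the costs of the excesses, of the noise and of the
    density difference; the last one makes the bound large enough for all n below
    \<open>n\<^sub>0\<close>.\<close>
  define C where "C = 8 * L + 8 * K + 16 * C\<^sub>1 * pi + 100 * n\<^sub>0 powr (\<delta> / 2)"
  have N: "prob_space std_normal_distribution" by (rule prob_space_normal_density) simp
  interpret N: prob_space std_normal_distribution by (rule N)
  have cauchy: "(\<integral>\<^sup>+ x. ennreal (4 * (1 / (1 + x\<^sup>2))) \<partial>lborel) = ennreal (4 * pi)"
  proof -
    have "(\<integral>x. 1 / (1 + x\<^sup>2) \<partial>lborel) = pi"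
      using LBINT_inverse_1_plus_square
      by (simp add: interval_lebesgue_integral_def einterval_def set_lebesgue_integral_def inverse_eq_divide)
    moreover have "integrable lborel (\<lambda>x :: real. 4 * (1 / (1 + x\<^sup>2)))"
      by (intro integrable_mult_right integrable_inverse_square)
    ultimately show ?thesis
      by (subst nn_integral_eq_integral) (simp_all only: integral_mult_right_zero, auto)
  qed
  have large: "\<exists>Q\<in>couplings (distr M borel A) std_normal_distribution.
      (\<integral>\<^sup>+ z. ennreal (cost \<delta> (fst z - snd z)) \<partial>Q)
        \<le> ennreal (C * n powr (- \<delta> / 2))
          + 8 * (\<integral>\<^sup>+ m. ennreal (cost \<delta> (A m - (\<Sum>i<n. X i m) / sqrt n)) \<partial>M)"
    if n: "n\<^sub>0 \<le> n" and [measurable]: "A \<in> borel_measurable M" for n A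
  proof -
    interpret Kl: prob_space "kern_law b" by (rule prob_space_kern_law[OF b])
    interpret P: pair_sigma_finite M "kern_law b" ..
    interpret MK: prob_space "M \<Otimes>\<^sub>M kern_law b" by (rule prob_space_pair) unfold_locales
    define T where "T = sqrt n"
    have T: "1 \<le> T" using n n0 by (simp add: T_def)
    have n1: "1 \<le> n" using n n0 by simp
    define S where "S m = (\<Sum>i<n. trunc T (X i m))" for m
    define R where "R m = (\<Sum>i<n. excess T (X i m))" for m
    have [measurable]: "S \<in> borel_measurable M" "R \<in> borel_measurable M"
      unfolding S_def R_def by measurable
    have SR: "(\<Sum>i<n. X i m) / T = S m + R m" for m
      by (simp add: S_def R_def sum.distrib[symmetric] trunc_add_excess sum_divide_distrib)
    define f where "f = smooth b T (distr M borel S)"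
    have [measurable]: "f \<in> borel_measurable borel"
      unfolding f_def by (rule measurable_smooth[OF M]) simp
    have f0: "0 \<le> f x" for x
      unfolding f_def smooth_def using T kern_mass_pos[OF b] by (intro mult_nonneg_nonneg integral_nonneg_AE) auto
    define A' Y where "A' z = A (fst z)" and "Y z = S (fst z) - snd z / T" for z :: "'a \<times> real"
    have [measurable]: "A' \<in> borel_measurable (M \<Otimes>\<^sub>M kern_law b)" "Y \<in> borel_measurable (M \<Otimes>\<^sub>M kern_law b)"
      unfolding A'_def Y_def by measurable
    have A': "distr (M \<Otimes>\<^sub>M kern_law b) borel A' = distr M borel A"
      unfolding A'_def using Kl.distr_pair_fst[of M]
      by (subst distr_distr[symmetric, where N = M, unfolded comp_def]) auto
    have Y: "distr (M \<Otimes>\<^sub>M kern_law b) borel Y = density lborel f"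
      unfolding f_def using distr_add_kern[OF M _ b, of S T] T by (simp add: Y_def[abs_def] split_beta')
    have "\<exists>Q\<in>couplings (distr (M \<Otimes>\<^sub>M kern_law b) borel A') std_normal_distribution.
      (\<integral>\<^sup>+ z. ennreal (cost \<delta> (fst z - snd z)) \<partial>Q)
        \<le> 2 * (\<integral>\<^sup>+ z. ennreal (cost \<delta> (A' z - Y z)) \<partial>(M \<Otimes>\<^sub>M kern_law b))
          + 4 * (\<integral>\<^sup>+ x. ennreal \<bar>f x - std_normal_density x\<bar> * ennreal (cost \<delta> x) \<partial>lborel)"
      by (rule maximal_coupling[OF MK.prob_space_axioms _ _ Y _ _ f0 _ nn_integral_std_normal _
            ennreal_cost_add_le[OF \<delta>]]) simp_all
    then obtain Q where Q: "Q \<in> couplings (distr M borel A) std_normal_distribution"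
      "(\<integral>\<^sup>+ z. ennreal (cost \<delta> (fst z - snd z)) \<partial>Q)
        \<le> 2 * (\<integral>\<^sup>+ z. ennreal (cost \<delta> (A' z - Y z)) \<partial>(M \<Otimes>\<^sub>M kern_law b))
          + 4 * (\<integral>\<^sup>+ x. ennreal \<bar>f x - std_normal_density x\<bar> * ennreal (cost \<delta> x) \<partial>lborel)"
      unfolding A' by blast
    define a where "a = (\<integral>\<^sup>+ m. ennreal (cost \<delta> (A m - (\<Sum>i<n. X i m) / sqrt n)) \<partial>M)"
    define p where "p = real n powr (- \<delta> / 2)"
    have p0: "0 \<le> p" by (simp add: p_def)
    have 1: "(\<integral>\<^sup>+ z. ennreal (cost \<delta> (A' z - Y z)) \<partial>(M \<Otimes>\<^sub>M kern_law b)) \<le> 2 * a + 4 * ennreal (L * p) + 4 * ennreal (K * p)"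
    proof -
      have pt: "ennreal (cost \<delta> (A m - (S m - u / T)))
        \<le> 2 * ennreal (cost \<delta> (A m - (\<Sum>i<n. X i m) / sqrt n)) + 4 * ennreal (cost \<delta> (R m)) + 4 * ennreal (p * cost \<delta> u)" for m u
      proof -
        have "cost \<delta> (A m - (S m - u / T)) = cost \<delta> ((A m - (\<Sum>i<n. X i m) / T) + (R m + u / T))"
        proof -
          have "A m - (S m - u / T) = (A m - (\<Sum>i<n. X i m) / T) + (R m + u / T)"
            unfolding SR by simp
          then show ?thesis by (simp only:)
        qed
        also have "\<dots> \<le> 2 * (cost \<delta> (A m - (\<Sum>i<n. X i m) / T) + 2 * (cost \<delta> (R m) + cost \<delta> (u / T)))"
          by (intro order_trans[OF cost_add_le[OF \<delta>]] mult_left_mono add_left_mono cost_add_le[OF \<delta>]) auto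
        also have "cost \<delta> (u / T) \<le> p * cost \<delta> u"
        proof -
          have "T powr (- \<delta>) = p"
            using n1 by (simp add: p_def T_def powr_half_sqrt[symmetric] powr_powr)
          then show ?thesis using cost_divide_le[OF \<delta> T, of u] by simp
        qed
        finally have "cost \<delta> (A m - (S m - u / T))
          \<le> 2 * cost \<delta> (A m - (\<Sum>i<n. X i m) / T) + 4 * cost \<delta> (R m) + 4 * (p * cost \<delta> u)" by simp
        from ennreal_leI[OF this] show ?thesis
          using p0 by (simp add: ennreal_plus ennreal_mult T_def)
      qed
      have "(\<integral>\<^sup>+ z. ennreal (cost \<delta> (A' z - Y z)) \<partial>(M \<Otimes>\<^sub>M kern_law b))
        = (\<integral>\<^sup>+ m. (\<integral>\<^sup>+ u. ennreal (cost \<delta> (A m - (S m - u / T))) \<partial>kern_law b) \<partial>M)"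
        unfolding A'_def Y_def by (subst Kl.nn_integral_fst[symmetric]) auto
      also have "\<dots> \<le> (\<integral>\<^sup>+ m. (\<integral>\<^sup>+ u. 2 * ennreal (cost \<delta> (A m - (\<Sum>i<n. X i m) / sqrt n))
          + 4 * ennreal (cost \<delta> (R m)) + 4 * ennreal (p * cost \<delta> u) \<partial>kern_law b) \<partial>M)"
        by (intro nn_integral_mono pt)
      also have "\<dots> = (\<integral>\<^sup>+ m. 2 * ennreal (cost \<delta> (A m - (\<Sum>i<n. X i m) / sqrt n))
          + 4 * ennreal (cost \<delta> (R m)) + 4 * ennreal (K * p) \<partial>M)"
      proof (rule nn_integral_cong)
        fix m
        have "(\<integral>\<^sup>+ u. 4 * ennreal (p * cost \<delta> u) \<partial>kern_law b) = 4 * ennreal (K * p)"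
          using p0 K by (simp add: nn_integral_cmult ennreal_mult mult.commute)
        then show "(\<integral>\<^sup>+ u. 2 * ennreal (cost \<delta> (A m - (\<Sum>i<n. X i m) / sqrt n))
          + 4 * ennreal (cost \<delta> (R m)) + 4 * ennreal (p * cost \<delta> u) \<partial>kern_law b)
          = 2 * ennreal (cost \<delta> (A m - (\<Sum>i<n. X i m) / sqrt n)) + 4 * ennreal (cost \<delta> (R m)) + 4 * ennreal (K * p)"
          by (subst nn_integral_add) (auto simp: Kl.emeasure_space_1)
      qed
      also have "\<dots> = 2 * a + 4 * (\<integral>\<^sup>+ m. ennreal (cost \<delta> (R m)) \<partial>M) + 4 * ennreal (K * p)"
        unfolding a_def
        by (subst nn_integral_add, simp, simp, subst nn_integral_add)
          (simp_all add: nn_integral_cmult step.emeasure_space_1)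
      also have "\<dots> \<le> 2 * a + 4 * ennreal (L * p) + 4 * ennreal (K * p)"
        using step.excess_sum_cost[OF ind same step n1]
        by (intro add_mono mult_left_mono) (auto simp: R_def T_def L_def p_def)
      finally show ?thesis .
    qed
    have 2: "(\<integral>\<^sup>+ x. ennreal \<bar>f x - std_normal_density x\<bar> * ennreal (cost \<delta> x) \<partial>lborel) \<le> ennreal (4 * C\<^sub>1 * pi * p)"
    proof -
      have "(\<integral>\<^sup>+ x. ennreal \<bar>f x - std_normal_density x\<bar> * ennreal (cost \<delta> x) \<partial>lborel)
        \<le> (\<integral>\<^sup>+ x. ennreal (C\<^sub>1 * p) * ennreal (4 * (1 / (1 + x\<^sup>2))) \<partial>lborel)"
      proof (rule nn_integral_mono)
        fix x
        have "\<bar>f x - std_normal_density x\<bar> * cost \<delta> x \<le> C\<^sub>1 * p / (1 + x ^ 4) * cost \<delta> x"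
          using close[OF n, of x] unfolding f_def S_def T_def p_def by (intro mult_right_mono) auto
        also have "\<dots> = C\<^sub>1 * p * (cost \<delta> x / (1 + x ^ 4))" by simp
        also have "\<dots> \<le> C\<^sub>1 * p * (4 * (1 / (1 + x\<^sup>2)))"
          using C1 p0 by (intro mult_left_mono cost_over_quartic_le \<delta>) auto
        finally have "\<bar>f x - std_normal_density x\<bar> * cost \<delta> x \<le> C\<^sub>1 * p * (4 * (1 / (1 + x\<^sup>2)))" .
        from ennreal_leI[OF this]
        show "ennreal \<bar>f x - std_normal_density x\<bar> * ennreal (cost \<delta> x) \<le> ennreal (C\<^sub>1 * p) * ennreal (4 * (1 / (1 + x\<^sup>2)))"
          using C1 p0 by (simp add: ennreal_mult'[symmetric] ennreal_mult''[symmetric])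
      qed
      also have "\<dots> = ennreal (C\<^sub>1 * p) * ennreal (4 * pi)"
        by (subst nn_integral_cmult) (simp_all only: cauchy, measurable)
      also have "\<dots> = ennreal (4 * C\<^sub>1 * pi * p)"
        using C1 p0 by (simp add: ennreal_mult'[symmetric] mult_ac)
      finally show ?thesis .
    qed
    have "(\<integral>\<^sup>+ z. ennreal (cost \<delta> (fst z - snd z)) \<partial>Q)
        \<le> 2 * (2 * a + 4 * ennreal (L * p) + 4 * ennreal (K * p)) + 4 * ennreal (4 * C\<^sub>1 * pi * p)"
      by (rule order_trans[OF Q(2)]) (intro add_mono mult_left_mono 1 2, auto)
    also have "\<dots> = 4 * a + ennreal ((8 * L + 8 * K + 16 * C\<^sub>1 * pi) * p)"
      using L K C1 p0
      by (simp add: distrib_left distrib_right ennreal_plus ennreal_mult mult.assoc[symmetric] add.assoc)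
    also have "\<dots> \<le> 8 * a + ennreal (C * p)"
      using p0 by (intro add_mono mult_right_mono ennreal_leI) (auto simp: C_def)
    finally show ?thesis using Q(1) unfolding a_def p_def by (auto simp: add.commute)
  qed
  have small: "\<exists>Q\<in>couplings (distr M borel A) std_normal_distribution.
      (\<integral>\<^sup>+ z. ennreal (cost \<delta> (fst z - snd z)) \<partial>Q)
        \<le> ennreal (C * n powr (- \<delta> / 2))
          + 8 * (\<integral>\<^sup>+ m. ennreal (cost \<delta> (A m - (\<Sum>i<n. X i m) / sqrt n)) \<partial>M)"
    if n: "1 \<le> n" "n < n\<^sub>0" and A [measurable]: "A \<in> borel_measurable M" for n A
  proof -
    define T where "T = sqrt n"
    have T: "1 \<le> T" using n by (simp add: T_def)
    define a where "a = (\<integral>\<^sup>+ m. ennreal (cost \<delta> (A m - (\<Sum>i<n. X i m) / sqrt n)) \<partial>M)"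
    define s where "s = (\<integral>\<^sup>+ m. ennreal (cost \<delta> ((\<Sum>i<n. X i m) / sqrt n)) \<partial>M)"
    have mom: "integrable M (\<lambda>m. f (X i m)) = integrable M (\<lambda>m. f (X 0 m))"
      "step.expectation (\<lambda>m. f (X i m)) = step.expectation (\<lambda>m. f (X 0 m))"
      if [measurable]: "f \<in> borel_measurable borel" for i and f :: "real \<Rightarrow> real"
    proof -
      have "integrable (distr M borel (X i)) f = integrable M (\<lambda>m. f (X i m))" for i
        by (rule integrable_distr_eq) auto
      moreover have "integral\<^sup>L (distr M borel (X i)) f = step.expectation (\<lambda>m. f (X i m))" for i
        by (rule integral_distr) auto
      ultimately show "integrable M (\<lambda>m. f (X i m)) = integrable M (\<lambda>m. f (X 0 m))"
        "step.expectation (\<lambda>m. f (X i m)) = step.expectation (\<lambda>m. f (X 0 m))"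
        using same[of i] by metis+
    qed
    have X1: "integrable M (X i)" "step.expectation (X i) = 0" for i
      using mom[of "\<lambda>x. x" i] step.integrable_X step.mean by auto
    have X2: "integrable M (\<lambda>m. (X i m)\<^sup>2)" "step.expectation (\<lambda>m. (X i m)\<^sup>2) = 1" for i
      using mom[of "\<lambda>x. x\<^sup>2" i] step.integrable_square step.var by auto
    have "step.indep_vars (\<lambda>_. borel) X {..<n}"
      using ind by (rule step.indep_vars_subset) simp
    note sq = step.expectation_sum_square_le[OF _ this X1(1) X2(1), simplified X1 X2, simplified]
    have "s \<le> (\<integral>\<^sup>+ m. ennreal (2 * (1 + (\<Sum>i<n. X i m)\<^sup>2 / n)) \<partial>M)"
      unfolding s_def using cost_le[OF \<delta>, of "_ / sqrt n"]
      by (intro nn_integral_mono ennreal_leI) (simp add: power_divide)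
    also have "\<dots> = ennreal (step.expectation (\<lambda>m. 2 * (1 + (\<Sum>i<n. X i m)\<^sup>2 / n)))"
      using sq(1) by (intro nn_integral_eq_integral) auto
    also have "\<dots> \<le> ennreal 4"
    proof (rule ennreal_leI)
      have "step.expectation (\<lambda>m. 2 * (1 + (\<Sum>i<n. X i m)\<^sup>2 / n)) = 2 * (1 + step.expectation (\<lambda>m. (\<Sum>i<n. X i m)\<^sup>2) / n)"
        using sq(1) by (simp add: step.prob_space)
      also have "step.expectation (\<lambda>m. (\<Sum>i<n. X i m)\<^sup>2) / n \<le> 1" using sq(2) n by simp
      finally show "step.expectation (\<lambda>m. 2 * (1 + (\<Sum>i<n. X i m)\<^sup>2 / n)) \<le> 4" by simp
    qed
    finally have s: "s \<le> 4" by simp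
    have cN: "(\<integral>\<^sup>+ x. ennreal (cost \<delta> x) \<partial>std_normal_distribution) \<le> 4"
    proof -
      have i2: "integrable std_normal_distribution (\<lambda>x. x\<^sup>2)"
        by (rule integrable_std_normal_distribution_moment)
      have "(\<integral>\<^sup>+ x. ennreal (cost \<delta> x) \<partial>std_normal_distribution) \<le> (\<integral>\<^sup>+ x. ennreal (2 * (1 + x\<^sup>2)) \<partial>std_normal_distribution)"
        by (intro nn_integral_mono ennreal_leI cost_le \<delta>)
      also have "\<dots> = ennreal (N.expectation (\<lambda>x. 2 * (1 + x\<^sup>2)))"
        using i2 by (intro nn_integral_eq_integral) auto
      also have "N.expectation (\<lambda>x. 2 * (1 + x\<^sup>2)) = 2 * (1 + N.expectation (\<lambda>x. x\<^sup>2))"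
        using i2 N.prob_space by simp
      also have "N.expectation (\<lambda>x. x\<^sup>2) = 1"
        using std_normal_distribution_even_moments(1)[of 1] by (simp add: fact_numeral)
      finally show ?thesis by simp
    qed
    have cA: "(\<integral>\<^sup>+ m. ennreal (cost \<delta> (A m)) \<partial>M) \<le> 2 * (a + s)"
    proof -
      have "(\<integral>\<^sup>+ m. ennreal (cost \<delta> (A m)) \<partial>M)
        \<le> (\<integral>\<^sup>+ m. 2 * (ennreal (cost \<delta> (A m - (\<Sum>i<n. X i m) / sqrt n)) + ennreal (cost \<delta> ((\<Sum>i<n. X i m) / sqrt n))) \<partial>M)"
      proof (rule nn_integral_mono)
        fix m
        show "ennreal (cost \<delta> (A m)) \<le> 2 * (ennreal (cost \<delta> (A m - (\<Sum>i<n. X i m) / sqrt n)) + ennreal (cost \<delta> ((\<Sum>i<n. X i m) / sqrt n)))"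
          using ennreal_cost_add_le[OF \<delta>, of "A m - (\<Sum>i<n. X i m) / sqrt n" "(\<Sum>i<n. X i m) / sqrt n"] by simp
      qed
      also have "\<dots> = 2 * (a + s)"
        unfolding a_def s_def by (subst nn_integral_cmult, simp, subst nn_integral_add) simp_all
      finally show ?thesis .
    qed
    obtain Q where Q: "Q \<in> couplings (distr M borel A) std_normal_distribution"
      "(\<integral>\<^sup>+ z. ennreal (cost \<delta> (fst z - snd z)) \<partial>Q)
        \<le> 4 * (\<integral>\<^sup>+ m. ennreal (cost \<delta> (A m)) \<partial>M) + 4 * (\<integral>\<^sup>+ x. ennreal (cost \<delta> x) \<partial>std_normal_distribution)"
      using independent_coupling[OF M A \<delta>] by blast
    note Q(2)
    also have "4 * (\<integral>\<^sup>+ m. ennreal (cost \<delta> (A m)) \<partial>M) + 4 * (\<integral>\<^sup>+ x. ennreal (cost \<delta> x) \<partial>std_normal_distribution)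
      \<le> 4 * (2 * (a + 4)) + 4 * 4"
      using cN order_trans[OF cA mult_left_mono[OF add_left_mono[OF s, of a], of 2]]
      by (intro add_mono mult_left_mono) auto
    \<comment> \<open>48 = 4 * 2 * 4 + 4 * 4: by their unit second moments the normalised walk and
      the normal law each have expected cost at most 4.\<close>
    also have "\<dots> = 8 * a + ennreal 48"
      by (simp add: distrib_left mult.assoc[symmetric] add.assoc)
    also have "\<dots> \<le> 8 * a + ennreal (C * n powr (- \<delta> / 2))"
    proof (intro add_left_mono ennreal_leI)
      have "n powr (\<delta> / 2) \<le> n\<^sub>0 powr (\<delta> / 2)" using n \<delta> by (intro powr_mono2) auto
      then have "1 \<le> n\<^sub>0 powr (\<delta> / 2) / n powr (\<delta> / 2)" using n by simp
      then have "1 \<le> n\<^sub>0 powr (\<delta> / 2) * n powr (- \<delta> / 2)"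
        using powr_minus_divide[of "real n" "\<delta> / 2"] by simp
      then have "48 \<le> 100 * (n\<^sub>0 powr (\<delta> / 2) * n powr (- \<delta> / 2))" by simp
      also have "\<dots> = (100 * n\<^sub>0 powr (\<delta> / 2)) * n powr (- \<delta> / 2)" by simp
      also have "\<dots> \<le> C * n powr (- \<delta> / 2)"
        using L K C1 by (intro mult_right_mono) (auto simp: C_def)
      finally show "48 \<le> C * n powr (- \<delta> / 2)" .
    qed
    finally show ?thesis using Q(1) unfolding a_def by (auto simp: add.commute)
  qed
  show ?thesis
  proof (rule that[of C])
    show "0 < C" using L K C1 n0 by (simp add: C_def add_nonneg_pos)
    show "\<exists>Q\<in>couplings (distr M borel A) std_normal_distribution.
      (\<integral>\<^sup>+ z. ennreal (cost \<delta> (fst z - snd z)) \<partial>Q)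
        \<le> ennreal (C * n powr (- \<delta> / 2))
          + 8 * (\<integral>\<^sup>+ m. ennreal (cost \<delta> (A m - (\<Sum>i<n. X i m) / sqrt n)) \<partial>M)"
      if "1 \<le> n" "A \<in> borel_measurable M" for n A
      using large[of n A] small[of n A] that by (cases "n\<^sub>0 \<le> n") auto
  qed
qed

section \<open>One generation of the branching process\<close>

text \<open>Quadratic for small and linear for large deviations: the expectation is finite as soon
  as the mean exists, yet it still decays with the sample size under a moment of order q in (1,
  2].\<close>

definition dev :: "real \<Rightarrow> real" where
  "dev d = min (d\<^sup>2) \<bar>d\<bar>"

lemma dev_nonneg: "0 \<le> dev d" by (simp add: dev_def)

text \<open>The larger summand decides: the sum is at most twice it in modulus, and the square is
  used if it is a, the modulus if it is b.\<close>

lemma dev_add_le: "dev (a + b) \<le> 4 * a\<^sup>2 + 2 * \<bar>b\<bar>"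
proof (cases "\<bar>a\<bar> \<le> \<bar>b\<bar>")
  case True
  then have "\<bar>a + b\<bar> \<le> 2 * \<bar>b\<bar>" by linarith
  then show ?thesis unfolding dev_def by (smt (verit) zero_le_power2)
next
  case False
  then have "\<bar>a + b\<bar> \<le> \<bar>2 * a\<bar>" by linarith
  then have "(a + b)\<^sup>2 \<le> (2 * a)\<^sup>2" by (rule abs_le_square_iff[THEN iffD1])
  then have "(a + b)\<^sup>2 \<le> 4 * a\<^sup>2" by (simp add: power_mult_distrib)
  then show ?thesis unfolding dev_def by (smt (verit) abs_ge_zero)
qed

text \<open>On R \<ge> 1/2 the logarithm is Lipschitz around 1, which gives the quadratic bound; for
  R > 2 the identity ln R = 2 ln (sqrt R) gives the linear one. Below 1/2 the hypothesis 1/m \<le> R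
  caps |ln R| by ln m while \<open>dev\<close> is at least 1/4. In the application 1/m \<le> R says
  that no generation is smaller than the one before.\<close>

lemma ln_square_le_dev:
  assumes "1 \<le> m" "1 / m \<le> R"
  shows "(ln R)\<^sup>2 \<le> 4 * (1 + (ln m)\<^sup>2) * dev (R - 1)"
proof -
  have R: "0 < R" using assms by (smt (verit) divide_pos_pos)
  have k: "1 * dev (R - 1) \<le> (1 + (ln m)\<^sup>2) * dev (R - 1)"
    by (intro mult_right_mono dev_nonneg) auto
  show ?thesis
  proof (cases "1 / 2 \<le> R")
    case True
    have l: "\<bar>ln R\<bar> \<le> 2 * \<bar>R - 1\<bar>"
    proof (cases "1 \<le> R")
      case True
      then show ?thesis using ln_le_minus_one[OF R] by simp
    next
      case False
      have "ln (1 / R) \<le> 1 / R - 1" using R by (intro ln_le_minus_one) auto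
      also have "\<dots> = (1 - R) / R" using R by (simp add: field_simps)
      also have "\<dots> \<le> (1 - R) / (1 / 2)" using True False by (intro divide_left_mono) auto
      finally have "- ln R \<le> 2 * (1 - R)" using R by (simp add: ln_div)
      then show ?thesis using False R by (simp add: ln_less_zero abs_if)
    qed
    have 1: "(ln R)\<^sup>2 \<le> 4 * (R - 1)\<^sup>2"
    proof -
      have "\<bar>ln R\<bar>\<^sup>2 \<le> (2 * \<bar>R - 1\<bar>)\<^sup>2" using l by (intro power_mono) auto
      then show ?thesis by (simp add: power_mult_distrib)
    qed
    have 2: "(ln R)\<^sup>2 \<le> 4 * \<bar>R - 1\<bar>"
    proof (cases "R \<le> 2")
      case True
      then have "\<bar>R - 1\<bar> \<le> 1" using \<open>1 / 2 \<le> R\<close> by auto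
      then have "\<bar>R - 1\<bar> * \<bar>R - 1\<bar> \<le> \<bar>R - 1\<bar> * 1" by (intro mult_left_mono) auto
      then have "(R - 1)\<^sup>2 \<le> \<bar>R - 1\<bar>" by (simp add: power2_eq_square)
      then have "4 * (R - 1)\<^sup>2 \<le> 4 * \<bar>R - 1\<bar>" by (rule mult_left_mono) simp
      with 1 show ?thesis by (rule order_trans)
    next
      case False
      define t where "t = sqrt R"
      have t: "1 \<le> t" "t * t = R" "0 < t" using False R by (simp_all add: t_def)
      have "ln R = 2 * ln t" using t by (metis ln_mult_pos mult_2)
      moreover have "0 \<le> ln t" "ln t \<le> t - 1" using t ln_le_minus_one by auto
      then have "(ln t)\<^sup>2 \<le> (t - 1)\<^sup>2" by (intro power_mono)
      moreover have "(t - 1)\<^sup>2 \<le> R - 1"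
        using t by (simp add: power2_eq_square algebra_simps)
      ultimately show ?thesis using False by (simp add: power_mult_distrib)
    qed
    have "(ln R)\<^sup>2 \<le> 4 * dev (R - 1)" using 1 2 by (simp add: dev_def)
    also have "\<dots> \<le> 4 * ((1 + (ln m)\<^sup>2) * dev (R - 1))"
      using k by (intro mult_left_mono) auto
    finally show ?thesis unfolding mult.assoc .
  next
    case False
    have "\<bar>ln R\<bar> \<le> ln m"
    proof -
      have "ln (1 / m) \<le> ln R" using assms R by (subst ln_le_cancel_iff) auto
      then have "- ln m \<le> ln R" using assms by (simp add: ln_div)
      moreover have "ln R < 0" using False R by (intro ln_less_zero) auto
      ultimately show ?thesis by simp
    qed
    then have 1: "(ln R)\<^sup>2 \<le> (ln m)\<^sup>2"
      using power_mono[of "\<bar>ln R\<bar>" "ln m" 2] by simp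
    have "1 / 4 \<le> dev (R - 1)"
    proof -
      have "(1 / 2)\<^sup>2 \<le> \<bar>R - 1\<bar>\<^sup>2" using False by (intro power_mono) auto
      then have "1 / 4 \<le> (R - 1)\<^sup>2" by (simp add: power_divide)
      moreover have "1 / 4 \<le> \<bar>R - 1\<bar>" using False by simp
      ultimately show ?thesis by (simp add: dev_def)
    qed
    then have "4 * (1 + (ln m)\<^sup>2) * (1 / 4) \<le> 4 * (1 + (ln m)\<^sup>2) * dev (R - 1)"
      by (intro mult_left_mono) auto
    then show ?thesis using 1 by simp
  qed
qed

text \<open>Lowering the exponent to t weakens the rate, but then only a small power of the
  offspring moment has to be integrated over the environment, as the hypotheses with exponent c
  allow.\<close>

lemma min_one_le_powr:
  assumes "0 \<le> (x :: real)" "0 < t" "t \<le> 1"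
  shows "min 1 x \<le> x powr t"
proof (cases "x \<le> 1")
  case True
  show ?thesis
  proof (cases "x = 0")
    case False
    then have "x powr 1 \<le> x powr t" using True assms by (intro powr_mono') auto
    then show ?thesis using assms False by simp
  qed simp
next
  case False
  then have "1 \<le> x powr t" using assms by (intro ge_one_powr_ge_zero) auto
  then show ?thesis by simp
qed

text \<open>The truncation at the sample size turns the moment of order \<open>q\<close> into a weak law of large
  numbers with a rate.\<close>

lemma (in prob_space) iid_mean_dev_le:
  fixes Y :: "'i \<Rightarrow> 'a \<Rightarrow> real"
  assumes I: "finite I" "I \<noteq> {}" and ind: "indep_vars (\<lambda>_. borel) Y I"
    and same: "\<And>i. i \<in> I \<Longrightarrow> distr M borel (Y i) = \<mu>"
    and nonneg: "AE y in \<mu>. 0 \<le> y" and q: "1 < q" "q \<le> 2"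
    and int: "integrable \<mu> (\<lambda>y. y)" and mean: "(\<integral>y. y \<partial>\<mu>) = 1"
    and Mq: "integrable \<mu> (\<lambda>y. y powr q)"
  defines "z \<equiv> real (card I)"
  shows "integrable M (\<lambda>x. dev ((\<Sum>i\<in>I. Y i x) / z - 1))"
    and "expectation (\<lambda>x. dev ((\<Sum>i\<in>I. Y i x) / z - 1)) \<le> 8 * min 1 (z powr (1 - q) * (\<integral>y. y powr q \<partial>\<mu>))"
proof -
  obtain i0 where i0: "i0 \<in> I" using I by blast
  have rv: "Y i \<in> borel_measurable M" if "i \<in> I" for i
    using ind that by (auto simp: indep_vars_def)
  have \<mu>: "prob_space \<mu>" using same[OF i0] rv[OF i0] by (metis prob_space_distr)
  interpret \<mu>: prob_space \<mu> by fact
  have [measurable_cong]: "sets \<mu> = sets borel" using same[OF i0] by (metis sets_distr)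
  have z: "1 \<le> z" using I by (simp add: z_def Suc_le_eq card_gt_0_iff)
  have ifI: "integrable M (\<lambda>x. f (Y i x)) = integrable \<mu> f" "expectation (\<lambda>x. f (Y i x)) = (\<integral>y. f y \<partial>\<mu>)"
    if "i \<in> I" and f: "f \<in> borel_measurable borel" for i and f :: "real \<Rightarrow> real"
    unfolding same[OF that(1), symmetric] using rv[OF that(1)] f
    by (simp_all add: integrable_distr_eq integral_distr)
  define K where "K = (\<integral>y. y powr q \<partial>\<mu>)"
  define lo hi where "lo y = (if y \<le> z then y else 0)" and "hi y = (if y \<le> z then 0 else y)" for y
  have [measurable]: "lo \<in> borel_measurable borel" "hi \<in> borel_measurable borel"
    unfolding lo_def hi_def by measurable
  have lohi: "lo y + hi y = y" for y by (simp add: lo_def hi_def)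
  have ihi: "integrable \<mu> hi" "integrable \<mu> lo"
    by (rule Bochner_Integration.integrable_bound[OF int]; auto simp: lo_def hi_def)+
  \<comment> \<open>For y \<le> z the factor y^(2 - q) is at most z^(2 - q), and for y > z the
    factor y^(1 - q) is at most z^(1 - q): these powers govern the variance of the small part and
    the mean of the large part.\<close>
  have lo2: "(lo y)\<^sup>2 \<le> z powr (2 - q) * y powr q" if "0 \<le> y" for y
  proof (cases "0 < y \<and> y \<le> z")
    case True
    have "y\<^sup>2 = y powr (2 - q) * y powr q" using True by (simp add: powr_add[symmetric])
    also have "\<dots> \<le> z powr (2 - q) * y powr q"
      using True q by (intro mult_right_mono powr_mono2) auto
    finally show ?thesis using True by (simp add: lo_def)
  qed (use that in \<open>auto simp: lo_def\<close>)
  have hi1: "hi y \<le> z powr (1 - q) * y powr q" if "0 \<le> y" for y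
  proof (cases "z < y")
    case True
    then have y: "0 < y" using z by simp
    have "y = y powr (1 - q) * y powr q" using y by (simp add: powr_add[symmetric])
    also have "\<dots> \<le> z powr (1 - q) * y powr q"
      using True z q by (intro mult_right_mono powr_mono2') auto
    finally show ?thesis using True by (simp add: hi_def)
  qed (use that in \<open>auto simp: hi_def\<close>)
  have ilo2: "integrable \<mu> (\<lambda>y. (lo y)\<^sup>2)"
  proof (rule Bochner_Integration.integrable_bound)
    show "integrable \<mu> (\<lambda>y. z powr (2 - q) * y powr q)" using Mq by simp
    show "AE y in \<mu>. norm ((lo y)\<^sup>2) \<le> norm (z powr (2 - q) * y powr q)"
      using nonneg by eventually_elim (use lo2 in auto)
  qed measurable
  have Elo2: "(\<integral>y. (lo y)\<^sup>2 \<partial>\<mu>) \<le> z powr (2 - q) * K"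
  proof -
    have "(\<integral>y. (lo y)\<^sup>2 \<partial>\<mu>) \<le> (\<integral>y. z powr (2 - q) * y powr q \<partial>\<mu>)"
    proof (rule integral_mono_AE[OF ilo2])
      show "AE y in \<mu>. (lo y)\<^sup>2 \<le> z powr (2 - q) * y powr q"
        using nonneg by eventually_elim (rule lo2)
    qed (use Mq in simp)
    then show ?thesis by (simp add: K_def)
  qed
  have Ehi: "(\<integral>y. hi y \<partial>\<mu>) \<le> z powr (1 - q) * K" "0 \<le> (\<integral>y. hi y \<partial>\<mu>)"
  proof -
    have "(\<integral>y. hi y \<partial>\<mu>) \<le> (\<integral>y. z powr (1 - q) * y powr q \<partial>\<mu>)"
    proof (rule integral_mono_AE[OF ihi(1)])
      show "AE y in \<mu>. hi y \<le> z powr (1 - q) * y powr q"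
        using nonneg by eventually_elim (rule hi1)
    qed (use Mq in simp)
    then show "(\<integral>y. hi y \<partial>\<mu>) \<le> z powr (1 - q) * K" by (simp add: K_def)
    show "0 \<le> (\<integral>y. hi y \<partial>\<mu>)"
    proof (rule integral_nonneg_AE)
      show "AE y in \<mu>. 0 \<le> hi y" using nonneg by eventually_elim (simp add: hi_def)
    qed
  qed
  define l where "l = (\<integral>y. lo y \<partial>\<mu>)"
  define W where "W i x = lo (Y i x) - l" for i x
  have W1: "integrable M (W i)" "expectation (W i) = 0" if "i \<in> I" for i
    using ifI[OF that, of lo] ihi(2) by (simp_all add: W_def[abs_def] l_def prob_space)
  have W2: "integrable M (\<lambda>x. (W i x)\<^sup>2)" "expectation (\<lambda>x. (W i x)\<^sup>2) \<le> z powr (2 - q) * K" if "i \<in> I" for i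
  proof -
    have i: "integrable M (\<lambda>x. lo (Y i x))" "expectation (\<lambda>x. lo (Y i x)) = l"
      "integrable M (\<lambda>x. (lo (Y i x))\<^sup>2)" "expectation (\<lambda>x. (lo (Y i x))\<^sup>2) \<le> z powr (2 - q) * K"
      using ifI[OF that, of lo] ifI[OF that, of "\<lambda>y. (lo y)\<^sup>2"] ihi(2) ilo2 Elo2 by (simp_all add: l_def)
    have eq: "(W i x)\<^sup>2 = (lo (Y i x))\<^sup>2 - 2 * l * lo (Y i x) + l\<^sup>2" for x
      by (simp add: W_def power2_diff)
    show "integrable M (\<lambda>x. (W i x)\<^sup>2)" unfolding eq using i by simp
    have "expectation (\<lambda>x. (W i x)\<^sup>2) = expectation (\<lambda>x. (lo (Y i x))\<^sup>2) - 2 * l * l + l\<^sup>2"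
      unfolding eq using i by (simp add: prob_space)
    moreover have "- 2 * l * l + l\<^sup>2 = - l\<^sup>2" by (simp add: power2_eq_square)
    ultimately show "expectation (\<lambda>x. (W i x)\<^sup>2) \<le> z powr (2 - q) * K"
      using i(4) zero_le_power2[of l] by linarith
  qed
  have indW: "indep_vars (\<lambda>_. borel) W I"
    unfolding W_def[abs_def] by (rule indep_vars_compose2[OF ind, where Y = "\<lambda>_ y. lo y - l"]) simp
  note sq = expectation_sum_square_le[OF I(1) indW W1(1) W2(1)]
  have sq2: "expectation (\<lambda>x. (\<Sum>i\<in>I. W i x)\<^sup>2) \<le> z * (z powr (2 - q) * K)"
  proof -
    have "expectation (\<lambda>x. (\<Sum>i\<in>I. W i x)\<^sup>2) \<le> (\<Sum>i\<in>I. expectation (\<lambda>x. (W i x)\<^sup>2)) + (\<Sum>i\<in>I. \<bar>expectation (W i)\<bar>)\<^sup>2"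
      by (rule sq(2))
    also have "(\<Sum>i\<in>I. \<bar>expectation (W i)\<bar>) = 0" using W1 by simp
    also have "(\<Sum>i\<in>I. expectation (\<lambda>x. (W i x)\<^sup>2)) \<le> (\<Sum>i\<in>I. z powr (2 - q) * K)"
      by (intro sum_mono W2)
    finally show ?thesis by (simp add: z_def)
  qed
  \<comment> \<open>Each part is centred by its own mean, and l + h = 1 is the mean of Y, so the two
    centred sums reassemble the deviation from 1.\<close>
  define h where "h = (\<integral>y. hi y \<partial>\<mu>)"
  have lh: "l + h = 1"
    unfolding l_def h_def using ihi mean by (subst Bochner_Integration.integral_add[symmetric]) (auto simp: lohi)
  define U where "U i x = hi (Y i x) - h" for i x
  have U: "integrable M (\<lambda>x. \<bar>U i x\<bar>)" "expectation (\<lambda>x. \<bar>U i x\<bar>) \<le> 2 * (z powr (1 - q) * K)" if "i \<in> I" for i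
  proof -
    have i: "integrable M (\<lambda>x. hi (Y i x))" "expectation (\<lambda>x. hi (Y i x)) = h"
      using ifI[OF that, of hi] ihi(1) by (simp_all add: h_def)
    then show iU: "integrable M (\<lambda>x. \<bar>U i x\<bar>)" unfolding U_def by simp
    have "AE y in distr M borel (Y i). 0 \<le> y" unfolding same[OF that] by (rule nonneg)
    then have nn: "AE x in M. 0 \<le> Y i x" using rv[OF that] by (simp add: AE_distr_iff)
    have "expectation (\<lambda>x. \<bar>U i x\<bar>) \<le> expectation (\<lambda>x. hi (Y i x) + h)"
    proof (rule integral_mono_AE[OF iU])
      show "AE x in M. \<bar>U i x\<bar> \<le> hi (Y i x) + h"
        using nn by eventually_elim (use Ehi(2) in \<open>auto simp: U_def hi_def h_def\<close>)
    qed (use i in simp)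
    also have "\<dots> = 2 * h" using i by (simp add: prob_space)
    also have "\<dots> \<le> 2 * (z powr (1 - q) * K)" using Ehi(1) by (simp add: h_def)
    finally show "expectation (\<lambda>x. \<bar>U i x\<bar>) \<le> 2 * (z powr (1 - q) * K)" .
  qed
  have dec: "(\<Sum>i\<in>I. Y i x) / z - 1 = (\<Sum>i\<in>I. W i x) / z + (\<Sum>i\<in>I. U i x) / z" for x
  proof -
    have "(\<Sum>i\<in>I. W i x) + (\<Sum>i\<in>I. U i x) = (\<Sum>i\<in>I. Y i x - 1)"
      unfolding sum.distrib[symmetric]
    proof (rule sum.cong[OF refl])
      fix i
      show "W i x + U i x = Y i x - 1" using lohi[of "Y i x"] lh by (simp add: W_def U_def)
    qed
    also have "\<dots> = (\<Sum>i\<in>I. Y i x) - z" by (simp add: sum_subtractf z_def)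
    finally show ?thesis using z by (simp add: add_divide_distrib[symmetric] diff_divide_distrib)
  qed
  have iY: "integrable M (Y i)" "expectation (Y i) = 1" if "i \<in> I" for i
  proof -
    have m: "(\<lambda>y :: real. y) \<in> borel_measurable borel" by simp
    show "integrable M (Y i)" using ifI(1)[OF that m] int by blast
    show "expectation (Y i) = 1" using trans[OF ifI(2)[OF that m] mean] .
  qed
  define D where "D x = (\<Sum>i\<in>I. Y i x) / z - 1" for x
  have iD: "integrable M D" unfolding D_def using iY by simp
  have [measurable]: "D \<in> borel_measurable M" using iD by simp
  have [measurable]: "dev \<in> borel_measurable borel" unfolding dev_def by measurable
  have idev: "integrable M (\<lambda>x. dev (D x))"
    by (rule Bochner_Integration.integrable_bound[OF iD]) (auto simp: dev_def)
  then show "integrable M (\<lambda>x. dev ((\<Sum>i\<in>I. Y i x) / z - 1))" by (simp add: D_def)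
  have b1: "expectation (\<lambda>x. dev (D x)) \<le> 8 * (z powr (1 - q) * K)"
  proof -
    have "expectation (\<lambda>x. dev (D x)) \<le> expectation (\<lambda>x. 4 / z\<^sup>2 * (\<Sum>i\<in>I. W i x)\<^sup>2 + 2 / z * (\<Sum>i\<in>I. \<bar>U i x\<bar>))"
    proof (rule integral_mono[OF idev])
      show "integrable M (\<lambda>x. 4 / z\<^sup>2 * (\<Sum>i\<in>I. W i x)\<^sup>2 + 2 / z * (\<Sum>i\<in>I. \<bar>U i x\<bar>))"
        using sq(1) U(1) by (intro Bochner_Integration.integrable_add integrable_mult_right) auto
      fix x
      have "dev (D x) \<le> 4 * ((\<Sum>i\<in>I. W i x) / z)\<^sup>2 + 2 * \<bar>(\<Sum>i\<in>I. U i x) / z\<bar>"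
        unfolding D_def dec by (rule dev_add_le)
      also have "\<bar>(\<Sum>i\<in>I. U i x) / z\<bar> \<le> (\<Sum>i\<in>I. \<bar>U i x\<bar>) / z"
        using z by (simp add: abs_divide divide_right_mono)
      finally show "dev (D x) \<le> 4 / z\<^sup>2 * (\<Sum>i\<in>I. W i x)\<^sup>2 + 2 / z * (\<Sum>i\<in>I. \<bar>U i x\<bar>)"
        by (simp add: power_divide)
    qed
    also have "\<dots> = 4 / z\<^sup>2 * expectation (\<lambda>x. (\<Sum>i\<in>I. W i x)\<^sup>2) + 2 / z * (\<Sum>i\<in>I. expectation (\<lambda>x. \<bar>U i x\<bar>))"
      using sq(1) U(1) by (subst Bochner_Integration.integral_add) (auto simp: Bochner_Integration.integral_sum)
    also have "\<dots> \<le> 4 / z\<^sup>2 * (z * (z powr (2 - q) * K)) + 2 / z * (\<Sum>i\<in>I. 2 * (z powr (1 - q) * K))"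
      using z by (intro add_mono mult_left_mono sq2 sum_mono U) auto
    also have "\<dots> = 8 * (z powr (1 - q) * K)"
    proof -
      have "z powr (2 - q) = z * z powr (1 - q)"
        using z powr_add[of z 1 "1 - q"] by simp
      then show ?thesis using z by (simp add: z_def[symmetric] power2_eq_square field_simps)
    qed
    finally show ?thesis .
  qed
  \<comment> \<open>A bound without any rate, from |D| at most the sample mean plus 1; it supplies
    the 1 in the minimum, which is the better bound when the moment of order q is large.\<close>
  have b2: "expectation (\<lambda>x. dev (D x)) \<le> 8 * 1"
  proof -
    have nn: "AE x in M. \<forall>i\<in>I. 0 \<le> Y i x"
    proof (rule AE_finite_allI[OF I(1)])
      fix i assume "i \<in> I"
      then have "AE y in distr M borel (Y i). 0 \<le> y" using nonneg by (simp only: same)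
      then show "AE x in M. 0 \<le> Y i x" using rv[OF \<open>i \<in> I\<close>] by (simp add: AE_distr_iff)
    qed
    have "expectation (\<lambda>x. dev (D x)) \<le> expectation (\<lambda>x. (\<Sum>i\<in>I. Y i x) / z + 1)"
    proof (rule integral_mono_AE[OF idev])
      show "AE x in M. dev (D x) \<le> (\<Sum>i\<in>I. Y i x) / z + 1"
        using nn
      proof eventually_elim
        case (elim x)
        then have "0 \<le> (\<Sum>i\<in>I. Y i x) / z" using z by (intro divide_nonneg_nonneg sum_nonneg) auto
        then have "\<bar>D x\<bar> \<le> (\<Sum>i\<in>I. Y i x) / z + 1" unfolding D_def by linarith
        then show ?case by (simp add: dev_def)
      qed
    qed (use iY in simp)
    also have "\<dots> = 2" using iY z by (simp add: prob_space z_def)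
    finally show ?thesis by simp
  qed
  show "expectation (\<lambda>x. dev ((\<Sum>i\<in>I. Y i x) / z - 1)) \<le> 8 * min 1 (z powr (1 - q) * (\<integral>y. y powr q \<partial>\<mu>))"
    using b1 b2 unfolding D_def K_def by (simp add: min_def)
qed

section \<open>Random sums and negative moments\<close>

lemma measurable_sum_nat:
  fixes f :: "'i \<Rightarrow> 'a \<Rightarrow> nat"
  assumes "finite J" "\<And>j. j \<in> J \<Longrightarrow> f j \<in> M \<rightarrow>\<^sub>M count_space UNIV"
  shows "(\<lambda>x. \<Sum>j\<in>J. f j x) \<in> M \<rightarrow>\<^sub>M count_space UNIV"
  using assms
proof (induction J rule: finite_induct)
  case (insert j J)
  have "(\<lambda>x. (f j x, \<Sum>i\<in>J. f i x)) \<in> M \<rightarrow>\<^sub>M count_space UNIV \<Otimes>\<^sub>M count_space UNIV"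
    using insert by (intro measurable_Pair) auto
  then have "(\<lambda>x. (f j x, \<Sum>i\<in>J. f i x)) \<in> M \<rightarrow>\<^sub>M count_space UNIV"
    by (simp add: pair_measure_countable)
  from measurable_compose[OF this, of "\<lambda>(a, b). a + b" "count_space UNIV"]
  show ?case using insert.hyps by simp
qed simp

text \<open>The number of summands takes countably many values, so measurability can be checked with
  this number fixed.\<close>

lemma measurable_random_sum:
  fixes H :: "nat \<Rightarrow> nat \<Rightarrow> 'c"
  assumes "\<And>z k. H z k \<in> space N"
  shows "(\<lambda>(z, w). H z (\<Sum>i\<in>{1..z}. w i))
    \<in> count_space UNIV \<Otimes>\<^sub>M PiM {1..} (\<lambda>_. count_space UNIV) \<rightarrow>\<^sub>M N"
proof (rule measurable_pair_measure_countable1)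
  fix z :: nat
  let ?T = "PiM {1 :: nat..} (\<lambda>_. count_space (UNIV :: nat set))"
  have "(\<lambda>w. \<Sum>i\<in>{1..z}. w i) \<in> ?T \<rightarrow>\<^sub>M count_space UNIV"
    by (intro measurable_sum_nat measurable_component_singleton) auto
  from measurable_compose[OF this, of "H z" N]
  show "(\<lambda>w. case (z, w) of (z, w) \<Rightarrow> H z (\<Sum>i\<in>{1..z}. w i)) \<in> ?T \<rightarrow>\<^sub>M N"
    using assms by (auto simp: Pi_iff)
qed simp

lemma random_sum_restrict:
  "(\<Sum>i\<in>{1..z}. (\<lambda>i\<in>{1..}. f i) i) = (\<Sum>i\<in>{1..z :: nat}. f i)"
  by (intro sum.cong) auto

text \<open>By independence the past can be frozen: for a fixed value z of \<open>Z\<close> the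
  integral over the new generation is at most \<open>G z\<close>. \<open>Z\<close> is read off from
  the past by \<open>g\<close>, because independence is assumed for the whole vector of earlier
  generation sizes.\<close>

lemma nn_integral_random_sum_le:
  fixes V :: "nat \<Rightarrow> 'a \<Rightarrow> nat" and H :: "nat \<Rightarrow> nat \<Rightarrow> ennreal"
  assumes Q: "prob_space Q"
    and ind: "prob_space.indep_var Q P past (PiM {1..} (\<lambda>_. count_space UNIV)) (\<lambda>x. \<lambda>i\<in>{1..}. V i x)"
    and g [measurable]: "g \<in> P \<rightarrow>\<^sub>M count_space UNIV" and Z: "\<And>x. Z x = g (past x)"
    and Z1: "AE x in Q. 1 \<le> Z x"
    and G: "\<And>z. 1 \<le> z \<Longrightarrow> (\<integral>\<^sup>+ x. H z (\<Sum>i\<in>{1..z}. V i x) \<partial>Q) \<le> G z"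
  shows "(\<integral>\<^sup>+ x. H (Z x) (\<Sum>i\<in>{1..Z x}. V i x) \<partial>Q) \<le> (\<integral>\<^sup>+ x. G (Z x) \<partial>Q)"
proof -
  interpret prob_space Q by fact
  let ?S = "count_space (UNIV :: nat set)" and ?T = "PiM {1 :: nat..} (\<lambda>_. count_space (UNIV :: nat set))"
  let ?W = "\<lambda>x. \<lambda>i\<in>{1..}. V i x"
  define F where "F = (\<lambda>(u, w). H (g u) (\<Sum>i\<in>{1..g u}. w i))"
  have F [measurable]: "F \<in> borel_measurable (P \<Otimes>\<^sub>M ?T)"
  proof -
    have "(\<lambda>t. (g (fst t), snd t)) \<in> P \<Otimes>\<^sub>M ?T \<rightarrow>\<^sub>M ?S \<Otimes>\<^sub>M ?T"
      by measurable
    from measurable_compose[OF this measurable_random_sum[of H borel]]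
    show ?thesis by (simp add: F_def split_beta')
  qed
  have [measurable]: "past \<in> Q \<rightarrow>\<^sub>M P" "?W \<in> Q \<rightarrow>\<^sub>M ?T"
    and joint: "distr Q P past \<Otimes>\<^sub>M distr Q ?T ?W = distr Q (P \<Otimes>\<^sub>M ?T) (\<lambda>x. (past x, ?W x))"
    using ind unfolding indep_var_distribution_eq by blast+
  interpret W: prob_space "distr Q ?T ?W" by (rule prob_space_distr) measurable
  have Fd: "F \<in> borel_measurable (distr Q P past \<Otimes>\<^sub>M distr Q ?T ?W)"
    unfolding measurable_cong_sets[OF sets_pair_measure_cong[OF sets_distr sets_distr] refl] by (rule F)
  have Fx: "F (past x, ?W y) = H (Z x) (\<Sum>i\<in>{1..Z x}. V i y)" for x y
    by (simp only: F_def split random_sum_restrict Z)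
  have "(\<integral>\<^sup>+ x. H (Z x) (\<Sum>i\<in>{1..Z x}. V i x) \<partial>Q) = (\<integral>\<^sup>+ x. F (past x, ?W x) \<partial>Q)"
    by (simp only: Fx)
  also have "\<dots> = integral\<^sup>N (distr Q (P \<Otimes>\<^sub>M ?T) (\<lambda>x. (past x, ?W x))) F"
    by (rule nn_integral_distr[symmetric]) measurable
  also have "\<dots> = (\<integral>\<^sup>+ z. (\<integral>\<^sup>+ w. F (z, w) \<partial>distr Q ?T ?W) \<partial>distr Q P past)"
    unfolding joint[symmetric] by (rule W.nn_integral_fst[OF Fd, symmetric])
  also have "\<dots> = (\<integral>\<^sup>+ x. (\<integral>\<^sup>+ w. F (past x, w) \<partial>distr Q ?T ?W) \<partial>Q)"
    by (rule nn_integral_distr[OF _ W.borel_measurable_nn_integral_fst[OF Fd]]) measurable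
  also have "\<dots> = (\<integral>\<^sup>+ x. (\<integral>\<^sup>+ y. F (past x, ?W y) \<partial>Q) \<partial>Q)"
  proof (rule nn_integral_cong)
    fix x assume "x \<in> space Q"
    then have "past x \<in> space P" using measurable_space[of past Q P] by simp
    then have "(\<lambda>w. F (past x, w)) \<in> borel_measurable ?T"
      by (intro measurable_compose[OF _ F] measurable_Pair1')
    then show "(\<integral>\<^sup>+ w. F (past x, w) \<partial>distr Q ?T ?W) = (\<integral>\<^sup>+ y. F (past x, ?W y) \<partial>Q)"
      unfolding measurable_cong_sets[OF sets_distr refl, of Q ?T ?W, symmetric]
      by (rule nn_integral_distr[rotated]) measurable
  qed
  also have "\<dots> = (\<integral>\<^sup>+ x. (\<integral>\<^sup>+ y. H (Z x) (\<Sum>i\<in>{1..Z x}. V i y) \<partial>Q) \<partial>Q)"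
    by (simp only: Fx)
  also have "\<dots> \<le> (\<integral>\<^sup>+ x. G (Z x) \<partial>Q)"
  proof (rule nn_integral_mono_AE)
    show "AE x in Q. (\<integral>\<^sup>+ y. H (Z x) (\<Sum>i\<in>{1..Z x}. V i y) \<partial>Q) \<le> G (Z x)"
      using Z1 by eventually_elim (rule G)
  qed
  finally show ?thesis .
qed

text \<open>Jensen's inequality for the convex function t^(-\<eta>), obtained from its tangent 1 -
  \<eta> (t - 1) at t = 1: it is applied to t = x/s with s the mean, where the linear terms sum to
  zero.\<close>

lemma sum_powr_neg_le:
  fixes x :: "'i \<Rightarrow> real"
  assumes "finite I" "I \<noteq> {}" "\<And>i. i \<in> I \<Longrightarrow> 0 < x i" "0 \<le> \<eta>"
  shows "(\<Sum>i\<in>I. x i) powr (- \<eta>) \<le> card I powr (- \<eta>) * ((\<Sum>i\<in>I. x i powr (- \<eta>)) / card I)"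
proof -
  define z where "z = real (card I)"
  have z: "0 < z" using assms by (simp add: z_def card_gt_0_iff)
  define s where "s = (\<Sum>i\<in>I. x i) / z"
  have s: "0 < s" using assms z by (auto simp: s_def intro!: divide_pos_pos sum_pos)
  have tangent: "1 - \<eta> * (t - 1) \<le> t powr (- \<eta>)" if "0 < t" for t
  proof -
    have "\<eta> * ln t \<le> \<eta> * (t - 1)" using that assms by (intro mult_left_mono ln_le_minus_one) auto
    moreover have "1 + (- \<eta> * ln t) \<le> exp (- \<eta> * ln t)" by (rule exp_ge_add_one_self)
    ultimately show ?thesis using that by (simp add: powr_def)
  qed
  have "z = (\<Sum>i\<in>I. 1 - \<eta> * (x i / s - 1))"
  proof -
    have "(\<Sum>i\<in>I. x i) = s * z" using z by (simp add: s_def)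
    then have "(\<Sum>i\<in>I. x i / s) = z" using s by (simp add: sum_divide_distrib[symmetric])
    then show ?thesis
      by (simp add: sum_subtractf sum_distrib_left[symmetric] z_def)
  qed
  also have "\<dots> \<le> (\<Sum>i\<in>I. (x i / s) powr (- \<eta>))"
    using assms s by (intro sum_mono tangent) auto
  also have "\<dots> = (\<Sum>i\<in>I. x i powr (- \<eta>)) / s powr (- \<eta>)"
    using assms s by (simp add: powr_divide sum_divide_distrib less_imp_le)
  finally have "s powr (- \<eta>) \<le> (\<Sum>i\<in>I. x i powr (- \<eta>)) / z"
    using s z by (simp add: pos_le_divide_eq mult.commute)
  then have "z powr (- \<eta>) * s powr (- \<eta>) \<le> z powr (- \<eta>) * ((\<Sum>i\<in>I. x i powr (- \<eta>)) / z)"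
    by (rule mult_left_mono) simp
  moreover have "z powr (- \<eta>) * s powr (- \<eta>) = (\<Sum>i\<in>I. x i) powr (- \<eta>)"
    using s z by (simp add: powr_mult[symmetric] s_def)
  ultimately show ?thesis by (simp add: z_def)
qed

lemma AE_offspring_pos:
  fixes V :: "'a \<Rightarrow> nat"
  assumes "prob_space Q" "V \<in> Q \<rightarrow>\<^sub>M count_space UNIV" "distr Q (count_space UNIV) V = measure_pmf p"
    and "pmf p 0 = 0"
  shows "AE x in Q. 1 \<le> V x"
proof -
  have "1 \<le> k" if "k \<in> set_pmf p" for k
    using that assms(4) by (cases k) (auto simp: set_pmf_iff)
  then have "AE k in measure_pmf p. 1 \<le> k" by (simp add: AE_measure_pmf_iff)
  then have "AE k in distr Q (count_space UNIV) V. 1 \<le> k" unfolding assms(3) .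
  then show ?thesis using assms(2) by (simp add: AE_distr_iff)
qed

text \<open>\<open>sum_powr_neg_le\<close> applies pointwise, and the average of the powers of the
  individual offspring numbers has the expectation of a single one. So a generation multiplies the
  negative moment by a factor that depends on the offspring law alone.\<close>

lemma nn_integral_sum_powr_neg_le:
  fixes V :: "nat \<Rightarrow> 'a \<Rightarrow> nat"
  assumes Q: "prob_space Q" and V: "\<And>i. 1 \<le> i \<Longrightarrow> V i \<in> Q \<rightarrow>\<^sub>M count_space UNIV"
    and law: "\<And>i. 1 \<le> i \<Longrightarrow> distr Q (count_space UNIV) (V i) = measure_pmf p"
    and p0: "pmf p 0 = 0" and "0 \<le> \<eta>" and z: "1 \<le> z"
  shows "(\<integral>\<^sup>+ x. ennreal (real (\<Sum>i\<in>{1..z}. V i x) powr (- \<eta>)) \<partial>Q)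
    \<le> ennreal (real z powr (- \<eta>)) * (\<integral>\<^sup>+ k. ennreal (real k powr (- \<eta>)) \<partial>measure_pmf p)"
proof -
  interpret prob_space Q by fact
  define c where "c = real z powr (- \<eta>) / real z"
  have c: "0 \<le> c" by (simp add: c_def)
  have pos: "AE x in Q. \<forall>i\<in>{1..z}. 1 \<le> V i x"
  proof (rule AE_finite_allI)
    show "AE x in Q. 1 \<le> V i x" if "i \<in> {1..z}" for i
      using that by (intro AE_offspring_pos[OF Q V law p0]) auto
  qed simp
  have mV [measurable]: "(\<lambda>x. ennreal (real (V i x) powr (- \<eta>))) \<in> borel_measurable Q" if "1 \<le> i" for i
    using V[OF that] by measurable
  have "(\<integral>\<^sup>+ x. ennreal (real (\<Sum>i\<in>{1..z}. V i x) powr (- \<eta>)) \<partial>Q)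
    \<le> (\<integral>\<^sup>+ x. ennreal c * (\<Sum>i\<in>{1..z}. ennreal (real (V i x) powr (- \<eta>))) \<partial>Q)"
  proof (rule nn_integral_mono_AE)
    show "AE x in Q. ennreal (real (\<Sum>i\<in>{1..z}. V i x) powr (- \<eta>)) \<le> ennreal c * (\<Sum>i\<in>{1..z}. ennreal (real (V i x) powr (- \<eta>)))"
      using pos
    proof eventually_elim
      case (elim x)
      have "(\<Sum>i\<in>{1..z}. real (V i x)) powr (- \<eta>)
        \<le> card {1..z} powr (- \<eta>) * ((\<Sum>i\<in>{1..z}. real (V i x) powr (- \<eta>)) / card {1..z})"
        using elim z assms(5) by (intro sum_powr_neg_le) (auto simp: Suc_le_eq)
      then have "real (\<Sum>i\<in>{1..z}. V i x) powr (- \<eta>) \<le> c * (\<Sum>i\<in>{1..z}. real (V i x) powr (- \<eta>))"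
        by (simp add: c_def)
      from ennreal_leI[OF this] show ?case
        using c by (simp add: ennreal_mult sum_nonneg sum_ennreal)
    qed
  qed
  also have "\<dots> = ennreal c * (\<Sum>i\<in>{1..z}. \<integral>\<^sup>+ x. ennreal (real (V i x) powr (- \<eta>)) \<partial>Q)"
  proof -
    have S: "(\<lambda>x. \<Sum>i\<in>{1..z}. ennreal (real (V i x) powr (- \<eta>))) \<in> borel_measurable Q"
      by (intro borel_measurable_sum mV) auto
    show ?thesis
      unfolding nn_integral_cmult[OF S]
      by (intro arg_cong2[where f = "(*)"] refl nn_integral_sum mV) auto
  qed
  also have "(\<Sum>i\<in>{1..z}. \<integral>\<^sup>+ x. ennreal (real (V i x) powr (- \<eta>)) \<partial>Q)
      = (\<Sum>i\<in>{1..z}. \<integral>\<^sup>+ k. ennreal (real k powr (- \<eta>)) \<partial>measure_pmf p)"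
  proof (rule sum.cong[OF refl])
    fix i assume "i \<in> {1..z}"
    then have i: "1 \<le> i" by simp
    show "(\<integral>\<^sup>+ x. ennreal (real (V i x) powr (- \<eta>)) \<partial>Q) = (\<integral>\<^sup>+ k. ennreal (real k powr (- \<eta>)) \<partial>measure_pmf p)"
      unfolding law[OF i, symmetric] using V[OF i] by (subst nn_integral_distr) auto
  qed
  also have "ennreal c * \<dots> = ennreal (real z powr (- \<eta>)) * (\<integral>\<^sup>+ k. ennreal (real k powr (- \<eta>)) \<partial>measure_pmf p)"
  proof -
    have "ennreal c * of_nat z = ennreal (real z powr (- \<eta>))"
      using z c by (simp add: c_def ennreal_of_nat_eq_real_of_nat ennreal_mult[symmetric])
    then show ?thesis by (simp add: mult.assoc[symmetric])
  qed
  finally show ?thesis .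
qed

text \<open>The ratio is the mean of the variables \<open>V i\<close>/m, which have expectation 1,
  and it is at least 1/m because every \<open>V i\<close> is at least 1; so
  \<open>ln_square_le_dev\<close> reduces the claim to \<open>iid_mean_dev_le\<close>. The minimum
  found there is weakened to a power t, and 32 = 4 * 8.\<close>

lemma nn_integral_ln_ratio_le:
  fixes V :: "nat \<Rightarrow> 'a \<Rightarrow> nat"
  assumes Q: "prob_space Q" and ind: "prob_space.indep_vars Q (\<lambda>_. count_space UNIV) V {1..z}"
    and law: "\<And>i. i \<in> {1..z} \<Longrightarrow> distr Q (count_space UNIV) (V i) = measure_pmf p"
    and p0: "pmf p 0 = 0" and z: "1 \<le> z" and q: "1 < q" "q \<le> 2" and t: "0 < t" "t \<le> 1"
    and m: "integrable (measure_pmf p) (\<lambda>k. real k)" "m = (\<integral>k. real k \<partial>measure_pmf p)"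
    and Mq: "integrable (measure_pmf p) (\<lambda>k. real k powr q)"
  shows "(\<integral>\<^sup>+ x. ennreal ((ln (real (\<Sum>i\<in>{1..z}. V i x) / (real z * m)))\<^sup>2) \<partial>Q)
    \<le> ennreal (32 * (1 + (ln m)\<^sup>2) * (real z powr (1 - q) * ((\<integral>k. real k powr q \<partial>measure_pmf p) / m powr q)) powr t)"
proof -
  interpret prob_space Q by fact
  have V: "V i \<in> Q \<rightarrow>\<^sub>M count_space UNIV" if "i \<in> {1..z}" for i
    using ind that by (auto simp: indep_vars_def)
  have m1: "1 \<le> m"
  proof -
    have "AE k in measure_pmf p. (1 :: real) \<le> real k"
      using p0 by (auto simp: AE_measure_pmf_iff set_pmf_iff Suc_le_eq intro!: gr0I)
    then have "(\<integral>k. 1 \<partial>measure_pmf p) \<le> m"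
      unfolding m(2) by (intro integral_mono_AE m(1)) auto
    then show ?thesis by simp
  qed
  define \<mu> where "\<mu> = distr (measure_pmf p) borel (\<lambda>k. real k / m)"
  define Y where "Y i x = real (V i x) / m" for i x
  have indY: "indep_vars (\<lambda>_. borel) Y {1..z}"
    unfolding Y_def[abs_def] by (rule indep_vars_compose2[OF ind, where Y = "\<lambda>_ k. real k / m"]) simp
  have same: "distr Q borel (Y i) = \<mu>" if "i \<in> {1..z}" for i
    unfolding \<mu>_def law[OF that, symmetric] Y_def[abs_def] using V[OF that]
    by (subst distr_distr) (auto simp: comp_def)
  have nn: "AE y in \<mu>. 0 \<le> y" unfolding \<mu>_def using m1 by (subst AE_distr_iff) auto
  have i1: "integrable \<mu> (\<lambda>y. y)" "(\<integral>y. y \<partial>\<mu>) = 1"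
    unfolding \<mu>_def using m m1 by (auto simp: integrable_distr_eq integral_distr)
  have yq: "(real k / m) powr q = real k powr q / m powr q" for k
    using m1 by (simp add: powr_divide)
  have iq: "integrable \<mu> (\<lambda>y. y powr q)" "(\<integral>y. y powr q \<partial>\<mu>) = (\<integral>k. real k powr q \<partial>measure_pmf p) / m powr q"
    unfolding \<mu>_def using Mq by (auto simp: integrable_distr_eq integral_distr yq)
  note dev = iid_mean_dev_le[OF _ _ indY same nn q i1 iq(1), simplified iq(2)]
  let ?M = "(\<integral>k. real k powr q \<partial>measure_pmf p) / m powr q"
  have M0: "0 \<le> ?M" by (intro divide_nonneg_nonneg integral_nonneg_AE) auto
  have pos: "AE x in Q. \<forall>i\<in>{1..z}. 1 \<le> V i x"
  proof (rule AE_finite_allI)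
    show "AE x in Q. 1 \<le> V i x" if "i \<in> {1..z}" for i
      using that by (intro AE_offspring_pos[OF Q V law p0]) auto
  qed simp
  have d: "integrable Q (\<lambda>x. dev ((\<Sum>i\<in>{1..z}. Y i x) / real z - 1))"
    "expectation (\<lambda>x. dev ((\<Sum>i\<in>{1..z}. Y i x) / real z - 1)) \<le> 8 * min 1 (real z powr (1 - q) * ?M)"
    using dev z by simp_all
  have "(\<integral>\<^sup>+ x. ennreal ((ln (real (\<Sum>i\<in>{1..z}. V i x) / (real z * m)))\<^sup>2) \<partial>Q)
    \<le> (\<integral>\<^sup>+ x. ennreal (4 * (1 + (ln m)\<^sup>2) * dev ((\<Sum>i\<in>{1..z}. Y i x) / real z - 1)) \<partial>Q)"
  proof (rule nn_integral_mono_AE)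
    show "AE x in Q. ennreal ((ln (real (\<Sum>i\<in>{1..z}. V i x) / (real z * m)))\<^sup>2)
      \<le> ennreal (4 * (1 + (ln m)\<^sup>2) * dev ((\<Sum>i\<in>{1..z}. Y i x) / real z - 1))"
      using pos
    proof eventually_elim
      case (elim x)
      have R: "real (\<Sum>i\<in>{1..z}. V i x) / (real z * m) = (\<Sum>i\<in>{1..z}. Y i x) / real z"
        by (simp add: Y_def sum_divide_distrib[symmetric])
      have "(\<Sum>i\<in>{1..z}. 1) \<le> (\<Sum>i\<in>{1..z}. V i x)" using elim by (intro sum_mono) auto
      then have "z \<le> (\<Sum>i\<in>{1..z}. V i x)" by simp
      then have "real z \<le> real (\<Sum>i\<in>{1..z}. V i x)" by (rule of_nat_mono)
      then have "real z / (real z * m) \<le> real (\<Sum>i\<in>{1..z}. V i x) / (real z * m)"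
        using m1 by (intro divide_right_mono) auto
      then have "1 / m \<le> real (\<Sum>i\<in>{1..z}. V i x) / (real z * m)" using z by simp
      then show ?case
        unfolding R by (intro ennreal_leI ln_square_le_dev m1)
    qed
  qed
  also have "\<dots> = ennreal (4 * (1 + (ln m)\<^sup>2) * expectation (\<lambda>x. dev ((\<Sum>i\<in>{1..z}. Y i x) / real z - 1)))"
    using d(1) by (subst nn_integral_eq_integral) (auto intro!: mult_nonneg_nonneg dev_nonneg)
  also have "\<dots> \<le> ennreal (32 * (1 + (ln m)\<^sup>2) * (real z powr (1 - q) * ?M) powr t)"
  proof (rule ennreal_leI)
    have "min 1 (real z powr (1 - q) * ?M) \<le> (real z powr (1 - q) * ?M) powr t"
      using M0 t by (intro min_one_le_powr) auto
    then have "8 * min 1 (real z powr (1 - q) * ?M) \<le> 8 * (real z powr (1 - q) * ?M) powr t" by simp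
    with d(2) have "expectation (\<lambda>x. dev ((\<Sum>i\<in>{1..z}. Y i x) / real z - 1)) \<le> 8 * (real z powr (1 - q) * ?M) powr t"
      by linarith
    then have "4 * (1 + (ln m)\<^sup>2) * expectation (\<lambda>x. dev ((\<Sum>i\<in>{1..z}. Y i x) / real z - 1))
      \<le> 4 * (1 + (ln m)\<^sup>2) * (8 * (real z powr (1 - q) * ?M) powr t)"
      by (intro mult_left_mono) auto
    then show "4 * (1 + (ln m)\<^sup>2) * expectation (\<lambda>x. dev ((\<Sum>i\<in>{1..z}. Y i x) / real z - 1))
      \<le> 32 * (1 + (ln m)\<^sup>2) * (real z powr (1 - q) * ?M) powr t"
      by (simp only: mult.assoc mult.left_commute[of _ 8])
  qed
  finally show ?thesis .
qed

section \<open>Quenched estimates\<close>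

lemma measurable_branching:
  assumes "\<And>n i. 1 \<le> i \<Longrightarrow> V n i \<in> M \<rightarrow>\<^sub>M count_space UNIV"
  shows "branching V n \<in> M \<rightarrow>\<^sub>M count_space UNIV"
proof (induction n)
  case (Suc n)
  have "(\<lambda>x. \<Sum>i\<in>{1..branching V n x}. V n i x) \<in> M \<rightarrow>\<^sub>M count_space UNIV"
    by (rule measurable_compose_countable[OF _ Suc])
      (intro measurable_sum_nat assms, auto)
  then show ?case by simp
qed simp

lemma offspring_moment_eq:
  "offspring_moment p q \<theta> = (\<integral>\<^sup>+ k. ennreal (real k powr q) \<partial>measure_pmf (p \<theta>))"
  by (simp add: offspring_moment_def nn_integral_measure_pmf nn_integral_count_space_nat
      ennreal_mult mult.commute)

lemma offspring_moment_finite: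
  assumes "offspring_moment p q \<theta> < \<infinity>"
  shows "integrable (measure_pmf (p \<theta>)) (\<lambda>k. real k powr q)"
    and "(\<integral>k. real k powr q \<partial>measure_pmf (p \<theta>)) = enn2real (offspring_moment p q \<theta>)"
proof -
  show "integrable (measure_pmf (p \<theta>)) (\<lambda>k. real k powr q)"
    using assms by (intro integrableI_nonneg) (auto simp: offspring_moment_eq)
  show "(\<integral>k. real k powr q \<partial>measure_pmf (p \<theta>)) = enn2real (offspring_moment p q \<theta>)"
    unfolding offspring_moment_eq by (rule integral_eq_nn_integral) auto
qed

text \<open>What remains of the one-generation bound once the power z^(-(q - 1) t) of the population
  size is split off: a function of the current environment state alone.\<close>

definition step_bound :: "('e \<Rightarrow> nat pmf) \<Rightarrow> real \<Rightarrow> real \<Rightarrow> 'e \<Rightarrow> ennreal" where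
  "step_bound p q t \<theta> = ennreal (32 * (1 + (ln (enn2real (offspring_moment p 1 \<theta>)))\<^sup>2)
    * (enn2real (offspring_moment p q \<theta>) / enn2real (offspring_moment p 1 \<theta>) powr q) powr t)"

text \<open>Conditioning on the past turns the one-generation bound into a negative moment of the
  population of order \<open>\<eta>\<close> = (q - 1) t, the exponent left by (z^(1 - q))^t. Each
  earlier generation contributes one factor to the bound on this moment.\<close>

lemma quenched_bounds:
  assumes Q: "prob_space Q" and V: "\<And>n i. 1 \<le> i \<Longrightarrow> V n i \<in> Q \<rightarrow>\<^sub>M count_space UNIV"
    and law: "\<And>n i. 1 \<le> i \<Longrightarrow> distr Q (count_space UNIV) (V n i) = measure_pmf (p (\<xi> n))"
    and ind: "\<And>n. prob_space.indep_vars Q (\<lambda>_. count_space UNIV) (V n) {1..}"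
    and past: "\<And>n. prob_space.indep_var Q
        (PiM {1..n} (\<lambda>_. count_space UNIV)) (\<lambda>x. \<lambda>k\<in>{1..n}. branching V k x)
        (PiM {1..} (\<lambda>_. count_space UNIV)) (\<lambda>x. \<lambda>i\<in>{1..}. V n i x)"
    and p0: "\<And>n. pmf (p (\<xi> n)) 0 = 0" and m: "\<And>n. offspring_moment p 1 (\<xi> n) < \<infinity>"
    and mq: "\<And>n. offspring_moment p q (\<xi> n) < \<infinity>" and q: "1 < q" "q \<le> 2" and t: "0 < t" "t \<le> 1"
  defines "\<eta> \<equiv> (q - 1) * t"
  shows "AE x in Q. 1 \<le> branching V n x"
    and "(\<integral>\<^sup>+ x. ennreal ((ln (real (branching V (Suc n) x)
        / (real (branching V n x) * enn2real (offspring_moment p 1 (\<xi> n)))))\<^sup>2) \<partial>Q)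
      \<le> (\<Prod>j<n. offspring_moment p (- \<eta>) (\<xi> j)) * step_bound p q t (\<xi> n)"
proof -
  interpret prob_space Q by fact
  let ?Z = "branching V"
  have Z [measurable]: "?Z n \<in> Q \<rightarrow>\<^sub>M count_space UNIV" for n by (rule measurable_branching[OF V])
  have Zpos: "AE x in Q. 1 \<le> ?Z n x" for n
  proof (induction n)
    case (Suc n)
    have "AE x in Q. \<forall>i \<in> {1..}. 1 \<le> V n i x"
    proof (rule AE_ball_countable[THEN iffD2], simp, rule ballI)
      fix i :: nat assume "i \<in> {1..}"
      then have "1 \<le> i" by simp
      then show "AE x in Q. 1 \<le> V n i x" by (intro AE_offspring_pos[OF Q V law p0])
    qed
    then show ?case
      using Suc
    proof eventually_elim
      case (elim x)
      have "(\<Sum>i\<in>{1..?Z n x}. 1) \<le> (\<Sum>i\<in>{1..?Z n x}. V n i x)" using elim by (intro sum_mono) auto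
      then show ?case using elim by simp
    qed
  qed simp
  then show "AE x in Q. 1 \<le> ?Z n x" .
  have step: "(\<integral>\<^sup>+ x. H (?Z n x) (?Z (Suc n) x) \<partial>Q) \<le> (\<integral>\<^sup>+ x. G (?Z n x) \<partial>Q)"
    if "\<And>z. 1 \<le> z \<Longrightarrow> (\<integral>\<^sup>+ x. H z (\<Sum>i\<in>{1..z}. V n i x) \<partial>Q) \<le> G z" for H G n
    unfolding branching.simps
  proof (rule nn_integral_random_sum_le[OF Q past[of n]])
    \<comment> \<open>The past records the generations 1 to n only, so the value 1 of generation 0
      is supplied by hand.\<close>
    show "(\<lambda>u. if n = 0 then 1 else u n) \<in> PiM {1..n} (\<lambda>_. count_space UNIV) \<rightarrow>\<^sub>M count_space UNIV"
      by (cases "n = 0") (simp, auto intro!: measurable_component_singleton)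
    show "?Z n x = (if n = 0 then 1 else (\<lambda>k\<in>{1..n}. ?Z k x) n)" for x by auto
  qed (use Zpos that in auto)
  have decay: "(\<integral>\<^sup>+ x. ennreal (real (?Z n x) powr (- \<eta>)) \<partial>Q) \<le> (\<Prod>j<n. offspring_moment p (- \<eta>) (\<xi> j))" for n
  proof (induction n)
    case 0
    then show ?case by (simp add: emeasure_space_1)
  next
    case (Suc n)
    have "(\<integral>\<^sup>+ x. ennreal (real (?Z (Suc n) x) powr (- \<eta>)) \<partial>Q)
      \<le> (\<integral>\<^sup>+ x. ennreal (real (?Z n x) powr (- \<eta>)) * offspring_moment p (- \<eta>) (\<xi> n) \<partial>Q)"
    proof (rule step[of "\<lambda>z k. ennreal (real k powr (- \<eta>))" n])
      show "(\<integral>\<^sup>+ x. ennreal (real (\<Sum>i\<in>{1..z}. V n i x) powr (- \<eta>)) \<partial>Q)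
        \<le> ennreal (real z powr (- \<eta>)) * offspring_moment p (- \<eta>) (\<xi> n)" if "1 \<le> z" for z
        unfolding offspring_moment_eq using q t that
        by (intro nn_integral_sum_powr_neg_le[OF Q V law p0]) (auto simp: \<eta>_def)
    qed
    also have "\<dots> = (\<integral>\<^sup>+ x. ennreal (real (?Z n x) powr (- \<eta>)) \<partial>Q) * offspring_moment p (- \<eta>) (\<xi> n)"
      by (rule nn_integral_multc) measurable
    also have "\<dots> \<le> (\<Prod>j<n. offspring_moment p (- \<eta>) (\<xi> j)) * offspring_moment p (- \<eta>) (\<xi> n)"
      by (intro mult_right_mono Suc) auto
    finally show ?case by (simp add: mult.commute)
  qed
  have m': "integrable (measure_pmf (p (\<xi> n))) (\<lambda>k. real k)"
    "enn2real (offspring_moment p 1 (\<xi> n)) = (\<integral>k. real k \<partial>measure_pmf (p (\<xi> n)))"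
    using offspring_moment_finite[OF m[of n]] by simp_all
  let ?m = "enn2real (offspring_moment p 1 (\<xi> n))" and ?M = "enn2real (offspring_moment p q (\<xi> n))"
  have "(\<integral>\<^sup>+ x. ennreal ((ln (real (?Z (Suc n) x) / (real (?Z n x) * ?m)))\<^sup>2) \<partial>Q)
    \<le> (\<integral>\<^sup>+ x. ennreal (real (?Z n x) powr (- \<eta>)) * step_bound p q t (\<xi> n) \<partial>Q)"
  proof (rule step[of "\<lambda>z k. ennreal ((ln (real k / (real z * ?m)))\<^sup>2)" n])
    fix z :: nat assume z: "1 \<le> z"
    have "(\<integral>\<^sup>+ x. ennreal ((ln (real (\<Sum>i\<in>{1..z}. V n i x) / (real z * ?m)))\<^sup>2) \<partial>Q)
      \<le> ennreal (32 * (1 + (ln ?m)\<^sup>2) * (real z powr (1 - q) * ((\<integral>k. real k powr q \<partial>measure_pmf (p (\<xi> n))) / ?m powr q)) powr t)"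
    proof (rule nn_integral_ln_ratio_le[OF Q _ law p0 z q t m'])
      show "indep_vars (\<lambda>_. count_space UNIV) (V n) {1..z}"
        using ind[of n] by (rule indep_vars_subset) auto
      show "integrable (measure_pmf (p (\<xi> n))) (\<lambda>k. real k powr q)"
        by (rule offspring_moment_finite(1)[OF mq])
    qed simp
    also have "(\<integral>k. real k powr q \<partial>measure_pmf (p (\<xi> n))) = ?M"
      by (rule offspring_moment_finite(2)[OF mq])
    also have "(real z powr (1 - q) * (?M / ?m powr q)) powr t = real z powr (- \<eta>) * (?M / ?m powr q) powr t"
    proof -
      have "(real z powr (1 - q) * (?M / ?m powr q)) powr t = (real z powr (1 - q)) powr t * (?M / ?m powr q) powr t"
        by (rule powr_mult)
      also have "(real z powr (1 - q)) powr t = real z powr (- \<eta>)"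
        by (simp add: powr_powr \<eta>_def algebra_simps)
      finally show ?thesis .
    qed
    also have "ennreal (32 * (1 + (ln ?m)\<^sup>2) * (real z powr (- \<eta>) * (?M / ?m powr q) powr t))
      = ennreal (real z powr (- \<eta>)) * step_bound p q t (\<xi> n)"
      unfolding step_bound_def by (subst ennreal_mult'[symmetric]) (auto simp: mult_ac)
    finally show "(\<integral>\<^sup>+ x. ennreal ((ln (real (\<Sum>i\<in>{1..z}. V n i x) / (real z * ?m)))\<^sup>2) \<partial>Q)
      \<le> ennreal (real z powr (- \<eta>)) * step_bound p q t (\<xi> n)" .
  qed
  also have "\<dots> = (\<integral>\<^sup>+ x. ennreal (real (?Z n x) powr (- \<eta>)) \<partial>Q) * step_bound p q t (\<xi> n)"
    by (rule nn_integral_multc) measurable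
  also have "\<dots> \<le> (\<Prod>j<n. offspring_moment p (- \<eta>) (\<xi> j)) * step_bound p q t (\<xi> n)"
    by (intro mult_right_mono decay) auto
  finally show "(\<integral>\<^sup>+ x. ennreal ((ln (real (?Z (Suc n) x) / (real (?Z n x) * ?m)))\<^sup>2) \<partial>Q)
    \<le> (\<Prod>j<n. offspring_moment p (- \<eta>) (\<xi> j)) * step_bound p q t (\<xi> n)" .
qed

section \<open>The logarithm of the population size\<close>

context bpre
begin

abbreviation "\<tau> \<equiv> env_law \<nu>"
abbreviation "P \<equiv> total_law \<nu> \<Gamma> Pq"

lemma prob_space_env: "prob_space \<tau>"
  unfolding env_law_def by (rule prob_space_PiM) (rule prob_env)

lemma measurable_coordinate [measurable]: "(\<lambda>\<xi>. \<xi> n) \<in> \<tau> \<rightarrow>\<^sub>M \<nu>"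
  unfolding env_law_def by measurable

lemma distr_coordinate: "distr \<tau> \<nu> (\<lambda>\<xi>. \<xi> n) = \<nu>"
  unfolding env_law_def by (rule distr_PiM_component) (auto intro: prob_env)

lemma space_env_ne: "space \<tau> \<noteq> {}"
  using prob_space_env by (rule prob_space.not_empty)

lemma measurable_quenched [measurable]: "Pq \<in> \<tau> \<rightarrow>\<^sub>M subprob_algebra \<Gamma>"
  by (rule measurable_prob_algebraD[OF quenched_kernel])

lemma quenched_prob:
  assumes "\<xi> \<in> space \<tau>"
  shows "prob_space (Pq \<xi>)" "sets (Pq \<xi>) = sets \<Gamma>"
  using measurable_space[OF quenched_kernel assms] by (auto simp: space_prob_algebra)

lemma measurable_total_kernel:
  "(\<lambda>\<xi>. Pq \<xi> \<bind> (\<lambda>x. return (\<tau> \<Otimes>\<^sub>M \<Gamma>) (\<xi>, x))) \<in> \<tau> \<rightarrow>\<^sub>M subprob_algebra (\<tau> \<Otimes>\<^sub>M \<Gamma>)"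
  by (rule measurable_bind'[OF measurable_quenched]) measurable

lemma sets_total [measurable_cong]: "sets P = sets (\<tau> \<Otimes>\<^sub>M \<Gamma>)"
  unfolding total_law_def
  by (rule sets_bind[OF _ space_env_ne]) (rule sets_kernel[OF measurable_total_kernel])

text \<open>Unfolds the two binds of the total law, so that annealed expectations become quenched
  ones followed by integration over the environment.\<close>

lemma nn_integral_total:
  assumes F: "F \<in> borel_measurable (\<tau> \<Otimes>\<^sub>M \<Gamma>)"
  shows "integral\<^sup>N P F = (\<integral>\<^sup>+ \<xi>. (\<integral>\<^sup>+ x. F (\<xi>, x) \<partial>Pq \<xi>) \<partial>\<tau>)"
proof -
  have "integral\<^sup>N P F = (\<integral>\<^sup>+ \<xi>. integral\<^sup>N (Pq \<xi> \<bind> (\<lambda>x. return (\<tau> \<Otimes>\<^sub>M \<Gamma>) (\<xi>, x))) F \<partial>\<tau>)"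
    unfolding total_law_def by (rule nn_integral_bind[OF F measurable_total_kernel])
  also have "\<dots> = (\<integral>\<^sup>+ \<xi>. (\<integral>\<^sup>+ x. F (\<xi>, x) \<partial>Pq \<xi>) \<partial>\<tau>)"
  proof (rule nn_integral_cong)
    fix \<xi> assume \<xi>: "\<xi> \<in> space \<tau>"
    have k: "(\<lambda>x. return (\<tau> \<Otimes>\<^sub>M \<Gamma>) (\<xi>, x)) \<in> Pq \<xi> \<rightarrow>\<^sub>M subprob_algebra (\<tau> \<Otimes>\<^sub>M \<Gamma>)"
      unfolding measurable_cong_sets[OF quenched_prob(2)[OF \<xi>] refl] using \<xi> by measurable
    have "integral\<^sup>N (Pq \<xi> \<bind> (\<lambda>x. return (\<tau> \<Otimes>\<^sub>M \<Gamma>) (\<xi>, x))) F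
        = (\<integral>\<^sup>+ x. integral\<^sup>N (return (\<tau> \<Otimes>\<^sub>M \<Gamma>) (\<xi>, x)) F \<partial>Pq \<xi>)"
      by (rule nn_integral_bind[OF F k])
    also have "\<dots> = (\<integral>\<^sup>+ x. F (\<xi>, x) \<partial>Pq \<xi>)"
    proof (rule nn_integral_cong)
      fix x assume "x \<in> space (Pq \<xi>)"
      then have "x \<in> space \<Gamma>" using sets_eq_imp_space_eq[OF quenched_prob(2)[OF \<xi>]] by simp
      then show "integral\<^sup>N (return (\<tau> \<Otimes>\<^sub>M \<Gamma>) (\<xi>, x)) F = F (\<xi>, x)"
        using \<xi> F by (intro nn_integral_return) (auto simp: space_pair_measure)
    qed
    finally show "integral\<^sup>N (Pq \<xi> \<bind> (\<lambda>x. return (\<tau> \<Otimes>\<^sub>M \<Gamma>) (\<xi>, x))) F = (\<integral>\<^sup>+ x. F (\<xi>, x) \<partial>Pq \<xi>)" .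
  qed
  finally show ?thesis .
qed

lemma nn_integral_total_fst:
  assumes [measurable]: "f \<in> borel_measurable \<tau>"
  shows "(\<integral>\<^sup>+ \<omega>. f (fst \<omega>) \<partial>P) = integral\<^sup>N \<tau> f"
proof -
  have "(\<integral>\<^sup>+ \<omega>. f (fst \<omega>) \<partial>P) = (\<integral>\<^sup>+ \<xi>. (\<integral>\<^sup>+ x. f \<xi> \<partial>Pq \<xi>) \<partial>\<tau>)"
    by (subst nn_integral_total) auto
  also have "\<dots> = integral\<^sup>N \<tau> f"
    by (intro nn_integral_cong) (simp add: prob_space.emeasure_space_1[OF quenched_prob(1)])
  finally show ?thesis .
qed

lemma prob_space_total: "prob_space P"
proof (rule prob_spaceI)
  have "emeasure P (space P) = (\<integral>\<^sup>+ \<omega>. 1 \<partial>P)" by simp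
  also have "\<dots> = (\<integral>\<^sup>+ \<xi>. 1 \<partial>\<tau>)" by (rule nn_integral_total_fst) simp
  finally show "emeasure P (space P) = 1" using prob_space.emeasure_space_1[OF prob_space_env] by simp
qed

lemma measurable_fst_total [measurable]: "fst \<in> P \<rightarrow>\<^sub>M \<tau>"
  unfolding measurable_cong_sets[OF sets_total refl] by (rule measurable_fst)

lemma measurable_snd_total [measurable]: "snd \<in> P \<rightarrow>\<^sub>M \<Gamma>"
  unfolding measurable_cong_sets[OF sets_total refl] by (rule measurable_snd)

lemma distr_total_fst: "distr P \<tau> fst = \<tau>"
proof (rule measure_eqI_nn_integral)
  fix h :: "(nat \<Rightarrow> 'e) \<Rightarrow> ennreal" assume "h \<in> borel_measurable \<tau>"
  then show "integral\<^sup>N (distr P \<tau> fst) h = integral\<^sup>N \<tau> h"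
    by (subst nn_integral_distr) (auto simp: nn_integral_total_fst)
qed simp

lemma distr_total_coordinate: "distr P \<nu> (\<lambda>\<omega>. fst \<omega> n) = \<nu>"
proof -
  have "distr P \<nu> (\<lambda>\<omega>. fst \<omega> n) = distr (distr P \<tau> fst) \<nu> (\<lambda>\<xi>. \<xi> n)"
    by (subst distr_distr) (auto simp: comp_def)
  then show ?thesis by (simp add: distr_total_fst distr_coordinate)
qed

text \<open>The first marginal of the total law is the product measure \<open>\<tau>\<close>, so the
  environment coordinates remain independent with law \<open>\<nu>\<close>.\<close>

lemma indep_total: "prob_space.indep_vars P (\<lambda>_. \<nu>) (\<lambda>n \<omega>. fst \<omega> n) UNIV"
proof -
  interpret prob_space P by (rule prob_space_total)
  have "distr P (PiM UNIV (\<lambda>_. \<nu>)) (\<lambda>\<omega>. \<lambda>n\<in>UNIV. fst \<omega> n) = PiM UNIV (\<lambda>n :: nat. distr P \<nu> (\<lambda>\<omega>. fst \<omega> n))"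
  proof -
    have "(\<lambda>\<omega> :: (nat \<Rightarrow> 'e) \<times> 'b. \<lambda>n\<in>UNIV. fst \<omega> n) = fst"
      by (rule ext) (simp add: restrict_def)
    then show ?thesis using distr_total_fst by (simp add: distr_total_coordinate env_law_def)
  qed
  then show ?thesis
    by (subst indep_vars_iff_distr_eq_PiM') auto
qed

lemma measurable_moment [measurable]: "offspring_moment p q \<in> borel_measurable \<nu>"
  unfolding offspring_moment_def using measurable_offspring by measurable

lemma nn_integral_total_coordinate:
  assumes "f \<in> borel_measurable \<nu>"
  shows "(\<integral>\<^sup>+ \<omega>. f (fst \<omega> n) \<partial>P) = integral\<^sup>N \<nu> f"
proof -
  have "integral\<^sup>N \<nu> f = integral\<^sup>N (distr P \<nu> (\<lambda>\<omega>. fst \<omega> n)) f" by (simp only: distr_total_coordinate)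
  also have "\<dots> = (\<integral>\<^sup>+ \<omega>. f (fst \<omega> n) \<partial>P)" using assms by (intro nn_integral_distr) auto
  finally show ?thesis by simp
qed

lemma AE_total_coordinate:
  assumes "{\<theta> \<in> space \<nu>. R \<theta>} \<in> sets \<nu>"
  shows "(AE \<omega> in P. R (fst \<omega> n)) \<longleftrightarrow> (AE \<theta> in \<nu>. R \<theta>)"
proof -
  have "(AE \<theta> in distr P \<nu> (\<lambda>\<omega>. fst \<omega> n). R \<theta>) \<longleftrightarrow> (AE \<omega> in P. R (fst \<omega> n))"
    using assms by (intro AE_distr_iff) auto
  then show ?thesis by (simp only: distr_total_coordinate)
qed

text \<open>Coordinates below n carry \<open>a\<close> and coordinate n carries \<open>b\<close>;
  both are put into one independent family so that the expectation of the product
  factorises.\<close>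

lemma nn_integral_prod_coordinates:
  assumes [measurable]: "a \<in> borel_measurable \<nu>" "b \<in> borel_measurable \<nu>"
  shows "(\<integral>\<^sup>+ \<xi>. (\<Prod>j<n. a (\<xi> j)) * b (\<xi> n) \<partial>\<tau>) = integral\<^sup>N \<nu> a ^ n * integral\<^sup>N \<nu> b"
proof -
  interpret prob_space P by (rule prob_space_total)
  define f where "f j = (if j < n then a else b)" for j
  have [measurable]: "f j \<in> borel_measurable \<nu>" for j by (simp add: f_def)
  have "indep_vars (\<lambda>_. borel) (\<lambda>j \<omega>. f j (fst \<omega> j)) UNIV"
    by (rule indep_vars_compose2[OF indep_total]) simp
  then have ind: "indep_vars (\<lambda>_. borel) (\<lambda>j \<omega>. f j (fst \<omega> j)) {..n}"
    by (rule indep_vars_subset) simp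
  have prod: "(\<Prod>j\<le>n. f j (\<xi> j)) = (\<Prod>j<n. a (\<xi> j)) * b (\<xi> n)" for \<xi> :: "nat \<Rightarrow> 'e"
    by (simp add: lessThan_Suc_atMost[symmetric] f_def)
  have "(\<integral>\<^sup>+ \<xi>. (\<Prod>j<n. a (\<xi> j)) * b (\<xi> n) \<partial>\<tau>) = (\<integral>\<^sup>+ \<omega>. (\<Prod>j<n. a (fst \<omega> j)) * b (fst \<omega> n) \<partial>P)"
    by (rule nn_integral_total_fst[symmetric]) measurable
  also have "\<dots> = (\<integral>\<^sup>+ \<omega>. (\<Prod>j\<le>n. f j (fst \<omega> j)) \<partial>P)" by (simp only: prod)
  also have "\<dots> = (\<Prod>j\<le>n. \<integral>\<^sup>+ \<omega>. f j (fst \<omega> j) \<partial>P)"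
    by (rule indep_vars_nn_integral[OF _ ind]) auto
  also have "\<dots> = (\<Prod>j\<le>n. integral\<^sup>N \<nu> (f j))"
    by (intro prod.cong refl nn_integral_total_coordinate) simp
  also have "\<dots> = integral\<^sup>N \<nu> a ^ n * integral\<^sup>N \<nu> b"
    by (simp add: lessThan_Suc_atMost[symmetric] f_def)
  finally show ?thesis .
qed

lemma measurable_population [measurable]: "branching V n \<in> \<Gamma> \<rightarrow>\<^sub>M count_space UNIV"
  by (rule measurable_branching[OF measurable_V])

lemma measurable_step_bound [measurable]: "step_bound p q t \<in> borel_measurable \<nu>"
  unfolding step_bound_def by measurable

text \<open>The quenched bound is a product over distinct coordinates of the environment, so
  averaging over the environment makes it geometric in n.\<close>

lemma annealed_step:
  assumes p0: "AE \<theta> in \<nu>. pmf (p \<theta>) 0 = 0" and m: "AE \<theta> in \<nu>. offspring_moment p 1 \<theta> < \<infinity>"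
    and mq: "AE \<theta> in \<nu>. offspring_moment p q \<theta> < \<infinity>"
    and q: "1 < q" "q \<le> 2" and t: "0 < t" "t \<le> 1"
  shows "AE \<omega> in P. \<forall>n. 1 \<le> branching V n (snd \<omega>)"
    and "(\<integral>\<^sup>+ \<omega>. ennreal ((ln (real (branching V (Suc n) (snd \<omega>))
        / (real (branching V n (snd \<omega>)) * enn2real (offspring_moment p 1 (fst \<omega> n)))))\<^sup>2) \<partial>P)
      \<le> integral\<^sup>N \<nu> (offspring_moment p (- ((q - 1) * t))) ^ n * integral\<^sup>N \<nu> (step_bound p q t)"
proof -
  have "AE \<theta> in \<nu>. pmf (p \<theta>) 0 = 0 \<and> offspring_moment p 1 \<theta> < \<infinity> \<and> offspring_moment p q \<theta> < \<infinity>"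
    using p0 m mq by eventually_elim simp
  then have "AE \<xi> in \<tau>. pmf (p (\<xi> n)) 0 = 0 \<and> offspring_moment p 1 (\<xi> n) < \<infinity> \<and> offspring_moment p q (\<xi> n) < \<infinity>" for n
    unfolding env_law_def by (intro AE_PiM_component[of UNIV "\<lambda>_. \<nu>"]) (auto intro: prob_env)
  then have good: "AE \<xi> in \<tau>. \<forall>n. pmf (p (\<xi> n)) 0 = 0 \<and> offspring_moment p 1 (\<xi> n) < \<infinity> \<and> offspring_moment p q (\<xi> n) < \<infinity>"
    by (subst AE_all_countable) blast
  have bounds: "AE \<xi> in \<tau>. (\<forall>n. AE x in Pq \<xi>. 1 \<le> branching V n x) \<and> (\<forall>n.
      (\<integral>\<^sup>+ x. ennreal ((ln (real (branching V (Suc n) x)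
        / (real (branching V n x) * enn2real (offspring_moment p 1 (\<xi> n)))))\<^sup>2) \<partial>Pq \<xi>)
      \<le> (\<Prod>j<n. offspring_moment p (- ((q - 1) * t)) (\<xi> j)) * step_bound p q t (\<xi> n))"
    using good quenched_law quenched_indep quenched_indep_past AE_space
  proof eventually_elim
    case (elim \<xi>)
    note Q = quenched_prob[OF elim(5)]
    have V: "V n i \<in> Pq \<xi> \<rightarrow>\<^sub>M count_space UNIV" if "1 \<le> i" for n i
      unfolding measurable_cong_sets[OF Q(2) refl] by (rule measurable_V[OF that])
    note bounds = quenched_bounds[where p = p and \<xi> = \<xi> and V = V and q = q and t = t, OF Q(1) V]
    show ?case
    proof (intro conjI allI)
      fix n
      show "AE x in Pq \<xi>. 1 \<le> branching V n x"
        by (rule bounds(1)) (use elim(1-4) q t in blast)+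
      show "(\<integral>\<^sup>+ x. ennreal ((ln (real (branching V (Suc n) x)
        / (real (branching V n x) * enn2real (offspring_moment p 1 (\<xi> n)))))\<^sup>2) \<partial>Pq \<xi>)
      \<le> (\<Prod>j<n. offspring_moment p (- ((q - 1) * t)) (\<xi> j)) * step_bound p q t (\<xi> n)"
        by (rule bounds(2)) (use elim(1-4) q t in blast)+
    qed
  qed
  have Fm: "(\<lambda>\<omega>. ennreal ((ln (real (branching V (Suc n) (snd \<omega>))
        / (real (branching V n (snd \<omega>)) * enn2real (offspring_moment p 1 (fst \<omega> n)))))\<^sup>2))
      \<in> borel_measurable (\<tau> \<Otimes>\<^sub>M \<Gamma>)"
    by measurable
  have "(\<integral>\<^sup>+ \<omega>. ennreal ((ln (real (branching V (Suc n) (snd \<omega>))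
        / (real (branching V n (snd \<omega>)) * enn2real (offspring_moment p 1 (fst \<omega> n)))))\<^sup>2) \<partial>P)
      = (\<integral>\<^sup>+ \<xi>. (\<integral>\<^sup>+ x. ennreal ((ln (real (branching V (Suc n) x)
        / (real (branching V n x) * enn2real (offspring_moment p 1 (\<xi> n)))))\<^sup>2) \<partial>Pq \<xi>) \<partial>\<tau>)"
    using nn_integral_total[OF Fm] by simp
  also have "\<dots> \<le> (\<integral>\<^sup>+ \<xi>. (\<Prod>j<n. offspring_moment p (- ((q - 1) * t)) (\<xi> j)) * step_bound p q t (\<xi> n) \<partial>\<tau>)"
  proof (rule nn_integral_mono_AE)
    show "AE \<xi> in \<tau>. (\<integral>\<^sup>+ x. ennreal ((ln (real (branching V (Suc n) x)
        / (real (branching V n x) * enn2real (offspring_moment p 1 (\<xi> n)))))\<^sup>2) \<partial>Pq \<xi>)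
      \<le> (\<Prod>j<n. offspring_moment p (- ((q - 1) * t)) (\<xi> j)) * step_bound p q t (\<xi> n)"
      using bounds by eventually_elim blast
  qed
  also have "\<dots> = integral\<^sup>N \<nu> (offspring_moment p (- ((q - 1) * t))) ^ n * integral\<^sup>N \<nu> (step_bound p q t)"
    by (rule nn_integral_prod_coordinates) measurable
  finally show "(\<integral>\<^sup>+ \<omega>. ennreal ((ln (real (branching V (Suc n) (snd \<omega>))
        / (real (branching V n (snd \<omega>)) * enn2real (offspring_moment p 1 (fst \<omega> n)))))\<^sup>2) \<partial>P)
      \<le> integral\<^sup>N \<nu> (offspring_moment p (- ((q - 1) * t))) ^ n * integral\<^sup>N \<nu> (step_bound p q t)" .
  \<comment> \<open>Positivity is known under almost every quenched law; it passes to the total law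
    because the expected indicator of extinction is 0.\<close>
  have "AE \<omega> in P. 1 \<le> branching V n (snd \<omega>)" for n
  proof -
    let ?h = "\<lambda>\<omega>. of_bool (branching V n (snd \<omega>) = 0) :: ennreal"
    have hm: "?h \<in> borel_measurable (\<tau> \<Otimes>\<^sub>M \<Gamma>)" by measurable
    have "(\<integral>\<^sup>+ \<omega>. ?h \<omega> \<partial>P) = (\<integral>\<^sup>+ \<xi>. (\<integral>\<^sup>+ x. of_bool (branching V n x = 0) \<partial>Pq \<xi>) \<partial>\<tau>)"
      using nn_integral_total[OF hm] by simp
    also have "\<dots> = (\<integral>\<^sup>+ \<xi>. 0 \<partial>\<tau>)"
    proof (rule nn_integral_cong_AE)
      show "AE \<xi> in \<tau>. (\<integral>\<^sup>+ x. of_bool (branching V n x = 0) \<partial>Pq \<xi>) = 0"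
        using bounds
      proof eventually_elim
        case (elim \<xi>)
        have "AE x in Pq \<xi>. of_bool (branching V n x = 0) = (0 :: ennreal)"
        proof -
          have "AE x in Pq \<xi>. 1 \<le> branching V n x" using elim by blast
          then show ?thesis by eventually_elim simp
        qed
        then have "(\<integral>\<^sup>+ x. of_bool (branching V n x = 0) \<partial>Pq \<xi>) = (\<integral>\<^sup>+ x. 0 \<partial>Pq \<xi>)"
          by (rule nn_integral_cong_AE)
        then show ?case by simp
      qed
    qed
    finally have "(\<integral>\<^sup>+ \<omega>. ?h \<omega> \<partial>P) = 0" by simp
    moreover have "?h \<in> borel_measurable P" by measurable
    ultimately have "AE \<omega> in P. ?h \<omega> = 0" by (simp only: nn_integral_0_iff_AE)
    then show ?thesis by (auto elim!: eventually_mono simp: Suc_le_eq)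
  qed
  then show "AE \<omega> in P. \<forall>n. 1 \<le> branching V n (snd \<omega>)"
    by (subst AE_all_countable) blast
qed

text \<open>The difference telescopes into the sum of the terms \<open>l k\<close>, whose second
  moments are at most A^k B with A < 1. Cauchy-Schwarz with weights s^k, where s^2 \<ge> A, bounds
  the second moment of the sum uniformly in n, since A^k/s^k \<le> s^k is still summable.\<close>

lemma log_population_bound:
  assumes p0: "AE \<theta> in \<nu>. pmf (p \<theta>) 0 = 0" and m: "AE \<theta> in \<nu>. offspring_moment p 1 \<theta> < \<infinity>"
    and m1: "AE \<theta> in \<nu>. 1 \<le> enn2real (offspring_moment p 1 \<theta>)"
    and mq: "AE \<theta> in \<nu>. offspring_moment p q \<theta> < \<infinity>"
    and q: "1 < q" "q \<le> 2" and t: "0 < t" "t \<le> 1"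
    and a: "integral\<^sup>N \<nu> (offspring_moment p (- ((q - 1) * t))) < 1"
    and b: "integral\<^sup>N \<nu> (step_bound p q t) < \<infinity>"
  obtains C where "0 \<le> C" "\<And>n. (\<integral>\<^sup>+ \<omega>. ennreal ((ln (real (branching V n (snd \<omega>)))
      - (\<Sum>k<n. ln (enn2real (offspring_moment p 1 (fst \<omega> k)))))\<^sup>2) \<partial>P) \<le> ennreal C"
proof -
  define l where "l k \<omega> = ln (real (branching V (Suc k) (snd \<omega>))
        / (real (branching V k (snd \<omega>)) * enn2real (offspring_moment p 1 (fst \<omega> k))))" for k and \<omega> :: "(nat \<Rightarrow> 'e) \<times> 'b"
  have l_meas [measurable]: "l k \<in> borel_measurable P" for k
  proof -
    have "l k \<in> borel_measurable (\<tau> \<Otimes>\<^sub>M \<Gamma>)" unfolding l_def by measurable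
    then show ?thesis unfolding measurable_cong_sets[OF sets_total refl] .
  qed
  define A B where "A = enn2real (integral\<^sup>N \<nu> (offspring_moment p (- ((q - 1) * t))))"
    and "B = enn2real (integral\<^sup>N \<nu> (step_bound p q t))"
  have A: "integral\<^sup>N \<nu> (offspring_moment p (- ((q - 1) * t))) = ennreal A" "0 \<le> A" "A < 1"
  proof -
    show 1: "integral\<^sup>N \<nu> (offspring_moment p (- ((q - 1) * t))) = ennreal A"
      unfolding A_def using a by (intro ennreal_enn2real[symmetric]) (auto intro: less_trans)
    show "0 \<le> A" by (simp add: A_def)
    then show "A < 1" using a unfolding 1 by (simp flip: ennreal_1 add: ennreal_less_iff)
  qed
  have B: "integral\<^sup>N \<nu> (step_bound p q t) = ennreal B" "0 \<le> B"
    using b by (simp_all add: B_def less_top)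
  \<comment> \<open>The maximum with 1/4 keeps s positive when A = 0, since \<open>CS\<close>
    divides by s^k.\<close>
  define s where "s = sqrt (max A (1 / 4))"
  have s: "0 < s" "s < 1" "A \<le> s\<^sup>2"
    using A by (simp_all add: s_def)
  have lk: "(\<integral>\<^sup>+ \<omega>. ennreal ((l k \<omega>)\<^sup>2) \<partial>P) \<le> ennreal (A ^ k * B)" for k
    using annealed_step(2)[OF p0 m mq q t, of k] A B
    by (simp only: l_def) (simp add: ennreal_mult ennreal_power)
  have geom: "(\<Sum>k<n. s ^ k) \<le> 1 / (1 - s)" for n
    using s sum_le_suminf[of "\<lambda>k. s ^ k" "{..<n}"] by (simp add: summable_geometric suminf_geometric)
  have CS: "(\<Sum>k<n. f k)\<^sup>2 \<le> (\<Sum>k<n. 1 / (1 - s) / s ^ k * (f k)\<^sup>2)" for f :: "nat \<Rightarrow> real" and n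
  proof -
    have "(\<Sum>k<n. f k)\<^sup>2 = (\<Sum>k<n. sqrt (s ^ k) * (f k / sqrt (s ^ k)))\<^sup>2"
      using s by simp
    also have "\<dots> \<le> (\<Sum>k<n. (sqrt (s ^ k))\<^sup>2) * (\<Sum>k<n. (f k / sqrt (s ^ k))\<^sup>2)"
      by (rule Cauchy_Schwarz_ineq_sum)
    also have "\<dots> = (\<Sum>k<n. s ^ k) * (\<Sum>k<n. (f k)\<^sup>2 / s ^ k)"
      using s by (simp add: power_divide)
    also have "\<dots> \<le> 1 / (1 - s) * (\<Sum>k<n. (f k)\<^sup>2 / s ^ k)"
      using s by (intro mult_right_mono geom sum_nonneg) auto
    also have "\<dots> = (\<Sum>k<n. 1 / (1 - s) / s ^ k * (f k)\<^sup>2)"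
      by (simp add: sum_distrib_left)
    finally show ?thesis .
  qed
  have mP: "AE \<omega> in P. 1 \<le> enn2real (offspring_moment p 1 (fst \<omega> k))" for k
    using m1 by (subst AE_total_coordinate) auto
  then have mP: "AE \<omega> in P. \<forall>k. 1 \<le> enn2real (offspring_moment p 1 (fst \<omega> k))"
    by (subst AE_all_countable) blast
  show ?thesis
  proof (rule that[of "B / (1 - s) / (1 - s)"])
    show "0 \<le> B / (1 - s) / (1 - s)" using B s by simp
    fix n
    have "(\<integral>\<^sup>+ \<omega>. ennreal ((ln (real (branching V n (snd \<omega>)))
      - (\<Sum>k<n. ln (enn2real (offspring_moment p 1 (fst \<omega> k)))))\<^sup>2) \<partial>P)
      \<le> (\<integral>\<^sup>+ \<omega>. (\<Sum>k<n. ennreal (1 / (1 - s) / s ^ k) * ennreal ((l k \<omega>)\<^sup>2)) \<partial>P)"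
    proof (rule nn_integral_mono_AE)
      show "AE \<omega> in P. ennreal ((ln (real (branching V n (snd \<omega>)))
        - (\<Sum>k<n. ln (enn2real (offspring_moment p 1 (fst \<omega> k)))))\<^sup>2)
        \<le> (\<Sum>k<n. ennreal (1 / (1 - s) / s ^ k) * ennreal ((l k \<omega>)\<^sup>2))"
        using mP annealed_step(1)[OF p0 m mq q t]
      proof eventually_elim
        case (elim \<omega>)
        have "ln (real (branching V n (snd \<omega>))) - (\<Sum>k<n. ln (enn2real (offspring_moment p 1 (fst \<omega> k)))) = (\<Sum>k<n. l k \<omega>)"
        proof (induction n)
          case (Suc n)
          have "1 \<le> branching V n (snd \<omega>)" "1 \<le> branching V (Suc n) (snd \<omega>)" using elim(2) by blast+
          then have "l n \<omega> = ln (real (branching V (Suc n) (snd \<omega>)))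
            - (ln (real (branching V n (snd \<omega>))) + ln (enn2real (offspring_moment p 1 (fst \<omega> n))))"
            unfolding l_def using spec[OF elim(1), of n] by (simp add: ln_div ln_mult del: branching.simps)
          then show ?case using Suc.IH by (simp del: branching.simps)
        qed simp
        then have "(ln (real (branching V n (snd \<omega>))) - (\<Sum>k<n. ln (enn2real (offspring_moment p 1 (fst \<omega> k)))))\<^sup>2
          \<le> (\<Sum>k<n. 1 / (1 - s) / s ^ k * (l k \<omega>)\<^sup>2)"
          using CS[of "\<lambda>k. l k \<omega>" n] by simp
        from ennreal_leI[OF this]
        have "ennreal ((ln (real (branching V n (snd \<omega>))) - (\<Sum>k<n. ln (enn2real (offspring_moment p 1 (fst \<omega> k)))))\<^sup>2)
          \<le> ennreal (\<Sum>k<n. 1 / (1 - s) / s ^ k * (l k \<omega>)\<^sup>2)" .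
        also have "\<dots> = (\<Sum>k<n. ennreal (1 / (1 - s) / s ^ k * (l k \<omega>)\<^sup>2))"
          by (rule sum_ennreal[symmetric]) (use s in simp)
        also have "\<dots> = (\<Sum>k<n. ennreal (1 / (1 - s) / s ^ k) * ennreal ((l k \<omega>)\<^sup>2))"
          by (intro sum.cong refl ennreal_mult) (use s in simp_all)
        finally show ?case .
      qed
    qed
    also have "\<dots> = (\<Sum>k<n. ennreal (1 / (1 - s) / s ^ k) * (\<integral>\<^sup>+ \<omega>. ennreal ((l k \<omega>)\<^sup>2) \<partial>P))"
      by (subst nn_integral_sum) (auto simp: nn_integral_cmult)
    also have "\<dots> \<le> (\<Sum>k<n. ennreal (B / (1 - s) * s ^ k))"
    proof (rule sum_mono)
      fix k
      have "ennreal (1 / (1 - s) / s ^ k) * (\<integral>\<^sup>+ \<omega>. ennreal ((l k \<omega>)\<^sup>2) \<partial>P)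
        \<le> ennreal (1 / (1 - s) / s ^ k) * ennreal (A ^ k * B)"
        by (intro mult_left_mono lk) auto
      also have "\<dots> = ennreal (1 / (1 - s) / s ^ k * (A ^ k * B))"
        using s by (subst ennreal_mult') auto
      also have "\<dots> \<le> ennreal (B / (1 - s) * s ^ k)"
      proof (rule ennreal_leI)
        have "A ^ k \<le> (s\<^sup>2) ^ k" using s A by (intro power_mono) auto
        also have "\<dots> = s ^ k * s ^ k" by (simp add: power2_eq_square power_mult_distrib)
        finally have "A ^ k / s ^ k \<le> s ^ k" using s by (simp add: divide_le_eq)
        then have "B / (1 - s) * (A ^ k / s ^ k) \<le> B / (1 - s) * s ^ k"
          using B s by (intro mult_left_mono) auto
        then show "1 / (1 - s) / s ^ k * (A ^ k * B) \<le> B / (1 - s) * s ^ k" by (simp add: mult.commute)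
      qed
      finally show "ennreal (1 / (1 - s) / s ^ k) * (\<integral>\<^sup>+ \<omega>. ennreal ((l k \<omega>)\<^sup>2) \<partial>P) \<le> ennreal (B / (1 - s) * s ^ k)" .
    qed
    also have "\<dots> = ennreal (B / (1 - s) * (\<Sum>k<n. s ^ k))"
      using B s by (subst sum_ennreal) (auto simp: sum_distrib_left)
    also have "\<dots> \<le> ennreal (B / (1 - s) * (1 / (1 - s)))"
      using B s by (intro ennreal_leI mult_left_mono geom) auto
    finally show "(\<integral>\<^sup>+ \<omega>. ennreal ((ln (real (branching V n (snd \<omega>)))
      - (\<Sum>k<n. ln (enn2real (offspring_moment p 1 (fst \<omega> k)))))\<^sup>2) \<partial>P) \<le> ennreal (B / (1 - s) / (1 - s))"
      by simp
  qed
qed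

end

section \<open>Wasserstein distances from one coupling\<close>

lemma wasserstein_le_of_cost:
  assumes Q: "Q \<in> couplings \<mu>\<^sub>1 \<mu>\<^sub>2" and cost: "(\<integral>\<^sup>+ z. ennreal (cost \<delta> (fst z - snd z)) \<partial>Q) \<le> ennreal D"
    and "0 < \<delta>" "\<delta> \<le> r" "r \<le> 2" "0 \<le> D"
  shows "r \<le> 1 \<Longrightarrow> wasserstein r \<mu>\<^sub>1 \<mu>\<^sub>2 \<le> ennreal D"
    and "1 < r \<Longrightarrow> wasserstein r \<mu>\<^sub>1 \<mu>\<^sub>2 \<le> ennreal (D powr (1 / r))"
proof -
  have "\<bar>d\<bar> powr r \<le> cost \<delta> d" for d :: real
  proof (cases "\<bar>d\<bar> \<le> 1")
    case True
    show ?thesis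
    proof (cases "d = 0")
      case False
      then have "\<bar>d\<bar> powr r \<le> \<bar>d\<bar> powr \<delta>" using True assms by (intro powr_mono') auto
      then show ?thesis by (simp add: cost_def add_increasing2)
    qed simp
  next
    case False
    then have "\<bar>d\<bar> powr r \<le> \<bar>d\<bar> powr 2" using assms by (intro powr_mono) auto
    also have "\<dots> = d\<^sup>2" using False by (simp add: powr_numeral)
    finally show ?thesis by (simp add: cost_def add_increasing)
  qed
  then have "(\<integral>\<^sup>+ z. ennreal (\<bar>fst z - snd z\<bar> powr r) \<partial>Q) \<le> (\<integral>\<^sup>+ z. ennreal (cost \<delta> (fst z - snd z)) \<partial>Q)"
    by (intro nn_integral_mono ennreal_leI)
  then have I: "(\<integral>\<^sup>+ z. ennreal (\<bar>fst z - snd z\<bar> powr r) \<partial>Q) \<le> ennreal D"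
    using cost by (rule order_trans)
  show "wasserstein r \<mu>\<^sub>1 \<mu>\<^sub>2 \<le> ennreal D" if "r \<le> 1"
    unfolding wasserstein_def using that I by (auto intro: INF_lower2[OF Q])
  show "wasserstein r \<mu>\<^sub>1 \<mu>\<^sub>2 \<le> ennreal (D powr (1 / r))" if "1 < r"
  proof -
    let ?I = "\<integral>\<^sup>+ z. ennreal (\<bar>fst z - snd z\<bar> powr r) \<partial>Q"
    have fin: "?I \<noteq> \<infinity>" using I by (auto simp: top_unique)
    have "enn2real ?I \<le> D" using I \<open>0 \<le> D\<close> by (simp add: enn2real_leI)
    then have "enn2real ?I powr (1 / r) \<le> D powr (1 / r)" using that by (intro powr_mono2) auto
    then have "ennpowr ?I (1 / r) \<le> ennreal (D powr (1 / r))"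
      using fin by (simp add: ennpowr_def ennreal_leI)
    then show ?thesis
      unfolding wasserstein_def using that by (auto intro: INF_lower2[OF Q])
  qed
qed

section \<open>Moment conditions on the environment\<close>

lemma abs_diff_powr_le:
  fixes x \<mu> r :: real
  assumes "0 \<le> x" "0 \<le> r"
  shows "\<bar>x - \<mu>\<bar> powr r \<le> 2 powr r * (x powr r + \<bar>\<mu>\<bar> powr r)"
proof -
  have "\<bar>x - \<mu>\<bar> powr r \<le> (2 * max x \<bar>\<mu>\<bar>) powr r"
    using assms by (intro powr_mono2) auto
  also have "\<dots> = 2 powr r * max x \<bar>\<mu>\<bar> powr r" using assms by (intro powr_mult)
  also have "\<dots> \<le> 2 powr r * (x powr r + \<bar>\<mu>\<bar> powr r)"
    by (intro mult_left_mono) (auto simp: max_def)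
  finally show ?thesis .
qed

lemma one_add_powr_le:
  fixes x r :: real
  assumes "0 \<le> x" "0 \<le> r"
  shows "(1 + x) powr r \<le> 2 powr r * (1 + x powr r)"
  using abs_diff_powr_le[of x r "- 1"] assms by (simp add: add.commute)

lemma ln_power4_le:
  fixes x c :: real
  assumes "1 \<le> x" "0 < c"
  shows "(ln x) ^ 4 \<le> (4 / c) ^ 4 * x powr c"
proof -
  have "ln x \<le> x powr (c / 4) / (c / 4)" using assms by (intro ln_powr_bound) auto
  then have "(ln x) ^ 4 \<le> (x powr (c / 4) / (c / 4)) ^ 4" using assms by (intro power_mono) auto
  also have "\<dots> = (x powr (c / 4)) ^ 4 * (4 / c) ^ 4" by (simp add: power_divide power_mult_distrib)
  also have "(x powr (c / 4)) ^ 4 = x powr c" using assms by (simp add: powr_power)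
  finally show ?thesis by (simp add: mult.commute)
qed

lemma offspring_mean_ge_1:
  assumes "pmf (p \<theta>) 0 = 0" "offspring_moment p 1 \<theta> < \<infinity>"
  shows "1 \<le> enn2real (offspring_moment p 1 \<theta>)"
proof -
  have "1 \<le> k" if "k \<in> set_pmf (p \<theta>)" for k using that assms(1) by (cases k) (auto simp: set_pmf_iff)
  then have "AE k in measure_pmf (p \<theta>). (1 :: real) \<le> real k powr 1" by (auto simp: AE_measure_pmf_iff)
  then have "(\<integral>k. 1 \<partial>measure_pmf (p \<theta>)) \<le> (\<integral>k. real k powr 1 \<partial>measure_pmf (p \<theta>))"
    by (intro integral_mono_AE offspring_moment_finite(1)[OF assms(2)]) auto
  then show ?thesis by (simp only: offspring_moment_finite(2)[OF assms(2)]) simp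
qed

lemma offspring_moment_neg_le_1:
  assumes "pmf (p \<theta>) 0 = 0" "0 \<le> \<eta>"
  shows "offspring_moment p (- \<eta>) \<theta> \<le> 1"
proof -
  have "real k powr (- \<eta>) \<le> 1" if "k \<in> set_pmf (p \<theta>)" for k
  proof -
    have "1 \<le> k" using that assms(1) by (cases k) (auto simp: set_pmf_iff)
    then have "real k powr (- \<eta>) \<le> real k powr 0" using assms by (intro powr_mono) auto
    then show ?thesis using \<open>1 \<le> k\<close> by simp
  qed
  then have "offspring_moment p (- \<eta>) \<theta> \<le> (\<integral>\<^sup>+ k. 1 \<partial>measure_pmf (p \<theta>))"
    unfolding offspring_moment_eq by (intro nn_integral_mono_AE) (auto simp: AE_measure_pmf_iff)
  then show ?thesis by (simp add: measure_pmf.emeasure_space_1[simplified])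
qed

text \<open>For k \<ge> 1 the power k^(-\<eta>) is at most 1, with equality only at k = 1; so a mean
  equal to 1 forces the offspring law to be the point mass at 1.\<close>

lemma offspring_moment_neg_eq_1:
  assumes p0: "pmf (p \<theta>) 0 = 0" and \<eta>: "0 < \<eta>" and 1: "offspring_moment p (- \<eta>) \<theta> = 1"
  shows "offspring_moment p 1 \<theta> = 1"
proof -
  have pos: "1 \<le> k" if "k \<in> set_pmf (p \<theta>)" for k using that p0 by (cases k) (auto simp: set_pmf_iff)
  have fin: "offspring_moment p (- \<eta>) \<theta> < \<infinity>" using 1 by simp
  have i: "integrable (measure_pmf (p \<theta>)) (\<lambda>k. 1 - real k powr (- \<eta>))"
    using offspring_moment_finite(1)[OF fin] by simp
  have nn: "0 \<le> 1 - real k powr (- \<eta>)" if "k \<in> set_pmf (p \<theta>)" for k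
  proof -
    have "real k powr (- \<eta>) \<le> real k powr 0" using \<eta> pos[OF that] by (intro powr_mono) auto
    then show ?thesis using pos[OF that] by simp
  qed
  have "(\<integral>k. 1 - real k powr (- \<eta>) \<partial>measure_pmf (p \<theta>)) = 0"
    using offspring_moment_finite[OF fin] 1 by simp
  then have "AE k in measure_pmf (p \<theta>). 1 - real k powr (- \<eta>) = 0"
    using i nn by (subst (asm) integral_nonneg_eq_0_iff_AE) (auto simp: AE_measure_pmf_iff)
  then have z: "real k powr (- \<eta>) = 1" if "k \<in> set_pmf (p \<theta>)" for k
    using that by (auto simp: AE_measure_pmf_iff)
  have "k = 1" if k: "k \<in> set_pmf (p \<theta>)" for k
  proof (rule ccontr)
    assume "k \<noteq> 1"
    then have "1 < real k" using pos[OF k] by simp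
    then have "real k powr (- \<eta>) < real k powr 0" using \<eta> by (intro powr_less_mono) auto
    then show False using z[OF k] \<open>1 < real k\<close> by simp
  qed
  then have "offspring_moment p 1 \<theta> = (\<integral>\<^sup>+ k. 1 \<partial>measure_pmf (p \<theta>))"
    unfolding offspring_moment_eq by (intro nn_integral_cong_AE) (auto simp: AE_measure_pmf_iff)
  then show ?thesis by (simp add: measure_pmf.emeasure_space_1[simplified])
qed

text \<open>Two orders occur: the hypotheses concern \<open>q\<close>, which may exceed 2, while the
  law of large numbers uses an order of at most 2; in the application \<open>q'\<close> is the
  minimum of \<open>q\<close> and 2. The condition 2 t \<le> c leaves room for squaring a power
  t.\<close>

context
  fixes p :: "'e \<Rightarrow> nat pmf" and \<theta> :: 'e and q q' c t :: real
  assumes p0: "pmf (p \<theta>) 0 = 0" and m: "offspring_moment p 1 \<theta> < \<infinity>" and mq: "offspring_moment p q \<theta> < \<infinity>"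
    and q: "1 < q'" "q' \<le> q" and c: "0 < c" and t: "0 < t" "2 * t \<le> c"
begin

private abbreviation (input) "m' \<equiv> enn2real (offspring_moment p 1 \<theta>)"

lemma offspring_moment_lower_finite: "offspring_moment p q' \<theta> < \<infinity>"
proof -
  have "real k powr q' \<le> 1 + real k powr q" for k
  proof (cases "k = 0")
    case False
    then have "real k powr q' \<le> real k powr q" using q by (intro powr_mono) auto
    then show ?thesis by simp
  qed simp
  then have "ennreal (real k powr q') \<le> 1 + ennreal (real k powr q)" for k
    by (simp add: ennreal_leI flip: ennreal_plus ennreal_1)
  then have "offspring_moment p q' \<theta> \<le> (\<integral>\<^sup>+ k. 1 + ennreal (real k powr q) \<partial>measure_pmf (p \<theta>))"
    unfolding offspring_moment_eq by (intro nn_integral_mono) auto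
  also have "\<dots> = 1 + offspring_moment p q \<theta>"
    unfolding offspring_moment_eq by (simp add: nn_integral_add measure_pmf.emeasure_space_1[simplified])
  also have "\<dots> < \<infinity>" using mq by (simp add: ennreal_add_eq_top less_top[symmetric] flip: ennreal_1)
  finally show ?thesis .
qed

text \<open>Pointwise x^\<open>q'\<close> \<le> 1 + x^q for x = k/\<open>m'\<close>; the
  normalisation by the mean has to be inside the power for the two normalised moments to
  appear.\<close>

lemma normalised_moment_le:
  "enn2real (offspring_moment p q' \<theta>) / m' powr q' \<le> 1 + enn2real (offspring_moment p q \<theta>) / m' powr q"
proof -
  have m1: "1 \<le> m'" by (rule offspring_mean_ge_1[OF p0 m])
  note fq = offspring_moment_finite[OF mq] and fq' = offspring_moment_finite[OF offspring_moment_lower_finite]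
  have le: "real k powr q' / m' powr q' \<le> 1 + real k powr q / m' powr q" for k
  proof -
    define x where "x = real k / m'"
    have x: "0 \<le> x" using m1 by (simp add: x_def)
    have "x powr q' \<le> 1 + x powr q"
    proof (cases "x \<le> 1")
      case True
      then have "x powr q' \<le> 1" using x q by (intro powr_le1) auto
      then show ?thesis by (simp add: add_increasing2)
    next
      case False
      then have "x powr q' \<le> x powr q" using q by (intro powr_mono) auto
      then show ?thesis by simp
    qed
    then show ?thesis using m1 by (simp add: x_def powr_divide)
  qed
  have "(\<integral>k. real k powr q' / m' powr q' \<partial>measure_pmf (p \<theta>)) \<le> (\<integral>k. 1 + real k powr q / m' powr q \<partial>measure_pmf (p \<theta>))"
    using fq(1) fq'(1) le by (intro integral_mono) auto
  then show ?thesis using fq fq' by simp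
qed

text \<open>The mean and the normalised moment are controlled only separately, so their product is
  split by x y \<le> x^2 + y^2. The squared logarithmic factor is at most 2 + 2 (ln
  \<open>m'\<close>)^4, hence below a multiple of 1 + \<open>m'\<close>^c, and M'^(2 t) \<le> (1 +
  M)^c because 2 t \<le> c.\<close>

lemma step_bound_le:
  "step_bound p q' t \<theta> \<le> ennreal (32 * (2 + 2 * (4 / c) ^ 4 + 2 powr c))
    * (1 + ennpowr (offspring_moment p 1 \<theta>) c + ennpowr (offspring_moment p q \<theta> / ennpowr (offspring_moment p 1 \<theta>) q) c)"
proof -
  define M M' where "M = enn2real (offspring_moment p q \<theta>) / m' powr q"
    and "M' = enn2real (offspring_moment p q' \<theta>) / m' powr q'"
  have m1: "1 \<le> m'" by (rule offspring_mean_ge_1[OF p0 m])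
  have M0: "0 \<le> M" "0 \<le> M'" by (simp_all add: M_def M'_def)
  have MM: "M' \<le> 1 + M" unfolding M_def M'_def by (rule normalised_moment_le)
  have e1: "ennpowr (offspring_moment p 1 \<theta>) c = ennreal (m' powr c)"
    using m by (simp add: ennpowr_def)
  have e2: "ennpowr (offspring_moment p q \<theta> / ennpowr (offspring_moment p 1 \<theta>) q) c = ennreal (M powr c)"
  proof -
    have "offspring_moment p q \<theta> / ennpowr (offspring_moment p 1 \<theta>) q
      = ennreal (enn2real (offspring_moment p q \<theta>)) / ennreal (m' powr q)"
      using m mq by (simp add: ennpowr_def)
    also have "\<dots> = ennreal M"
      unfolding M_def using m1 by (intro divide_ennreal) auto
    finally show ?thesis using M0 by (simp add: ennpowr_def)
  qed
  have "(1 + (ln m')\<^sup>2) * M' powr t \<le> (1 + (ln m')\<^sup>2)\<^sup>2 + (M' powr t)\<^sup>2"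
  proof -
    have "x * y \<le> x\<^sup>2 + y\<^sup>2" if "0 \<le> x" "0 \<le> y" for x y :: real
    proof -
      have "0 \<le> (x - y)\<^sup>2" by simp
      then have "2 * (x * y) \<le> x\<^sup>2 + y\<^sup>2" by (simp add: power2_eq_square algebra_simps)
      moreover have "0 \<le> x * y" using that by simp
      ultimately show ?thesis by linarith
    qed
    then show ?thesis by simp
  qed
  also have "(1 + (ln m')\<^sup>2)\<^sup>2 \<le> 2 + 2 * (ln m') ^ 4"
  proof -
    have "0 \<le> (1 - (ln m')\<^sup>2)\<^sup>2" by simp
    then show ?thesis by (simp add: power2_eq_square algebra_simps eval_nat_numeral)
  qed
  also have "(ln m') ^ 4 \<le> (4 / c) ^ 4 * m' powr c" by (rule ln_power4_le[OF m1 c])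
  also have "(M' powr t)\<^sup>2 \<le> 2 powr c * (1 + M powr c)"
  proof -
    have "(M' powr t)\<^sup>2 = M' powr (2 * t)"
      using M0 by (simp add: power2_eq_square powr_add[symmetric])
    also have "\<dots> \<le> (1 + M) powr (2 * t)" using MM M0 t by (intro powr_mono2) auto
    also have "\<dots> \<le> (1 + M) powr c" using M0 t by (intro powr_mono) auto
    also have "\<dots> \<le> 2 powr c * (1 + M powr c)" using M0 c by (intro one_add_powr_le) auto
    finally show ?thesis .
  qed
  finally have "(1 + (ln m')\<^sup>2) * M' powr t \<le> 2 + 2 * ((4 / c) ^ 4 * m' powr c) + 2 powr c * (1 + M powr c)"
    by simp
  also have "\<dots> \<le> (2 + 2 * (4 / c) ^ 4 + 2 powr c) * (1 + m' powr c + M powr c)"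
  proof -
    have "2 + 2 * (u * x) + w * (1 + y) \<le> (2 + 2 * u + w) * (1 + x + y)"
      if "0 \<le> u" "0 \<le> w" "0 \<le> x" "0 \<le> y" for u w x y :: real
    proof -
      have "(2 + 2 * u + w) * (1 + x + y) = 2 + 2 * (u * x) + w * (1 + y) + (2 * x + 2 * y + 2 * u + 2 * (u * y) + w * x)"
        by (simp add: algebra_simps)
      moreover have "0 \<le> 2 * x + 2 * y + 2 * u + 2 * (u * y) + w * x" using that by simp
      ultimately show ?thesis by linarith
    qed
    then show ?thesis by simp
  qed
  finally have "32 * ((1 + (ln m')\<^sup>2) * M' powr t) \<le> 32 * ((2 + 2 * (4 / c) ^ 4 + 2 powr c) * (1 + m' powr c + M powr c))"
    by (rule mult_left_mono) simp
  then have "ennreal (32 * (1 + (ln m')\<^sup>2) * M' powr t)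
    \<le> ennreal (32 * (2 + 2 * (4 / c) ^ 4 + 2 powr c) * (1 + m' powr c + M powr c))"
    by (intro ennreal_leI) (simp only: mult.assoc)
  also have "\<dots> = ennreal (32 * (2 + 2 * (4 / c) ^ 4 + 2 powr c)) * (1 + ennreal (m' powr c) + ennreal (M powr c))"
    by (subst ennreal_mult) (auto intro!: add_nonneg_nonneg mult_nonneg_nonneg)
  finally show ?thesis
    unfolding e1 e2 step_bound_def M'_def .
qed

end

section \<open>Supercriticality and the final coupling\<close>

context supercritical_bpre
begin

lemma AE_env:
  assumes "{\<theta> \<in> space \<nu>. R \<theta>} \<in> sets \<nu>" "AE \<omega> in P. R (fst \<omega> 0)"
  shows "AE \<theta> in \<nu>. R \<theta>"
  using AE_total_coordinate[OF assms(1), of 0] assms(2) by simp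

lemma no_extinction_env: "AE \<theta> in \<nu>. pmf (p \<theta>) 0 = 0"
  using measurable_offspring[of 0] by (intro AE_env no_extinction) measurable

lemma mean_finite_env: "AE \<theta> in \<nu>. offspring_moment p 1 \<theta> < \<infinity>"
  by (intro AE_env mean_finite) measurable

lemma mean_ge_1_env: "AE \<theta> in \<nu>. 1 \<le> enn2real (offspring_moment p 1 \<theta>)"
  using no_extinction_env mean_finite_env by eventually_elim (rule offspring_mean_ge_1)

text \<open>The integrand is at most 1 almost surely. If its mean were 1, almost every environment
  state would give exactly one child, so log m_0 = 0 almost surely, against \<mu> > 0.\<close>

lemma negative_moment_less_1:
  assumes \<eta>: "0 < \<eta>"
  shows "integral\<^sup>N \<nu> (offspring_moment p (- \<eta>)) < 1"
proof (rule ccontr)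
  interpret N: prob_space \<nu> by (rule prob_env)
  let ?a = "offspring_moment p (- \<eta>)"
  assume "\<not> ?thesis"
  then have ge: "1 \<le> integral\<^sup>N \<nu> ?a" by simp
  have le: "AE \<theta> in \<nu>. ?a \<theta> \<le> 1"
    using no_extinction_env by eventually_elim (use \<eta> in \<open>auto intro: offspring_moment_neg_le_1\<close>)
  then have "integral\<^sup>N \<nu> ?a \<le> (\<integral>\<^sup>+ \<theta>. 1 \<partial>\<nu>)" by (rule nn_integral_mono_AE)
  then have fin: "integral\<^sup>N \<nu> ?a \<noteq> \<infinity>" by (auto simp: N.emeasure_space_1 top_unique)
  have "(\<integral>\<^sup>+ \<theta>. 1 - ?a \<theta> \<partial>\<nu>) = (\<integral>\<^sup>+ \<theta>. 1 \<partial>\<nu>) - integral\<^sup>N \<nu> ?a"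
    using le fin by (intro nn_integral_diff) auto
  also have "\<dots> = 0" using ge by (simp add: N.emeasure_space_1 diff_eq_0_iff_ennreal less_top)
  finally have "AE \<theta> in \<nu>. 1 - ?a \<theta> = 0" by (subst (asm) nn_integral_0_iff_AE) auto
  with le no_extinction_env have "AE \<theta> in \<nu>. ln (enn2real (offspring_moment p 1 \<theta>)) = 0"
  proof eventually_elim
    case (elim \<theta>)
    then have "?a \<theta> = 1" by (metis diff_eq_0_iff_ennreal antisym)
    then have "offspring_moment p 1 \<theta> = 1" using elim \<eta> by (intro offspring_moment_neg_eq_1)
    then show ?case by simp
  qed
  then have "AE \<omega> in P. log_mean p \<omega> = 0"
    unfolding log_mean_def by (subst AE_total_coordinate) auto
  then have "drift \<nu> p \<Gamma> Pq = (\<integral>\<omega>. 0 \<partial>P)"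
    unfolding drift_def using integrable_log_mean by (intro integral_cong_AE) auto
  then show False using drift_pos by simp
qed

abbreviation "\<mu> \<equiv> drift \<nu> p \<Gamma> Pq"
abbreviation "\<sigma> \<equiv> volatility \<nu> p \<Gamma> Pq"

definition increment :: "nat \<Rightarrow> (nat \<Rightarrow> 'a) \<times> 'b \<Rightarrow> real" where
  "increment k \<omega> = (ln (enn2real (offspring_moment p 1 (fst \<omega> k))) - \<mu>) / \<sigma>"

lemma increment_0: "increment 0 \<omega> = (log_mean p \<omega> - \<mu>) / \<sigma>"
  by (simp add: increment_def log_mean_def)

lemma indep_increments: "prob_space.indep_vars P (\<lambda>_. borel) increment UNIV"
  unfolding increment_def[abs_def]
  by (rule prob_space.indep_vars_compose2[OF prob_space_total indep_total,
        where Y = "\<lambda>_ \<theta>. (ln (enn2real (offspring_moment p 1 \<theta>)) - \<mu>) / \<sigma>"]) measurable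

lemma distr_increment: "distr P borel (increment k) = distr P borel (increment 0)"
proof -
  have "distr P borel (increment k) = distr (distr P \<nu> (\<lambda>\<omega>. fst \<omega> k)) borel (\<lambda>\<theta>. (ln (enn2real (offspring_moment p 1 \<theta>)) - \<mu>) / \<sigma>)" for k
    by (subst distr_distr) (auto simp: comp_def increment_def[abs_def])
  then show ?thesis by (simp only: distr_total_coordinate)
qed

lemma normalised_increment:
  assumes \<delta>: "0 < \<delta>" "\<delta> < 1" and i: "integrable P (\<lambda>\<omega>. log_mean p \<omega> powr (2 + \<delta>))"
  shows "normalised_step P (increment 0) \<delta>"
proof -
  interpret prob_space P by (rule prob_space_total)
  \<comment> \<open>m_0 \<ge> 1, as every individual has a child. With this nonnegative base the
    power of \<open>log_mean\<close> dominates the power of |X - \<mu>| up to constants.\<close>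
  have pos: "AE \<omega> in P. 0 \<le> log_mean p \<omega>"
  proof -
    have "AE \<omega> in P. 1 \<le> enn2real (offspring_moment p 1 (fst \<omega> 0))"
      using mean_ge_1_env by (subst AE_total_coordinate) auto
    then show ?thesis unfolding log_mean_def by eventually_elim simp
  qed
  have [measurable]: "log_mean p \<in> borel_measurable P" using integrable_log_mean by simp
  show ?thesis
  proof
    show "increment 0 \<in> borel_measurable P" unfolding increment_0[abs_def] by measurable
    show "0 < \<delta>" "\<delta> \<le> 1" using \<delta> by auto
    have "integrable P (\<lambda>\<omega>. \<bar>log_mean p \<omega> - \<mu>\<bar> powr (2 + \<delta>))"
    proof (rule Bochner_Integration.integrable_bound)
      show "integrable P (\<lambda>\<omega>. 2 powr (2 + \<delta>) * (log_mean p \<omega> powr (2 + \<delta>) + \<bar>\<mu>\<bar> powr (2 + \<delta>)))"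
        using i by simp
      show "AE \<omega> in P. norm (\<bar>log_mean p \<omega> - \<mu>\<bar> powr (2 + \<delta>))
        \<le> norm (2 powr (2 + \<delta>) * (log_mean p \<omega> powr (2 + \<delta>) + \<bar>\<mu>\<bar> powr (2 + \<delta>)))"
        using pos by eventually_elim (use \<delta> in \<open>auto intro!: abs_diff_powr_le\<close>)
    qed measurable
    moreover have "\<bar>increment 0 \<omega>\<bar> powr (2 + \<delta>) = \<bar>log_mean p \<omega> - \<mu>\<bar> powr (2 + \<delta>) / \<sigma> powr (2 + \<delta>)" for \<omega>
      using volatility_pos by (simp add: increment_0 abs_divide powr_divide)
    ultimately show "integrable P (\<lambda>\<omega>. \<bar>increment 0 \<omega>\<bar> powr (2 + \<delta>))" by simp
    show "expectation (increment 0) = 0"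
      unfolding increment_0[abs_def] using integrable_log_mean by (simp add: drift_def prob_space)
    have "expectation (\<lambda>\<omega>. (log_mean p \<omega> - \<mu>)\<^sup>2) = \<sigma>\<^sup>2"
      unfolding volatility_def by (intro real_sqrt_pow2[symmetric] integral_nonneg_AE) auto
    then show "expectation (\<lambda>\<omega>. (increment 0 \<omega>)\<^sup>2) = 1"
      using volatility_pos
      by (simp only: increment_0 power_divide Bochner_Integration.integral_divide_zero) simp
  qed
qed

lemma log_population_bounded:
  assumes q: "1 < q" and c: "0 < c"
    and mc: "(\<integral>\<^sup>+ \<omega>. ennpowr (offspring_moment p 1 (fst \<omega> 0)) c \<partial>P) < \<infinity>"
    and Mc: "(\<integral>\<^sup>+ \<omega>. ennpowr (offspring_moment p q (fst \<omega> 0) / ennpowr (offspring_moment p 1 (fst \<omega> 0)) q) c \<partial>P) < \<infinity>"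
  obtains C where "0 \<le> C" "\<And>n. (\<integral>\<^sup>+ \<omega>. ennreal ((ln (real (branching V n (snd \<omega>)))
      - (\<Sum>k<n. ln (enn2real (offspring_moment p 1 (fst \<omega> k)))))\<^sup>2) \<partial>P) \<le> ennreal C"
proof -
  have ennpowr_meas [measurable]: "(\<lambda>x. ennpowr x a) \<in> borel_measurable borel" for a
    unfolding ennpowr_def by measurable
  let ?M = "\<lambda>\<theta>. ennpowr (offspring_moment p q \<theta> / ennpowr (offspring_moment p 1 \<theta>) q) c"
  have mc': "(\<integral>\<^sup>+ \<theta>. ennpowr (offspring_moment p 1 \<theta>) c \<partial>\<nu>) < \<infinity>"
    using mc by (subst (asm) nn_integral_total_coordinate) auto
  have Mc': "(\<integral>\<^sup>+ \<theta>. ?M \<theta> \<partial>\<nu>) < \<infinity>"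
    using Mc by (subst (asm) nn_integral_total_coordinate[of ?M]) auto
  \<comment> \<open>As the mean is finite, an infinite moment of order q would make the normalised
    moment infinite; so the integrability hypothesis yields a finite moment of order q almost
    surely.\<close>
  have "AE \<theta> in \<nu>. ?M \<theta> \<noteq> \<infinity>"
    using Mc' by (intro nn_integral_noteq_infinite) auto
  with mean_finite_env have mq: "AE \<theta> in \<nu>. offspring_moment p q \<theta> < \<infinity>"
  proof eventually_elim
    case (elim \<theta>)
    then show ?case
      by (auto simp: ennpowr_def less_top[symmetric] ennreal_top_divide split: if_splits)
  qed
  \<comment> \<open>\<open>q'\<close> \<le> 2 is the range of the law of large numbers, t \<le> 1
    that of \<open>min_one_le_powr\<close>, and 2 t \<le> c is required by
    \<open>step_bound_le\<close>.\<close>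
  define q' t where "q' = min q 2" and "t = min 1 (c / 2)"
  have q': "1 < q'" "q' \<le> 2" "q' \<le> q" using q by (auto simp: q'_def)
  have t: "0 < t" "t \<le> 1" "2 * t \<le> c" using c by (auto simp: t_def)
  have mq': "AE \<theta> in \<nu>. offspring_moment p q' \<theta> < \<infinity>"
    using no_extinction_env mean_finite_env mq
    by eventually_elim (rule offspring_moment_lower_finite[OF _ _ _ q'(1,3) c t(1,3)])
  define K where "K = 32 * (2 + 2 * (4 / c) ^ 4 + 2 powr c)"
  have "integral\<^sup>N \<nu> (step_bound p q' t) \<le> (\<integral>\<^sup>+ \<theta>. ennreal K * (1 + ennpowr (offspring_moment p 1 \<theta>) c + ?M \<theta>) \<partial>\<nu>)"
  proof (rule nn_integral_mono_AE)
    show "AE \<theta> in \<nu>. step_bound p q' t \<theta> \<le> ennreal K * (1 + ennpowr (offspring_moment p 1 \<theta>) c + ?M \<theta>)"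
      using no_extinction_env mean_finite_env mq
      unfolding K_def by eventually_elim (rule step_bound_le[OF _ _ _ q'(1,3) c t(1,3)])
  qed
  also have "\<dots> = ennreal K * (1 + (\<integral>\<^sup>+ \<theta>. ennpowr (offspring_moment p 1 \<theta>) c \<partial>\<nu>) + (\<integral>\<^sup>+ \<theta>. ?M \<theta> \<partial>\<nu>))"
    by (subst nn_integral_cmult, measurable, subst nn_integral_add, measurable, subst nn_integral_add)
      (auto simp: prob_space.emeasure_space_1[OF prob_env])
  also have "\<dots> < \<infinity>" using mc' Mc' by (simp add: ennreal_mult_less_top)
  finally have fin: "integral\<^sup>N \<nu> (step_bound p q' t) < \<infinity>" .
  have "integral\<^sup>N \<nu> (offspring_moment p (- ((q' - 1) * t))) < 1"
    using q' t by (intro negative_moment_less_1) auto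
  from log_population_bound[OF no_extinction_env mean_finite_env mean_ge_1_env mq' q'(1,2) t(1,2) this fin]
  show ?thesis using that by blast
qed

text \<open>The normalised logarithm of the population differs from the normalised walk by
  \<open>L\<close>/(\<sigma> sqrt n), where the second moment of \<open>L\<close> is bounded
  uniformly in n. By \<open>cost_divide_le\<close> the division by sqrt n gives this difference a
  cost of order n^(-\<delta>/2), the same as that of \<open>clt_coupling\<close>.\<close>

lemma coupling_bound:
  assumes \<delta>: "0 < \<delta>" "\<delta> < 1" and i: "integrable P (\<lambda>\<omega>. log_mean p \<omega> powr (2 + \<delta>))"
    and q: "1 < q" and c: "0 < c"
    and mc: "(\<integral>\<^sup>+ \<omega>. ennpowr (offspring_moment p 1 (fst \<omega> 0)) c \<partial>P) < \<infinity>"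
    and Mc: "(\<integral>\<^sup>+ \<omega>. ennpowr (offspring_moment p q (fst \<omega> 0) / ennpowr (offspring_moment p 1 (fst \<omega> 0)) q) c \<partial>P) < \<infinity>"
  obtains C where "0 < C" "\<And>n. 1 \<le> n \<Longrightarrow>
    \<exists>Q\<in>couplings (distr P borel (normalized_log_Z \<nu> p \<Gamma> Pq V n)) std_normal_distribution.
      (\<integral>\<^sup>+ z. ennreal (cost \<delta> (fst z - snd z)) \<partial>Q) \<le> ennreal (C * n powr (- \<delta> / 2))"
proof -
  interpret prob_space P by (rule prob_space_total)
  obtain C\<^sub>1 where C1: "0 < C\<^sub>1" "\<And>n A. 1 \<le> n \<Longrightarrow> A \<in> borel_measurable P \<Longrightarrow>
    \<exists>Q\<in>couplings (distr P borel A) std_normal_distribution.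
      (\<integral>\<^sup>+ z. ennreal (cost \<delta> (fst z - snd z)) \<partial>Q)
        \<le> ennreal (C\<^sub>1 * n powr (- \<delta> / 2))
          + 8 * (\<integral>\<^sup>+ m. ennreal (cost \<delta> (A m - (\<Sum>i<n. increment i m) / sqrt n)) \<partial>P)"
    using clt_coupling[OF prob_space_total indep_increments distr_increment normalised_increment[OF \<delta> i]] by blast
  obtain C\<^sub>2 where C2: "0 \<le> C\<^sub>2" "\<And>n. (\<integral>\<^sup>+ \<omega>. ennreal ((ln (real (branching V n (snd \<omega>)))
      - (\<Sum>k<n. ln (enn2real (offspring_moment p 1 (fst \<omega> k)))))\<^sup>2) \<partial>P) \<le> ennreal C\<^sub>2"
    using log_population_bounded[OF q c mc Mc] by blast
  have \<sigma>: "0 < \<sigma>" by (rule volatility_pos)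
  define C where "C = C\<^sub>1 + 8 * (2 * (1 + C\<^sub>2 / \<sigma>\<^sup>2))"
  show ?thesis
  proof (rule that[of C])
    show "0 < C" using C1(1) C2(1) by (simp add: C_def add_pos_nonneg)
    fix n :: nat assume n: "1 \<le> n"
    define L where "L \<omega> = ln (real (branching V n (snd \<omega>))) - (\<Sum>k<n. ln (enn2real (offspring_moment p 1 (fst \<omega> k))))"
      for \<omega> :: "(nat \<Rightarrow> 'a) \<times> 'b"
    have [measurable]: "(\<lambda>\<omega>. branching V n (snd \<omega>)) \<in> P \<rightarrow>\<^sub>M count_space UNIV"
      by (rule measurable_compose[OF measurable_snd_total measurable_population])
    have [measurable]: "(\<lambda>\<omega>. offspring_moment p 1 (fst \<omega> k)) \<in> borel_measurable P" for k
      by measurable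
    have [measurable]: "L \<in> borel_measurable P" unfolding L_def by measurable
    have A [measurable]: "normalized_log_Z \<nu> p \<Gamma> Pq V n \<in> borel_measurable P"
      unfolding normalized_log_Z_def[abs_def] by measurable
    have diff: "normalized_log_Z \<nu> p \<Gamma> Pq V n \<omega> - (\<Sum>i<n. increment i \<omega>) / sqrt n = L \<omega> / \<sigma> / sqrt n" for \<omega>
    proof -
      have "(\<Sum>i<n. increment i \<omega>) = ((\<Sum>k<n. ln (enn2real (offspring_moment p 1 (fst \<omega> k)))) - n * \<mu>) / \<sigma>"
        by (simp add: increment_def sum_divide_distrib[symmetric] sum_subtractf)
      then show ?thesis
        by (simp add: normalized_log_Z_def L_def diff_divide_distrib mult.commute)
    qed
    define x where "x = real n powr (- \<delta> / 2)"
    have x0: "0 \<le> x" by (simp add: x_def)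
    have "(\<integral>\<^sup>+ \<omega>. ennreal (cost \<delta> (normalized_log_Z \<nu> p \<Gamma> Pq V n \<omega> - (\<Sum>i<n. increment i \<omega>) / sqrt n)) \<partial>P)
      \<le> (\<integral>\<^sup>+ \<omega>. ennreal (2 * x) * (1 + ennreal (1 / \<sigma>\<^sup>2) * ennreal ((L \<omega>)\<^sup>2)) \<partial>P)"
    proof (rule nn_integral_mono)
      fix \<omega>
      have "cost \<delta> (L \<omega> / \<sigma> / sqrt n) \<le> sqrt n powr (- \<delta>) * cost \<delta> (L \<omega> / \<sigma>)"
        using \<delta> n by (intro cost_divide_le) auto
      also have "sqrt n powr (- \<delta>) = x"
        using n by (simp add: x_def powr_half_sqrt[symmetric] powr_powr)
      also have "x * cost \<delta> (L \<omega> / \<sigma>) \<le> x * (2 * (1 + (L \<omega> / \<sigma>)\<^sup>2))"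
        using \<delta> x0 by (intro mult_left_mono cost_le) auto
      also have "\<dots> = (2 * x) * (1 + (1 / \<sigma>\<^sup>2) * (L \<omega>)\<^sup>2)" by (simp add: power_divide)
      finally have "ennreal (cost \<delta> (L \<omega> / \<sigma> / sqrt n)) \<le> ennreal ((2 * x) * (1 + (1 / \<sigma>\<^sup>2) * (L \<omega>)\<^sup>2))"
        by (rule ennreal_leI)
      also have "\<dots> = ennreal (2 * x) * (1 + ennreal (1 / \<sigma>\<^sup>2) * ennreal ((L \<omega>)\<^sup>2))"
      proof -
        have "ennreal (1 + (1 / \<sigma>\<^sup>2) * (L \<omega>)\<^sup>2) = 1 + ennreal (1 / \<sigma>\<^sup>2) * ennreal ((L \<omega>)\<^sup>2)"
          by (subst ennreal_plus) (auto simp del: times_divide_eq_left intro!: ennreal_mult)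
        then show ?thesis using x0 by (subst ennreal_mult) auto
      qed
      finally show "ennreal (cost \<delta> (normalized_log_Z \<nu> p \<Gamma> Pq V n \<omega> - (\<Sum>i<n. increment i \<omega>) / sqrt n))
        \<le> ennreal (2 * x) * (1 + ennreal (1 / \<sigma>\<^sup>2) * ennreal ((L \<omega>)\<^sup>2))"
        unfolding diff .
    qed
    also have "\<dots> = ennreal (2 * x) * (1 + ennreal (1 / \<sigma>\<^sup>2) * (\<integral>\<^sup>+ \<omega>. ennreal ((L \<omega>)\<^sup>2) \<partial>P))"
      by (subst nn_integral_cmult, measurable, subst nn_integral_add, simp, measurable, subst nn_integral_cmult)
        (auto simp: emeasure_space_1)
    also have "\<dots> \<le> ennreal (2 * x) * (1 + ennreal (1 / \<sigma>\<^sup>2) * ennreal C\<^sub>2)"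
      unfolding L_def by (intro mult_left_mono add_left_mono C2(2)) auto
    also have "\<dots> = ennreal (2 * (1 + C\<^sub>2 / \<sigma>\<^sup>2) * x)"
    proof -
      have "1 + ennreal (1 / \<sigma>\<^sup>2) * ennreal C\<^sub>2 = ennreal (1 + C\<^sub>2 / \<sigma>\<^sup>2)"
        using C2(1) by (simp add: ennreal_mult[symmetric])
      then show ?thesis
        using C2(1) x0 by (simp only:) (subst ennreal_mult[symmetric], auto simp: mult_ac)
    qed
    finally have bd: "(\<integral>\<^sup>+ \<omega>. ennreal (cost \<delta> (normalized_log_Z \<nu> p \<Gamma> Pq V n \<omega> - (\<Sum>i<n. increment i \<omega>) / sqrt n)) \<partial>P)
      \<le> ennreal (2 * (1 + C\<^sub>2 / \<sigma>\<^sup>2) * x)" .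
    obtain Q where Q: "Q \<in> couplings (distr P borel (normalized_log_Z \<nu> p \<Gamma> Pq V n)) std_normal_distribution"
      "(\<integral>\<^sup>+ z. ennreal (cost \<delta> (fst z - snd z)) \<partial>Q) \<le> ennreal (C\<^sub>1 * x)
          + 8 * (\<integral>\<^sup>+ m. ennreal (cost \<delta> (normalized_log_Z \<nu> p \<Gamma> Pq V n m - (\<Sum>i<n. increment i m) / sqrt n)) \<partial>P)"
      using C1(2)[OF n A] unfolding x_def by blast
    note Q(2)
    also have "ennreal (C\<^sub>1 * x) + 8 * (\<integral>\<^sup>+ m. ennreal (cost \<delta> (normalized_log_Z \<nu> p \<Gamma> Pq V n m - (\<Sum>i<n. increment i m) / sqrt n)) \<partial>P)
      \<le> ennreal (C\<^sub>1 * x) + 8 * ennreal (2 * (1 + C\<^sub>2 / \<sigma>\<^sup>2) * x)"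
      by (intro add_left_mono mult_left_mono bd) auto
    also have "\<dots> = ennreal (C * x)"
    proof -
      have "8 * ennreal (2 * (1 + C\<^sub>2 / \<sigma>\<^sup>2) * x) = ennreal (8 * (2 * (1 + C\<^sub>2 / \<sigma>\<^sup>2) * x))"
        using C2(1) x0 by (subst ennreal_mult) auto
      then show ?thesis
        using C1(1) C2(1) x0
        by (simp only: C_def distrib_right mult.assoc) (subst ennreal_plus, auto)
    qed
    finally show "\<exists>Q\<in>couplings (distr P borel (normalized_log_Z \<nu> p \<Gamma> Pq V n)) std_normal_distribution.
      (\<integral>\<^sup>+ z. ennreal (cost \<delta> (fst z - snd z)) \<partial>Q) \<le> ennreal (C * n powr (- \<delta> / 2))"
      using Q(1) unfolding x_def by blast
  qed
qed

end

theorem corollary2p2: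
  fixes \<nu> :: "'e measure"
    and p :: "'e \<Rightarrow> nat pmf"
    and \<Gamma> :: "'b measure"
    and Pq :: "(nat \<Rightarrow> 'e) \<Rightarrow> 'b measure"
    and V :: "nat \<Rightarrow> nat \<Rightarrow> 'b \<Rightarrow> nat"
    and M :: "'c measure"
    and N :: "'c \<Rightarrow> real"
    and \<delta> q c :: real
  defines "P \<equiv> total_law \<nu> \<Gamma> Pq"
  assumes "supercritical_bpre \<nu> p \<Gamma> Pq V"
    and "0 < \<delta>" "\<delta> < 1"
    and "integrable P (\<lambda>\<omega>. log_mean p \<omega> powr (2 + \<delta>))"
    and "q > 1" and "c > 0"
    and "(\<integral>\<^sup>+ \<omega>. ennpowr (offspring_moment p 1 (fst \<omega> 0)) c \<partial>P) < \<infinity>"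
    and "(\<integral>\<^sup>+ \<omega>. ennpowr (offspring_moment p q (fst \<omega> 0)
            / ennpowr (offspring_moment p 1 (fst \<omega> 0)) q) c \<partial>P) < \<infinity>"
    and "prob_space M" and "distributed M lborel N std_normal_density"
  shows "(\<forall>r\<in>{\<delta>..1}. \<exists>C>0. \<forall>n\<ge>1.
            wasserstein_rv r P (normalized_log_Z \<nu> p \<Gamma> Pq V n) M N
              \<le> ennreal (C / real n powr (\<delta> / 2)))
       \<and> (\<forall>r\<in>{1<..2}. \<exists>C>0. \<forall>n\<ge>1.
            wasserstein_rv r P (normalized_log_Z \<nu> p \<Gamma> Pq V n) M N
              \<le> ennreal (C / real n powr (\<delta> / (2 * r))))"
proof -
  interpret S: supercritical_bpre \<nu> p \<Gamma> Pq V by fact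
  note \<delta> = \<open>0 < \<delta>\<close> \<open>\<delta> < 1\<close>
  have N: "distr M borel N = std_normal_distribution"
    using distributed_distr_eq_density[OF assms(11)] by (simp cong: distr_cong)
  obtain C where C: "0 < C" "\<And>n. 1 \<le> n \<Longrightarrow>
    \<exists>Q\<in>couplings (distr P borel (normalized_log_Z \<nu> p \<Gamma> Pq V n)) std_normal_distribution.
      (\<integral>\<^sup>+ z. ennreal (cost \<delta> (fst z - snd z)) \<partial>Q) \<le> ennreal (C * n powr (- \<delta> / 2))"
    using S.coupling_bound[OF \<delta> assms(5)[unfolded P_def] assms(6,7) assms(8,9)[unfolded P_def]]
    unfolding P_def by blast
  have rate: "C * n powr (- \<delta> / 2) = C / n powr (\<delta> / 2)" for n :: nat
    using powr_minus_divide[of "real n" "\<delta> / 2"] by simp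
  have 1: "wasserstein_rv r P (normalized_log_Z \<nu> p \<Gamma> Pq V n) M N \<le> ennreal (C / real n powr (\<delta> / 2))"
    if rn: "r \<in> {\<delta>..1}" "1 \<le> n" for r n
  proof -
    obtain Q where Q: "Q \<in> couplings (distr P borel (normalized_log_Z \<nu> p \<Gamma> Pq V n)) std_normal_distribution"
      "(\<integral>\<^sup>+ z. ennreal (cost \<delta> (fst z - snd z)) \<partial>Q) \<le> ennreal (C / real n powr (\<delta> / 2))"
      using C(2)[OF \<open>1 \<le> n\<close>] unfolding rate by blast
    show ?thesis
      unfolding wasserstein_rv_def N
      using rn C(1) \<delta> by (intro wasserstein_le_of_cost(1)[OF Q]) auto
  qed
  have 2: "wasserstein_rv r P (normalized_log_Z \<nu> p \<Gamma> Pq V n) M N \<le> ennreal (C powr (1 / r) / real n powr (\<delta> / (2 * r)))"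
    if rn: "r \<in> {1<..2}" "1 \<le> n" for r n
  proof -
    obtain Q where Q: "Q \<in> couplings (distr P borel (normalized_log_Z \<nu> p \<Gamma> Pq V n)) std_normal_distribution"
      "(\<integral>\<^sup>+ z. ennreal (cost \<delta> (fst z - snd z)) \<partial>Q) \<le> ennreal (C / real n powr (\<delta> / 2))"
      using C(2)[OF \<open>1 \<le> n\<close>] unfolding rate by blast
    \<comment> \<open>The root of order r in the definition of the distance for r > 1 slows the rate
      to n^(-\<delta>/(2 r)).\<close>
    have "(C / real n powr (\<delta> / 2)) powr (1 / r) = C powr (1 / r) / real n powr (\<delta> / (2 * r))"
      using C(1) rn by (simp add: powr_divide powr_powr)
    moreover have "wasserstein r (distr P borel (normalized_log_Z \<nu> p \<Gamma> Pq V n)) std_normal_distribution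
        \<le> ennreal ((C / real n powr (\<delta> / 2)) powr (1 / r))"
      using rn C(1) \<delta> by (intro wasserstein_le_of_cost(2)[OF Q]) auto
    ultimately show ?thesis unfolding wasserstein_rv_def N by simp
  qed
  show ?thesis
  proof (intro conjI ballI)
    fix r assume "r \<in> {\<delta>..1}"
    then show "\<exists>C>0. \<forall>n\<ge>1. wasserstein_rv r P (normalized_log_Z \<nu> p \<Gamma> Pq V n) M N
              \<le> ennreal (C / real n powr (\<delta> / 2))"
      using 1 C(1) by blast
  next
    fix r :: real assume r: "r \<in> {1<..2}"
    show "\<exists>C>0. \<forall>n\<ge>1. wasserstein_rv r P (normalized_log_Z \<nu> p \<Gamma> Pq V n) M N
              \<le> ennreal (C / real n powr (\<delta> / (2 * r)))"
      using 2[OF r] C(1) by (intro exI[of _ "C powr (1 / r)"]) auto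
  qed
qed

end
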